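(* Let $r\ge2$ and let $\mathcal{P}=\{P,Q\}$ be a set of two distinct $r$-patterns. Then: (i) if $P$ and $Q$ are harmonious, there are constants $0<c<C$ such that asymptotically almost surely $c\,n^{1/(r-1)}\le z_{\mathcal P}(\mathbb{RM}^{(r)}_{n})\le C\,n^{1/(r-1)}$; (ii) if $P$ and $Q$ form a mismatch, there are constants $0<c<C$ such that asymptotically almost surely $c\,n^{1/r}\le z_{\mathcal P}(\mathbb{RM}^{(r)}_{n})\le C\,n^{1/r}$; (iii) if neither $P$ nor $Q$ is collectable, then asymptotically almost surely $z_{\mathcal P}(\mathbb{RM}^{(r)}_{n})=z$, where $z=z_{\mathcal P}$ is an integer (depending only on $\mathcal P$) with $2\le z\le 5$.
   Context: An ordered $r$-matching of size $n$ is a set of $n$ pairwise disjoint $r$-element subsets (edges) of a linearly ordered set of $rn$ vertices (every vertex lies in an edge). Two ordered hypergraphs are order-isomorphic if there is an isomorphism between them preserving the linear orders. An $r$-pattern is an ordered $r$-matching of size 2 (up to order-isomorphism), written as a word of length $2r$ in letters $A,B$, each occurring $r$ times, beginning with $A$ (positions of $A$ form one edge, positions of $B$ the other). An $r$-pattern $P$ is collectable if it can be split into consecutive blocks $P=S_1\cdots S_s$ where each block is of the form $A^tB^t$ or $B^tA^t$ for some $t\ge1$ (depending on the block); equivalently, there exist $P$-cliques of every size. This splitting is unique, and $\lambda_P=(\lambda_1,\dots,\lambda_s)$ with $\lambda_i=|S_i|/2$ is the composition of $P$. Two distinct collectable $r$-patterns are harmonious if they have the same composition. A pair $\{P,Q\}$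 of $r$-patterns is a mismatch if one of them is collectable and the other is not, or both are collectable but not harmonious (different compositions). For a set $\mathcal{P}$ of $r$-patterns, a $\mathcal{P}$-clique is an ordered $r$-matching in which every pair of edges is order-isomorphic to a member of $\mathcal{P}$; $z_{\mathcal{P}}(M)$ is the maximum size of a $\mathcal{P}$-clique that is a sub-matching of the ordered $r$-matching $M$. $\mathbb{RM}^{(r)}_n$ is an ordered $r$-matching chosen uniformly at random among all ordered $r$-matchings on $[rn]$ with its natural order. "Asymptotically almost surely" means with probability tending to $1$ as $n\to\infty$. *)

theory Defs
  imports "HOL-Probability.Probability"
begin

section \<open>Ordered matchings\<close>

text \<open>A hypergraph without isolated vertices is represented by its set of edges; its vertex set is
  the union of the edges, ordered by the order of the ambient type.\<close>

definition ordered_matching :: "nat \<Rightarrow> 'a::linorder set set \<Rightarrow> bool" where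
  "ordered_matching r M \<longleftrightarrow>
     finite M \<and> (\<forall>e\<in>M. finite e \<and> card e = r) \<and> pairwise disjnt M"

definition order_isomorphic :: "'a::linorder set set \<Rightarrow> 'b::linorder set set \<Rightarrow> bool" where
  "order_isomorphic E F \<longleftrightarrow>
     (\<exists>\<phi>. bij_betw \<phi> (\<Union>E) (\<Union>F) \<and> strict_mono_on (\<Union>E) \<phi> \<and> (\<lambda>e. \<phi> ` e) ` E = F)"

definition matchings :: "nat \<Rightarrow> nat \<Rightarrow> nat set set set" where
  "matchings r n = {M. ordered_matching r M \<and> card M = n \<and> \<Union>M = {1..r * n}}"

definition RM :: "nat \<Rightarrow> nat \<Rightarrow> nat set set pmf" where
  "RM r n = pmf_of_set (matchings r n)"

text \<open>The property may depend on \<open>n\<close> as well as on the random matching.\<close>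

definition aas :: "nat \<Rightarrow> (nat \<Rightarrow> nat set set \<Rightarrow> bool) \<Rightarrow> bool" where
  "aas r \<Phi> \<longleftrightarrow> (\<lambda>n. measure_pmf.prob (RM r n) {M. \<Phi> n M}) \<longlonglongrightarrow> 1"

section \<open>Patterns\<close>

datatype letter = LA | LB

type_synonym pattern = "letter list"

definition r_pattern :: "nat \<Rightarrow> pattern \<Rightarrow> bool" where
  "r_pattern r P \<longleftrightarrow>
     length P = 2 * r \<and> count_list P LA = r \<and> count_list P LB = r \<and> P \<noteq> [] \<and> hd P = LA"

definition pattern_edge :: "pattern \<Rightarrow> letter \<Rightarrow> nat set" where
  "pattern_edge P x = {i. i < length P \<and> P ! i = x}"

definition pattern_matching :: "pattern \<Rightarrow> nat set set" where
  "pattern_matching P = {pattern_edge P LA, pattern_edge P LB}"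

definition clique :: "nat \<Rightarrow> pattern set \<Rightarrow> 'a::linorder set set \<Rightarrow> bool" where
  "clique r \<P> N \<longleftrightarrow> ordered_matching r N \<and>
     (\<forall>e\<in>N. \<forall>f\<in>N. e \<noteq> f \<longrightarrow> (\<exists>P\<in>\<P>. order_isomorphic {e, f} (pattern_matching P)))"

definition max_clique_size :: "nat \<Rightarrow> pattern set \<Rightarrow> 'a::linorder set set \<Rightarrow> nat" where
  "max_clique_size r \<P> M = Max {card N | N. N \<subseteq> M \<and> clique r \<P> N}"

section \<open>Collectable patterns\<close>

definition block :: "letter list \<Rightarrow> bool" where
  "block S \<longleftrightarrow> (\<exists>t\<ge>1. S = replicate t LA @ replicate t LB \<or> S = replicate t LB @ replicate t LA)"

definition splitting :: "pattern \<Rightarrow> letter list list \<Rightarrow> bool" where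
  "splitting P Ss \<longleftrightarrow> P = concat Ss \<and> (\<forall>S\<in>set Ss. block S)"

definition collectable :: "pattern \<Rightarrow> bool" where
  "collectable P \<longleftrightarrow> (\<exists>Ss. splitting P Ss)"

text \<open>Only meaningful for collectable \<open>P\<close>; the description is justified by
  \<open>splitting_unique\<close> below.\<close>

definition composition :: "pattern \<Rightarrow> nat list" where
  "composition P = map (\<lambda>S. length S div 2) (THE Ss. splitting P Ss)"

definition harmonious :: "pattern \<Rightarrow> pattern \<Rightarrow> bool" where
  "harmonious P Q \<longleftrightarrow> P \<noteq> Q \<and> collectable P \<and> collectable Q \<and> composition P = composition Q"

definition mismatch :: "pattern \<Rightarrow> pattern \<Rightarrow> bool" where
  "mismatch P Q \<longleftrightarrow> P \<noteq> Q \<and>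
     (collectable P \<and> \<not> collectable Q \<or> \<not> collectable P \<and> collectable Q \<or>
      collectable P \<and> collectable Q \<and> \<not> harmonious P Q)"

section \<open>The definitions are well behaved\<close>

lemma replicate_append_Cons_eq:
  assumes "x \<noteq> y" "replicate s x @ y # us = replicate t x @ y # vs"
  shows "s = t"
  using assms
proof (induction s arbitrary: t)
  case 0
  then show ?case by (cases t) auto
next
  case (Suc s)
  then show ?case by (cases t) auto
qed

lemma block_prefix_unique:
  assumes "block S" "block T" "S @ us = T @ vs"
  shows "S = T"
proof -
  have form: "\<exists>t x y. x \<noteq> y \<and> S = replicate (Suc t) x @ y # replicate t y" if "block S" for S
  proof -
    obtain t where t: "t \<ge> 1"
      "S = replicate t LA @ replicate t LB \<or> S = replicate t LB @ replicate t LA"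
      using \<open>block S\<close> unfolding block_def by auto
    from t(2) obtain x y where "x \<noteq> y" "S = replicate t x @ replicate t y"
    proof
      assume "S = replicate t LA @ replicate t LB"
      then show ?thesis by (intro that[of LA LB]) auto
    next
      assume "S = replicate t LB @ replicate t LA"
      then show ?thesis by (intro that[of LB LA]) auto
    qed
    moreover obtain u where "t = Suc u" using t(1) by (cases t) auto
    ultimately have "x \<noteq> y \<and> S = replicate (Suc u) x @ y # replicate u y" by simp
    then show ?thesis by blast
  qed
  obtain s x y where S: "x \<noteq> y" "S = replicate (Suc s) x @ y # replicate s y"
    using form assms(1) by blast
  obtain t x' y' where T: "x' \<noteq> y'" "T = replicate (Suc t) x' @ y' # replicate t y'"
    using form assms(2) by blast
  have "x = x'" using assms(3) S T by simp
  moreover have "y = y'"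
    using S(1) T(1) \<open>x = x'\<close> by (cases x; cases y; cases y') auto
  ultimately have "replicate (Suc s) x @ y # (replicate s y @ us)
      = replicate (Suc t) x @ y # (replicate t y @ vs)"
    using assms(3) S T by simp
  then have "s = t" using replicate_append_Cons_eq[OF S(1)] by blast
  then show ?thesis using S T \<open>x = x'\<close> \<open>y = y'\<close> by simp
qed

lemma splitting_unique: "splitting P Ss \<Longrightarrow> splitting P Ts \<Longrightarrow> Ss = Ts"
proof (induction Ss arbitrary: P Ts)
  case Nil
  then show ?case by (cases Ts) (auto simp: splitting_def block_def)
next
  case (Cons S Ss)
  from Cons.prems obtain T Ts' where Ts: "Ts = T # Ts'"
    by (cases Ts) (auto simp: splitting_def block_def)
  from Cons.prems have "S = T"
    using block_prefix_unique[of S T "concat Ss" "concat Ts'"] by (auto simp: splitting_def Ts)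
  moreover from this have "Ss = Ts'"
    using Cons.prems by (intro Cons.IH[of "concat Ss"]) (auto simp: splitting_def Ts)
  ultimately show ?case by (simp add: Ts)
qed

lemma composition_eq: "splitting P Ss \<Longrightarrow> composition P = map (\<lambda>S. length S div 2) Ss"
  unfolding composition_def using splitting_unique by (metis the_equality)

lemma finite_matchings: "finite (matchings r n)"
proof (rule finite_subset)
  show "matchings r n \<subseteq> Pow (Pow {1..r * n})" by (auto simp: matchings_def)
qed simp

lemma matchings_nonempty:
  assumes "r \<ge> 1"
  shows "matchings r n \<noteq> {}"
proof -
  define e where "e k = {r * k + 1..r * k + r}" for k
  have lt: "x < y" if "i < j" "x \<in> e i" "y \<in> e j" for i j x y
  proof -
    have "r * Suc i \<le> r * j" using that(1) by (intro mult_left_mono) auto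
    with that show ?thesis by (auto simp: e_def)
  qed
  have disj: "disjnt (e i) (e j)" if "i \<noteq> j" for i j
    using lt[of i j] lt[of j i] that unfolding disjnt_iff by (metis less_irrefl nat_neq_iff)
  have inj: "inj e"
  proof (rule injI, rule ccontr)
    fix i j assume "e i = e j" "i \<noteq> j"
    then have "e i = {}" using disj[of i j] by (simp add: disjnt_def)
    then show False using assms by (simp add: e_def)
  qed
  have U: "\<Union>(e ` {..<n}) = {1..r * n}"
  proof (induction n)
    case (Suc n)
    have "{1..r * Suc n} = {1..r * n} \<union> e n" by (auto simp: e_def)
    with Suc show ?case by (simp add: lessThan_Suc Un_commute)
  qed simp
  have card: "card (e ` {..<n}) = n"
    using inj by (simp add: card_image inj_on_subset[OF _ subset_UNIV])
  have pw: "pairwise disjnt (e ` {..<n})"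
  proof (rule pairwiseI)
    fix X Y assume "X \<in> e ` {..<n}" "Y \<in> e ` {..<n}" "X \<noteq> Y"
    then obtain i j where "X = e i" "Y = e j" "i \<noteq> j" by auto
    then show "disjnt X Y" using disj by simp
  qed
  have "e ` {..<n} \<in> matchings r n"
    unfolding matchings_def ordered_matching_def
    using U card pw by (simp add: e_def)
  then show ?thesis by blast
qed

end

theory Submission
  imports Defs
begin

text \<open>
  Enumerating the vertices of each edge increasingly, a pattern becomes a relation \<open>R\<close> on
  coordinates: two edges \<open>e\<close>, \<open>f\<close> form it if \<open>e\<^sub>p < f\<^sub>q \<longleftrightarrow> R p q\<close>.

  Upper bounds are first moment bounds, so one has to count the cliques of size \<open>k\<close> on \<open>rk\<close> given
  vertices. Once the edges are sorted by a suitable coordinate \<open>d\<close>, a clique is determined by which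
  pairs form \<open>P\<close> and which form \<open>Q\<close>. For harmonious patterns this is encoded by one permutation, so
  there are at most \<open>k\<^sup>k\<close> cliques. In a mismatch \<open>d\<close> is taken just after the blocks of common sizes. Either
  the runs of \<open>P\<close> and \<open>Q\<close> starting there have different lengths \<open>t < t'\<close>; then the intervals
  \<open>[e\<^sub>d, e\<^sub>d\<^sub>+\<^sub>t]\<close> are disjoint for one pattern and overlap in a fixed way (all crossing or all nested) for the
  other, which leaves at most \<open>4\<^sup>k\<close> possibilities as for Catalan structures. Or one pattern breaks off
  a block; then it can only be formed by pairs containing the last edge, which leaves \<open>2\<^sup>k\<close>
  possibilities. The latter argument also shows that a non-collectable pattern has no cliques of size
  \<open>3\<close>, whence \<open>z < R(3, 3) = 6\<close>.

  For the lower bounds cut the vertices into \<open>rk\<close> intervals, with \<open>k\<close> of the order of the claimed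
  clique size, and look for random edges having one vertex in each interval of some member of a
  family of template edges on \<open>{..<rk}\<close>; disjoint template edges form \<open>P\<close> or \<open>Q\<close>. By Chebyshev's
  inequality there are linearly many (in \<open>k\<close>) such edges. A union bound over sets of \<open>\<delta>k\<close> intervals
  shows that they are not all covered by few intervals, so a maximal family of them with disjoint
  templates has size of order \<open>k\<close>.
\<close>

section \<open>Patterns as relations between coordinates\<close>

text \<open>The exponents come from two balances. If \<open>rk\<close> given vertices carry at most
  \<open>B^k k^((r-w)k)\<close> cliques of size \<open>k\<close>, the expected number of such
  cliques is about \<open>(const n / k^w)^k\<close> at most, since choosing the vertices and
  including the edges together contribute \<open>(r! n)^k / (rk)!\<close>. Conversely
  \<open>k^u\<close> template edges, each with \<open>(n/k)^r\<close> blow-ups present with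
  probability of order \<open>n^(1-r)\<close>, yield about \<open>k^u n / k^r\<close> edges, which
  is \<open>k\<close> when \<open>n = k^w\<close> with \<open>w = r + 1 - u\<close>. A harmonious
  pair has a two-parameter family of templates (\<open>u = 2\<close>), because an edge may be
  shifted independently in the blocks where the patterns agree and in those where they differ. A
  single collectable pattern has one parameter, and in a mismatch the second pattern does not help.

  The obstacle in the lower bound is that blow-ups of intersecting templates may form any pattern,
  so many edges are useless if they crowd into few cells. For two non-collectable patterns the
  number of cells is kept fixed: every fixed finite clique then occurs asymptotically almost surely,
  so \<open>z\<close> is the largest size of any clique at all.\<close>

definition vx :: "nat set \<Rightarrow> nat \<Rightarrow> nat" where
  "vx e p = sorted_list_of_set e ! p"

text \<open>The \<open>p\<close>-th \<open>x\<close> of the word stands before the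
  \<open>q\<close>-th occurrence of the other letter, both counted from 0. An index \<open>p\<close>
  beyond the last \<open>x\<close> counts as coming after everything, whence \<open>False\<close> on
  the empty word.\<close>

fun before :: "letter \<Rightarrow> pattern \<Rightarrow> nat \<Rightarrow> nat \<Rightarrow> bool" where
  "before x [] p q = False"
| "before x (z # w) p q =
     (if z = x then p = 0 \<or> before x w (p - 1) q else q \<noteq> 0 \<and> before x w p (q - 1))"

definition arranged :: "nat \<Rightarrow> (nat \<Rightarrow> nat \<Rightarrow> bool) \<Rightarrow> nat set \<Rightarrow> nat set \<Rightarrow> bool" where
  "arranged r R e f \<longleftrightarrow> (\<forall>p<r. \<forall>q<r. vx e p < vx f q \<longleftrightarrow> R p q)"

lemma sorted_list_of_set_eqI:
  "sorted_wrt (<) xs \<Longrightarrow> set xs = A \<Longrightarrow> sorted_list_of_set A = xs"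
  by (rule strict_sorted_equal) auto

lemma sorted_list_of_set_image_strict_mono:
  fixes A :: "'a::linorder set"
  assumes "finite A" "strict_mono_on A g"
  shows "sorted_list_of_set (g ` A) = map g (sorted_list_of_set A)"
proof (rule sorted_list_of_set_eqI)
  show "sorted_wrt (<) (map g (sorted_list_of_set A))"
    unfolding sorted_wrt_map
    by (rule sorted_wrt_mono_rel[OF _ strict_sorted_list_of_set])
       (use assms in \<open>auto simp: strict_mono_on_def\<close>)
qed (use assms in auto)

lemma vx_image:
  assumes "finite A" "strict_mono_on A g" "p < card A"
  shows "vx (g ` A) p = g (vx A p)"
  using assms by (simp add: vx_def sorted_list_of_set_image_strict_mono)

lemma vx_in: "finite e \<Longrightarrow> p < card e \<Longrightarrow> vx e p \<in> e"
  unfolding vx_def using nth_mem[of p "sorted_list_of_set e"] by simp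

lemma vx_less: "finite e \<Longrightarrow> p < q \<Longrightarrow> q < card e \<Longrightarrow> vx e p < vx e q"
  unfolding vx_def using strict_sorted_list_of_set[of e]
  by (simp add: sorted_wrt_nth_less)

lemma vx_less_iff: "finite e \<Longrightarrow> p < card e \<Longrightarrow> q < card e \<Longrightarrow> vx e p < vx e q \<longleftrightarrow> p < q"
  using vx_less by (metis linorder_neqE_nat order_less_asym less_irrefl)

lemma vx_image_lessThan: "finite e \<Longrightarrow> vx e ` {..<card e} = e"
proof -
  assume "finite e"
  then have "set (sorted_list_of_set e) = e" by simp
  then show ?thesis
    unfolding vx_def set_conv_nth by (force simp: \<open>finite e\<close>)
qed

lemma vx_ex: "finite e \<Longrightarrow> v \<in> e \<Longrightarrow> \<exists>p<card e. v = vx e p"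
  using vx_image_lessThan[of e] by blast

lemma letter_neq_neq: "(x::letter) \<noteq> y \<Longrightarrow> z \<noteq> x \<longleftrightarrow> z = y"
  by (cases x; cases y; cases z) auto

lemma pattern_edge_Cons:
  "pattern_edge (z # w) x = (if z = x then {0} else {}) \<union> Suc ` pattern_edge w x"
proof -
  have "i \<in> pattern_edge (z # w) x \<longleftrightarrow>
      i \<in> (if z = x then {0} else {}) \<union> Suc ` pattern_edge w x" for i
    by (cases i) (auto simp: pattern_edge_def)
  then show ?thesis by blast
qed

lemma finite_pattern_edge [simp]: "finite (pattern_edge P x)"
  by (simp add: pattern_edge_def)

lemma card_pattern_edge: "card (pattern_edge P x) = count_list P x"
proof (induction P)
  case Nil
  then show ?case by (simp add: pattern_edge_def)
next
  case (Cons z w)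
  have "card (Suc ` pattern_edge w x) = card (pattern_edge w x)" by (simp add: card_image)
  moreover have "0 \<notin> Suc ` pattern_edge w x" by auto
  ultimately show ?case using Cons by (simp add: pattern_edge_Cons)
qed

lemma sorted_list_pattern_edge_Cons:
  "sorted_list_of_set (pattern_edge (z # w) x) =
     (if z = x then [0] else []) @ map Suc (sorted_list_of_set (pattern_edge w x))"
proof -
  have *: "sorted_list_of_set (Suc ` pattern_edge w x)
      = map Suc (sorted_list_of_set (pattern_edge w x))"
    by (rule sorted_list_of_set_image_strict_mono) (auto simp: strict_mono_on_def)
  have "sorted_list_of_set ({0} \<union> Suc ` pattern_edge w x)
      = 0 # sorted_list_of_set (Suc ` pattern_edge w x)"
    by (rule sorted_list_of_set_eqI) (auto simp flip: *)
  then show ?thesis by (simp add: pattern_edge_Cons *)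
qed

text \<open>Reading the first letter uses up one index of one of the two letters; this is the
  recursion of \<open>before\<close>, and positions in the word obey it too.\<close>

lemma vx_pattern_edge_less_iff:
  assumes "x \<noteq> y" "p < count_list P x" "q < count_list P y"
  shows "vx (pattern_edge P x) p < vx (pattern_edge P y) q \<longleftrightarrow> before x P p q"
  using assms(2,3)
proof (induction P arbitrary: p q)
  case (Cons z w)
  note * = vx_def sorted_list_pattern_edge_Cons card_pattern_edge
  show ?case
  proof (cases "z = x")
    case True
    with Cons assms(1) show ?thesis by (cases p) (auto simp: *)
  next
    case False
    then have "z = y" using assms(1) letter_neq_neq by blast
    with False Cons show ?thesis by (cases q) (auto simp: *)
  qed
qed simp

lemma before_swap:
  assumes "x \<noteq> y" "p < count_list P x" "q < count_list P y"
  shows "before y P q p \<longleftrightarrow> \<not> before x P p q"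
proof -
  have "vx (pattern_edge P x) p \<in> pattern_edge P x" "vx (pattern_edge P y) q \<in> pattern_edge P y"
    using assms by (auto intro!: vx_in simp: card_pattern_edge)
  then have "vx (pattern_edge P x) p \<noteq> vx (pattern_edge P y) q"
    using assms(1) by (auto simp: pattern_edge_def)
  then show ?thesis
    using vx_pattern_edge_less_iff[OF assms]
      vx_pattern_edge_less_iff[OF assms(1)[symmetric] assms(3) assms(2)]
    by auto
qed

lemma count_list_letter: "r_pattern r P \<Longrightarrow> count_list P x = r"
  by (cases x) (auto simp: r_pattern_def)

lemma vx_neq:
  assumes "finite e" "finite f" "p < card e" "q < card f" "e \<inter> f = {}"
  shows "vx e p \<noteq> vx f q"
  using assms vx_in by (metis disjoint_iff)

text \<open>Exchanging the edges and the letters at once leaves the interleaving unchanged. This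
  permits reading a pattern from the side of \<open>LB\<close>.\<close>

lemma arranged_swap:
  assumes "r_pattern r P" "finite e" "finite f" "card e = r" "card f = r" "e \<inter> f = {}"
    and "x \<noteq> y"
  shows "arranged r (before y P) f e \<longleftrightarrow> arranged r (before x P) e f"
proof -
  have "vx f q < vx e p \<longleftrightarrow> \<not> vx e p < vx f q" if "p < r" "q < r" for p q
    using vx_neq[of e f p q] assms that by auto
  moreover have "before y P q p \<longleftrightarrow> \<not> before x P p q" if "p < r" "q < r" for p q
    using before_swap[of x y p P q] assms that by (auto simp: count_list_letter)
  ultimately show ?thesis unfolding arranged_def by blast
qed

text \<open>\<open>R\<close> fixes how the vertices of the two edges interleave, and within an edge
  the coordinates are increasing anyway; hence the map that preserves edges and coordinates is
  monotone.\<close>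

lemma order_isomorphic_if_arranged:
  assumes "finite e" "finite f" "card e = r" "card f = r" "e \<inter> f = {}"
    and "finite e'" "finite f'" "card e' = r" "card f' = r" "e' \<inter> f' = {}"
    and "arranged r R e f" "arranged r R e' f'"
  shows "order_isomorphic {e, f} {e', f'}"
proof -
  define idx where "idx g v = (THE p. p < r \<and> vx g p = v)" for g v
  have inj: "p = q" if "finite g" "card g = r" "p < r" "q < r" "vx g p = vx g q" for g p q
    using vx_less_iff[of g p q] vx_less_iff[of g q p] that by auto
  have idx: "idx g (vx g p) = p" if "finite g" "card g = r" "p < r" for g p
    unfolding idx_def using that inj[OF that(1,2)] by (intro the_equality) auto
  define \<phi> where "\<phi> v = (if v \<in> e then vx e' (idx e v) else vx f' (idx f v))" for v
  have \<phi>e: "\<phi> (vx e p) = vx e' p" if "p < r" for p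
    using that assms vx_in[of e p] by (simp add: \<phi>_def idx)
  have \<phi>f: "\<phi> (vx f p) = vx f' p" if "p < r" for p
  proof -
    have "vx f p \<notin> e" using that assms vx_in[of f p] by auto
    then show ?thesis using that assms by (simp add: \<phi>_def idx)
  qed
  have e: "e = vx e ` {..<r}" "f = vx f ` {..<r}" "e' = vx e' ` {..<r}" "f' = vx f' ` {..<r}"
    using vx_image_lessThan assms by metis+
  have im: "\<phi> ` e = e'" "\<phi> ` f = f'"
  proof -
    have "\<phi> ` vx e ` {..<r} = vx e' ` {..<r}" "\<phi> ` vx f ` {..<r} = vx f' ` {..<r}"
      by (auto simp: \<phi>e \<phi>f image_image)
    then show "\<phi> ` e = e'" "\<phi> ` f = f'" by (simp_all flip: e)
  qed
  have "vx e p < vx f q \<longleftrightarrow> vx e' p < vx f' q" if "p < r" "q < r" for p q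
    using assms that by (simp add: arranged_def)
  moreover have "vx f q < vx e p \<longleftrightarrow> \<not> vx e p < vx f q"
    "vx f' q < vx e' p \<longleftrightarrow> \<not> vx e' p < vx f' q" if "p < r" "q < r" for p q
    using vx_neq[of e f p q] vx_neq[of e' f' p q] assms that by auto
  ultimately have less: "\<phi> u < \<phi> v" if uv: "u \<in> e \<union> f" "v \<in> e \<union> f" "u < v" for u v
  proof -
    have "(\<exists>p<r. u = vx e p) \<or> (\<exists>p<r. u = vx f p)" "(\<exists>p<r. v = vx e p) \<or> (\<exists>p<r. v = vx f p)"
      using uv vx_ex[of e] vx_ex[of f] assms by auto
    then show ?thesis
      using \<open>u < v\<close> assms vx_less_iff[of e] vx_less_iff[of e'] vx_less_iff[of f] vx_less_iff[of f']
        \<open>\<And>q p. \<lbrakk>p < r; q < r\<rbrakk> \<Longrightarrow> (vx e p < vx f q) = (vx e' p < vx f' q)\<close>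
        \<open>\<And>q p. \<lbrakk>p < r; q < r\<rbrakk> \<Longrightarrow> (vx f q < vx e p) = (\<not> vx e p < vx f q)\<close>
        \<open>\<And>q p. \<lbrakk>p < r; q < r\<rbrakk> \<Longrightarrow> (vx f' q < vx e' p) = (\<not> vx e' p < vx f' q)\<close>
      by (elim disjE exE conjE) (simp_all add: \<phi>e \<phi>f)
  qed
  then have mono: "strict_mono_on (\<Union>{e, f}) \<phi>" by (auto simp: strict_mono_on_def)
  moreover have "bij_betw \<phi> (\<Union>{e, f}) (\<Union>{e', f'})"
    unfolding bij_betw_def using strict_mono_on_imp_inj_on[OF mono] im by (auto simp: image_Un)
  ultimately show ?thesis unfolding order_isomorphic_def using im by (intro exI[of _ \<phi>]) auto
qed

abbreviation forms :: "pattern \<Rightarrow> 'a::linorder set \<Rightarrow> 'a set \<Rightarrow> bool" where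
  "forms P e f \<equiv> order_isomorphic {e, f} (pattern_matching P)"

text \<open>The pair on the left is unordered while \<open>arranged\<close> is directed, so either
  edge may play the part of the letter \<open>LA\<close>.\<close>

lemma order_isomorphic_pattern_iff:
  assumes "r_pattern r P" "finite e" "finite f" "card e = r" "card f = r" "e \<inter> f = {}"
  shows "forms P e f \<longleftrightarrow>
    arranged r (before LA P) e f \<or> arranged r (before LA P) f e"
proof
  let ?A = "pattern_edge P LA" and ?B = "pattern_edge P LB"
  have AB: "finite ?A" "finite ?B" "card ?A = r" "card ?B = r" "?A \<inter> ?B = {}"
    "arranged r (before LA P) ?A ?B"
    using assms(1) by (auto simp: card_pattern_edge count_list_letter arranged_def
        vx_pattern_edge_less_iff) (auto simp: pattern_edge_def)
  show "forms P e f"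
    if "arranged r (before LA P) e f \<or> arranged r (before LA P) f e"
    using that order_isomorphic_if_arranged[of e f r ?A ?B "before LA P"]
      order_isomorphic_if_arranged[of f e r ?A ?B "before LA P"] assms AB
    unfolding pattern_matching_def by (metis insert_commute inf_commute)
  assume "forms P e f"
  then obtain \<phi> where \<phi>: "strict_mono_on (e \<union> f) \<phi>" "{\<phi> ` e, \<phi> ` f} = {?A, ?B}"
    unfolding order_isomorphic_def pattern_matching_def by auto
  have m: "strict_mono_on e \<phi>" "strict_mono_on f \<phi>"
    using \<phi>(1) by (auto simp: strict_mono_on_def)
  have "vx (\<phi> ` e) p < vx (\<phi> ` f) q \<longleftrightarrow> vx e p < vx f q"
     "vx (\<phi> ` f) q < vx (\<phi> ` e) p \<longleftrightarrow> vx f q < vx e p" if "p < r" "q < r" for p q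
  proof -
    have "vx (\<phi> ` e) p = \<phi> (vx e p)" "vx (\<phi> ` f) q = \<phi> (vx f q)"
      using m assms that by (auto intro!: vx_image)
    moreover have "vx e p \<in> e" "vx f q \<in> f" using vx_in assms that by auto
    ultimately show "vx (\<phi> ` e) p < vx (\<phi> ` f) q \<longleftrightarrow> vx e p < vx f q"
     "vx (\<phi> ` f) q < vx (\<phi> ` e) p \<longleftrightarrow> vx f q < vx e p"
      using \<phi>(1) by (auto simp: strict_mono_on_less)
  qed
  moreover have "\<phi> ` e = ?A \<and> \<phi> ` f = ?B \<or> \<phi> ` f = ?A \<and> \<phi> ` e = ?B"
    using \<phi>(2) by (auto simp: doubleton_eq_iff)
  ultimately show "arranged r (before LA P) e f \<or> arranged r (before LA P) f e"
    using AB(6) unfolding arranged_def by metis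
qed

text \<open>The letter \<open>x\<close> orients the pattern: \<open>e\<close> is the edge that comes first at coordinate \<open>d\<close>.\<close>

lemma order_isomorphic_pattern_arranged:
  assumes "r_pattern r P" "finite e" "finite f" "card e = r" "card f = r" "e \<inter> f = {}"
    and "forms P e f"
    and "d < r" "before x P d d" "vx e d < vx f d"
  shows "arranged r (before x P) e f"
proof -
  have *: "arranged r (before x P) e f \<or> arranged r (before x P) f e"
  proof (cases x)
    case LA
    then show ?thesis using order_isomorphic_pattern_iff[of r P e f] assms by blast
  next
    case LB
    then show ?thesis
      using order_isomorphic_pattern_iff[of r P e f] assms
        arranged_swap[of r P e f LA LB] arranged_swap[of r P f e LA LB] by (auto simp: inf_commute)
  qed
  show ?thesis using * assms unfolding arranged_def by (metis not_less_iff_gr_or_eq)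
qed

section \<open>Words and their blocks\<close>

fun other :: "letter \<Rightarrow> letter" where
  "other LA = LB"
| "other LB = LA"

lemma other_neq [simp]: "other x \<noteq> x" "x \<noteq> other x"
  by (cases x; simp)+

lemma other_eqI: "z \<noteq> x \<Longrightarrow> z = other x"
  by (cases x; cases z) auto

definition blk :: "nat \<Rightarrow> letter \<Rightarrow> pattern" where
  "blk t x = replicate t x @ replicate t (other x)"

definition balanced :: "pattern \<Rightarrow> bool" where
  "balanced w \<longleftrightarrow> count_list w LA = count_list w LB"

lemma count_list_replicate [simp]: "count_list (replicate n x) y = (if x = y then n else 0)"
  by (induction n) auto

lemma count_list_blk [simp]: "count_list (blk t x) y = t"
  by (cases x; cases y) (auto simp: blk_def)

lemma block_iff: "block S \<longleftrightarrow> (\<exists>t\<ge>1. \<exists>x. S = blk t x)"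
proof -
  have "(\<exists>x. S = blk t x) \<longleftrightarrow> S = blk t LA \<or> S = blk t LB" for t
  proof -
    have "(\<exists>x. Q x) \<longleftrightarrow> Q LA \<or> Q LB" for Q
    proof
      assume "\<exists>x. Q x"
      then obtain x where "Q x" ..
      then show "Q LA \<or> Q LB" by (cases x) auto
    qed auto
    then show ?thesis .
  qed
  then show ?thesis by (simp add: block_def blk_def)
qed

lemma balanced_count: "balanced w \<Longrightarrow> count_list w x = count_list w LA"
  by (cases x) (auto simp: balanced_def)

lemma balanced_Nil [simp]: "balanced []"
  by (simp add: balanced_def)

lemma balanced_blk_append [simp]: "balanced (blk t x @ w) \<longleftrightarrow> balanced w"
  by (simp add: balanced_def)

lemma collectable_Nil: "collectable []"
  unfolding collectable_def splitting_def by (intro exI[of _ "[]"]) simp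

lemma collectable_blk_append:
  assumes "t \<ge> 1" "collectable w"
  shows "collectable (blk t x @ w)"
proof -
  obtain Ss where "splitting w Ss" using assms(2) by (auto simp: collectable_def)
  moreover have "block (blk t x)" using assms(1) by (auto simp: block_iff)
  ultimately show ?thesis
    unfolding collectable_def splitting_def by (intro exI[of _ "blk t x # Ss"]) auto
qed

lemma before_append_shift:
  "before x (S @ w) (count_list S x + p) (count_list S (other x) + q) \<longleftrightarrow> before x w p q"
proof (induction S)
  case (Cons z S)
  show ?case
  proof (cases "z = x")
    case True
    with Cons.IH show ?thesis by simp
  next
    case False
    then have "z = other x" by (rule other_eqI)
    with Cons.IH show ?thesis by simp
  qed
qed simp

lemma before_blk_shift: "before x (blk t y @ w) (t + p) (t + q) \<longleftrightarrow> before x w p q"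
  using before_append_shift[of x "blk t y" w p q] by simp

lemma before_replicate: "before x (replicate t x @ w) p q \<longleftrightarrow> p < t \<or> before x w (p - t) q"
proof (induction t arbitrary: p)
  case (Suc t)
  then show ?case by (cases p) auto
qed simp

lemma before_replicate_other:
  "before x (replicate t (other x) @ w) p q \<longleftrightarrow> t \<le> q \<and> before x w p (q - t)"
proof (induction t arbitrary: q)
  case (Suc t)
  then show ?case by (cases q) auto
qed simp

lemma before_blk:
  "before x (blk t x @ w) p q \<longleftrightarrow> p < t \<or> t \<le> q \<and> before x w (p - t) (q - t)"
  by (simp add: blk_def before_replicate before_replicate_other)

lemma before_blk_other:
  "before x (blk t (other x) @ w) p q \<longleftrightarrow> t \<le> q \<and> (p < t \<or> before x w (p - t) (q - t))"
proof -
  have "other (other x) = x" by (cases x) auto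
  then show ?thesis by (simp add: blk_def before_replicate before_replicate_other)
qed

lemma before_hd: "w \<noteq> [] \<Longrightarrow> hd w = x \<Longrightarrow> before x w 0 q"
  by (cases w) auto

lemma split_run:
  obtains j v where "w = replicate j x @ v" "v = [] \<or> hd v \<noteq> x" "w \<noteq> [] \<and> hd w = x \<longrightarrow> j \<ge> 1"
proof
  have "takeWhile (\<lambda>y. y = x) w = replicate (length (takeWhile (\<lambda>y. y = x) w)) x"
    by (rule replicate_length_same[symmetric]) (auto dest: set_takeWhileD)
  then show "w = replicate (length (takeWhile (\<lambda>y. y = x) w)) x @ dropWhile (\<lambda>y. y = x) w"
    by (metis takeWhile_dropWhile_id)
  show "dropWhile (\<lambda>y. y = x) w = [] \<or> hd (dropWhile (\<lambda>y. y = x) w) \<noteq> x"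
    using hd_dropWhile by blast
  show "w \<noteq> [] \<and> hd w = x \<longrightarrow> 1 \<le> length (takeWhile (\<lambda>y. y = x) w)"
    by (cases w) auto
qed

text \<open>Let the first two runs have lengths \<open>t\<close> and \<open>j\<close>. If
  \<open>t \<le> j\<close> a block can be split off; otherwise balance forces further letters, and
  the next one is \<open>x\<close> again.\<close>

lemma balanced_first_run:
  assumes "balanced P" "P \<noteq> []"
  obtains (block) t x w where "t \<ge> 1" "P = blk t x @ w" "balanced w"
  | (short) t x j v where "1 \<le> j" "j < t" "P = replicate t x @ replicate j (other x) @ v" "v \<noteq> []" "hd v = x"
proof -
  define x where "x = hd P"
  obtain t w where w: "P = replicate t x @ w" "w = [] \<or> hd w \<noteq> x" "t \<ge> 1"
    using split_run[of P x] assms(2) x_def by metis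
  obtain j v where v: "w = replicate j (other x) @ v" "v = [] \<or> hd v \<noteq> other x"
    "w \<noteq> [] \<and> hd w = other x \<longrightarrow> j \<ge> 1"
    using split_run[of w "other x"] by metis
  have cnt: "count_list P x = count_list P (other x)"
    using balanced_count[OF assms(1)] by metis
  then have "w \<noteq> []" using w(1,3) by auto
  then have j: "j \<ge> 1" using v(3) w(2) other_eqI by blast
  show thesis
  proof (cases "t \<le> j")
    case True
    then have "replicate j (other x) = replicate t (other x) @ replicate (j - t) (other x)"
      by (simp flip: replicate_add)
    then have "P = blk t x @ (replicate (j - t) (other x) @ v)"
      using w v by (simp add: blk_def)
    then show thesis using block[of t x] w(3) assms(1) by simp
  next
    case False
    have "v \<noteq> []" using cnt False w v by auto
    moreover have "hd v = x" using v(2) \<open>v \<noteq> []\<close> by (metis other_eqI)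
    ultimately show thesis using short[of j t x v] j False w v by auto
  qed
qed

text \<open>The four conditions on \<open>(d, d)\<close>, \<open>(u, d)\<close>, \<open>(s, d)\<close>, \<open>(s, u)\<close> say that from coordinate \<open>d\<close>
  on the word starts with \<open>x\<close> repeated \<open>s - d\<close> times, but not with a block of that size.\<close>

lemma not_collectable_defect:
  assumes "balanced P" "\<not> collectable P"
  shows "\<exists>x d u s. d < count_list P LA \<and> u < count_list P LA \<and> s < count_list P LA \<and>
    before x P d d \<and> before x P u d \<and> \<not> before x P s d \<and> before x P s u"
  using assms
proof (induction P rule: length_induct)
  case (1 P)
  have "P \<noteq> []" using 1(3) collectable_Nil by blast
  from \<open>balanced P\<close> this show ?case
  proof (cases rule: balanced_first_run)
    case (block t x w)
    have "length w < length P" using block by (simp add: blk_def)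
    moreover have "\<not> collectable w" using block 1(3) collectable_blk_append by blast
    ultimately obtain y d u s where *: "d < count_list w LA" "u < count_list w LA"
      "s < count_list w LA"
      "before y w d d \<and> before y w u d \<and> \<not> before y w s d \<and> before y w s u"
      using 1(1) block by blast
    then show ?thesis unfolding block
      by (intro exI[of _ y] exI[of _ "t + d"] exI[of _ "t + u"] exI[of _ "t + s"])
        (simp add: before_blk_shift)
  next
    case (short t x j v)
    have "count_list v x \<ge> 1" using short by (cases v) auto
    then have "t < count_list P x" using short(3) by simp
    then have "t < count_list P LA" using balanced_count[OF 1(2), of x] by simp
    \<comment> \<open>Index \<open>t - 1\<close> is the last one of the first run. The
      \<open>x\<close> with index \<open>t\<close> opens \<open>v\<close>, after \<open>j\<close>
      other letters with \<open>1 \<le> j < t\<close>, so it comes after the other letter with index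
      0 but before the one with index \<open>t - 1\<close>.\<close>
    then show ?thesis using short
      by (intro exI[of _ x] exI[of _ 0] exI[of _ "t - 1"] exI[of _ t])
        (auto simp: before_replicate before_replicate_other intro: before_hd)
  qed
qed

text \<open>A triple \<open>(t, x, x')\<close> stands for a pair of blocks \<open>blk t x\<close>, \<open>blk t x'\<close> at the same position of
  two words with the same composition.\<close>

definition left_word :: "(nat \<times> letter \<times> letter) list \<Rightarrow> pattern" where
  "left_word L = concat (map (\<lambda>(t, x, x'). blk t x) L)"

definition right_word :: "(nat \<times> letter \<times> letter) list \<Rightarrow> pattern" where
  "right_word L = concat (map (\<lambda>(t, x, x'). blk t x') L)"

definition proper :: "(nat \<times> letter \<times> letter) list \<Rightarrow> bool" where
  "proper L \<longleftrightarrow> (\<forall>(t, x, x')\<in>set L. t \<ge> 1)"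

lemma word_simps [simp]:
  "left_word [] = []" "right_word [] = []" "proper []"
  "left_word ((t, x, x') # L) = blk t x @ left_word L"
  "right_word ((t, x, x') # L) = blk t x' @ right_word L"
  "proper ((t, x, x') # L) \<longleftrightarrow> t \<ge> 1 \<and> proper L"
  by (auto simp: left_word_def right_word_def proper_def)

lemma collectable_words:
  assumes "proper L"
  shows "collectable (left_word L)" "collectable (right_word L)"
    "composition (left_word L) = composition (right_word L)"
proof -
  let ?l = "map (\<lambda>(t, x, x'). blk t x) L" and ?r = "map (\<lambda>(t, x, x'). blk t x') L"
  have *: "splitting (left_word L) ?l" "splitting (right_word L) ?r"
    using assms by (auto simp: splitting_def left_word_def right_word_def block_iff proper_def)
  then show "collectable (left_word L)" "collectable (right_word L)"
    by (auto simp: collectable_def)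
  show "composition (left_word L) = composition (right_word L)"
    using composition_eq[OF *(1)] composition_eq[OF *(2)]
    by (auto simp: comp_def blk_def case_prod_unfold)
qed

lemma same_composition_words:
  assumes "splitting P Ss" "splitting Q Ts"
    and "map (\<lambda>S. length S div 2) Ss = map (\<lambda>S. length S div 2) Ts"
  shows "\<exists>L. proper L \<and> P = left_word L \<and> Q = right_word L"
proof -
  have "length Ss = length Ts" using assms(3) by (metis length_map)
  then show ?thesis using assms
  proof (induction Ss Ts arbitrary: P Q rule: list_induct2)
    case Nil
    then show ?case by (intro exI[of _ "[]"]) (simp add: splitting_def)
  next
    case (Cons S Ss T Ts)
    obtain L where L: "proper L" "concat Ss = left_word L" "concat Ts = right_word L"
      using Cons.IH[of "concat Ss" "concat Ts"] Cons.prems by (auto simp: splitting_def)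
    obtain t x where S: "t \<ge> 1" "S = blk t x"
      using Cons.prems(1) by (auto simp: splitting_def block_iff)
    obtain t' x' where T: "t' \<ge> 1" "T = blk t' x'"
      using Cons.prems(2) by (auto simp: splitting_def block_iff)
    have "t = t'" using Cons.prems(3) S T by (simp add: blk_def)
    then show ?case using Cons.prems(1,2) S T L
      by (intro exI[of _ "(t, x, x') # L"]) (auto simp: splitting_def)
  qed
qed

text \<open>A word paired with itself: the templates built for harmonious pairs then also serve a
  single collectable pattern.\<close>

lemma collectable_word:
  assumes "collectable P"
  obtains L where "proper L" "P = left_word L" "P = right_word L"
  using same_composition_words assms unfolding collectable_def by metis

lemma harmonious_words:
  assumes "harmonious P Q"
  obtains L where "proper L" "P = left_word L" "Q = right_word L"
proof -
  obtain Ss Ts where *: "splitting P Ss" "splitting Q Ts"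
    using assms by (auto simp: harmonious_def collectable_def)
  then show thesis
    using same_composition_words[OF *] that assms composition_eq[OF *(1)] composition_eq[OF *(2)]
    by (auto simp: harmonious_def)
qed

text \<open>After a common sequence of block sizes, ending at coordinate \<open>d\<close>, either the first runs of the
  two words have different lengths, or only \<open>Q\<close> fails to continue with a block.\<close>

lemma compare_words:
  assumes "collectable P" "balanced Q" "count_list P LA = count_list Q LA"
  shows "(\<exists>L. proper L \<and> P = left_word L \<and> Q = right_word L) \<or>
    (\<exists>x x' d. d < count_list Q LA \<and> before x P d d \<and> before x' Q d d \<and>
      ((\<exists>s<count_list Q LA. before x P s d \<noteq> before x' Q s d) \<or>
       (\<exists>u<count_list Q LA. \<exists>s<count_list Q LA. before x P u d \<and> before x' Q u d \<and>
          \<not> before x P s d \<and> \<not> before x' Q s d \<and> \<not> before x P s u \<and> before x' Q s u)))"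
proof -
  obtain L where "proper L" "P = left_word L" using collectable_word[OF assms(1)] .
  then show ?thesis using assms(2,3)
  proof (induction L arbitrary: P Q)
    case Nil
    then have "count_list Q LA = 0" "count_list Q LB = 0" by (auto simp: balanced_def)
    then have "LA \<notin> set Q" "LB \<notin> set Q" by (auto simp: count_list_0_iff)
    then have "x \<notin> set Q" for x by (cases x) auto
    then have "Q = []" by (cases Q) auto
    with Nil show ?case by (intro disjI1 exI[of _ "[]"]) auto
  next
    case (Cons a L)
    obtain t x y where a: "a = (t, x, y)" by (cases a)
    then have t: "t \<ge> 1" "proper L" and P: "P = blk t x @ left_word L" using Cons.prems by auto
    let ?m = "count_list Q LA"
    have m: "t \<le> ?m" using Cons.prems(4) P by simp
    then have "Q \<noteq> []" using t by auto
    \<comment> \<open>At \<open>d = 0\<close> the relation at \<open>(p, 0)\<close> reads off the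
      length of the first run, and the one at \<open>(t, t - 1)\<close> tests whether a block of
      size \<open>t\<close> is completed.\<close>
    have P1: "before x P p 0 \<longleftrightarrow> p < t" for p using t by (auto simp: P before_blk)
    have P2: "\<not> before x P t (t - 1)" using t by (auto simp: P before_blk)
    from \<open>balanced Q\<close> \<open>Q \<noteq> []\<close> show ?case
    proof (cases rule: balanced_first_run)
      case (block t' x' w)
      have Q1: "before x' Q p 0 \<longleftrightarrow> p < t'" for p using block by (auto simp: before_blk)
      show ?thesis
      proof (cases "t' = t")
        case True
        have "count_list (left_word L) LA = count_list w LA"
          using Cons.prems(4) P block True by simp
        from Cons.IH[OF t(2) refl \<open>balanced w\<close> this] show ?thesis
        proof (elim disjE exE conjE, goal_cases)
          case (1 L')
          then show ?thesis using P block True t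
            by (intro disjI1 exI[of _ "(t, x, x') # L'"]) auto
        next
          case (2 z z' d s)
          then show ?thesis using P block True
            by (intro disjI2 exI[of _ z] exI[of _ z'] exI[of _ "t + d"] conjI disjI1
                exI[of _ "t + s"]) (auto simp: before_blk_shift)
        next
          case (3 z z' d u s)
          then show ?thesis using P block True
            by (intro disjI2 exI[of _ z] exI[of _ z'] exI[of _ "t + d"] conjI
                exI[of _ "t + u"] exI[of _ "t + s"]) (auto simp: before_blk_shift)
        qed
      next
        case False
        have "t' \<le> ?m" using block by simp
        \<comment> \<open>The index \<open>min t t'\<close> lies in the longer of the two first runs
          and just beyond the shorter one.\<close>
        with False m have "min t t' < ?m" "(min t t' < t) \<noteq> (min t t' < t')" by auto
        moreover have "0 < ?m" "0 < t'" using m t block by auto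
        ultimately show ?thesis using t
          by (intro disjI2 exI[of _ x] exI[of _ x'] exI[of _ 0] conjI disjI1
                exI[of _ "min t t'"]) (simp_all only: P1 Q1, auto)
      qed
    next
      case (short t' x' j v)
      have "count_list v x' \<ge> 1" using short by (cases v) auto
      then have "t' < count_list Q x'" using short(3) by simp
      then have t'm: "t' < ?m" using balanced_count[OF \<open>balanced Q\<close>, of x'] by simp
      have Q1: "before x' Q p 0 \<longleftrightarrow> p < t'" for p
        using short by (auto simp: before_replicate before_replicate_other)
      have Q2: "before x' Q t' (t' - 1)"
        using short by (auto simp: before_replicate before_replicate_other intro: before_hd)
      show ?thesis
      proof (cases "t' = t")
        case True
        \<comment> \<open>The first runs agree, but \<open>Q\<close> returns to \<open>x'\<close>
          before \<open>t\<close> other letters have appeared, whereas \<open>P\<close> completes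
          its block.\<close>
        show ?thesis
          by (intro disjI2 exI[of _ x] exI[of _ x'] exI[of _ 0] conjI
                exI[of _ "t - 1"] exI[of _ t])
            (use True t t'm P2 Q2 in \<open>simp_all only: P1 Q1, auto\<close>)
      next
        case False
        with t'm m have "min t t' < ?m" "(min t t' < t) \<noteq> (min t t' < t')" by auto
        moreover have "0 < ?m" "0 < t'" using m t short by auto
        ultimately show ?thesis using t
          by (intro disjI2 exI[of _ x] exI[of _ x'] exI[of _ 0] conjI disjI1
                exI[of _ "min t t'"]) (simp_all only: P1 Q1, auto)
      qed
    qed
  qed
qed

section \<open>Template edges for harmonious patterns\<close>

definition tsize :: "(nat \<times> letter \<times> letter) list \<Rightarrow> nat" where
  "tsize L = sum_list (map fst L)"

text \<open>The edge in cell \<open>(i, j)\<close> takes its place among \<open>k\<close> edges in a block of \<open>left_word L\<close> and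
  \<open>right_word L\<close> according to \<open>i\<close> if the two words agree there, and according to \<open>j\<close> otherwise.\<close>

definition slot :: "nat \<Rightarrow> letter \<Rightarrow> letter \<Rightarrow> nat \<Rightarrow> nat \<Rightarrow> nat" where
  "slot k x x' i j =
     (let a = if x = x' then i else j in if x = LA then a else k - 1 - a)"

text \<open>A block of size \<open>t\<close> owns the next \<open>k * t\<close> positions, cut into
  \<open>k\<close> groups of \<open>t\<close> consecutive ones; the slot is the index of the group
  that the edge occupies. The value for the empty list is a dummy.\<close>

fun tpos :: "nat \<Rightarrow> (nat \<times> letter \<times> letter) list \<Rightarrow> nat \<Rightarrow> nat \<Rightarrow> nat \<Rightarrow> nat" where
  "tpos k [] i j p = 0"
| "tpos k ((t, x, x') # L) i j p =
     (if p < t then slot k x x' i j * t + p else k * t + tpos k L i j (p - t))"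

lemma tsize_simps [simp]: "tsize [] = 0" "tsize ((t, x, x') # L) = t + tsize L"
  by (auto simp: tsize_def)

lemma count_list_words: "count_list (left_word L) x = tsize L" "count_list (right_word L) x = tsize L"
  by (induction L) auto

lemma slot_less: "i < k \<Longrightarrow> j < k \<Longrightarrow> slot k x x' i j < k"
  by (auto simp: slot_def Let_def)

lemma slot_block_less:
  assumes "i < k" "j < k" "p < t"
  shows "slot k x x' i j * t + p < k * t"
proof -
  have "Suc (slot k x x' i j) * t \<le> k * t"
    using slot_less[OF assms(1,2), of x x'] by (intro mult_le_mono1) simp
  then show ?thesis using assms(3) by simp
qed

lemma tpos_less: "i < k \<Longrightarrow> j < k \<Longrightarrow> p < tsize L \<Longrightarrow> tpos k L i j p < k * tsize L"
proof (induction L arbitrary: p)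
  case (Cons a L)
  obtain t x x' where a: "a = (t, x, x')" by (cases a)
  show ?case
  proof (cases "p < t")
    case True
    then show ?thesis
      using slot_block_less[of i k j p t x x'] Cons.prems by (simp add: a distrib_left trans_less_add1)
  next
    case False
    then have "p - t < tsize L" using Cons.prems by (simp add: a)
    from Cons.IH[OF Cons.prems(1,2) this] show ?thesis using False by (simp add: a distrib_left)
  qed
qed simp

lemma tpos_strict_mono:
  "i < k \<Longrightarrow> j < k \<Longrightarrow> p < q \<Longrightarrow> q < tsize L \<Longrightarrow> tpos k L i j p < tpos k L i j q"
proof (induction L arbitrary: p q)
  case (Cons a L)
  obtain t x x' where a: "a = (t, x, x')" by (cases a)
  show ?case
  proof (cases "p < t")
    case True
    then show ?thesis
      using slot_block_less[of i k j p t x x'] Cons.prems by (auto simp: a trans_less_add1)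
  next
    case False
    then have "p - t < q - t" "q - t < tsize L" using Cons.prems by (auto simp: a)
    from Cons.IH[OF Cons.prems(1,2) this] show ?thesis using False Cons.prems by (simp add: a)
  qed
qed simp

lemma block_order:
  fixes s s' t p q :: nat
  assumes "p < t" "q < t" "s < s'"
  shows "s * t + p < s' * t + q"
proof -
  have "Suc s * t \<le> s' * t" using assms(3) by (intro mult_le_mono1) simp
  then show ?thesis using assms(1) by simp
qed

lemma block_split: "s < s' \<or> s' < s \<Longrightarrow> p < t \<Longrightarrow> q < t \<Longrightarrow>
   s * t + p < s' * t + q \<longleftrightarrow> s < (s' :: nat)"
  using block_order[of p t q s s'] block_order[of q t p s' s] by auto

text \<open>The common core for both words: \<open>y\<close> selects from each block the letter of
  the word in question. Inside a block, edges with different slots occupy disjoint groups, so only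
  the order of the slots matters; across blocks the order of the blocks decides.\<close>

lemma tpos_before:
  assumes "i < k" "j < k" "i' < k" "j' < k" "p < tsize L" "q < tsize L"
    and sl: "\<And>x x'. (if y x x' = LA then slot k x x' i j < slot k x x' i' j'
       else slot k x x' i' j' < slot k x x' i j)"
  shows "tpos k L i j p < tpos k L i' j' q \<longleftrightarrow>
    before LA (concat (map (\<lambda>(t, x, x'). blk t (y x x')) L)) p q"
  using assms(5,6)
proof (induction L arbitrary: p q)
  case (Cons a L)
  obtain t x x' where a: "a = (t, x, x')" by (cases a)
  define W where "W = concat (map (\<lambda>(t, x, x'). blk t (y x x')) L)"
  have IH: "tpos k L i j (p - t) < tpos k L i' j' (q - t) \<longleftrightarrow> before LA W (p - t) (q - t)"
    if "\<not> p < t" "\<not> q < t"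
    unfolding W_def using that Cons.prems by (intro Cons.IH) (auto simp: a)
  have b: "before LA (blk t (y x x') @ W) p q \<longleftrightarrow>
     (if y x x' = LA then p < t \<or> t \<le> q \<and> before LA W (p - t) (q - t)
      else t \<le> q \<and> (p < t \<or> before LA W (p - t) (q - t)))"
    using before_blk[of LA t W p q] before_blk_other[of LA t W p q]
    by (cases "y x x'") auto
  have l: "p < t \<Longrightarrow> slot k x x' i j * t + p < k * t" "q < t \<Longrightarrow> slot k x x' i' j' * t + q < k * t"
    using assms slot_block_less by auto
  have "tpos k (a # L) i j p < tpos k (a # L) i' j' q \<longleftrightarrow> before LA (blk t (y x x') @ W) p q"
  proof (cases "p < t"; cases "q < t")
    assume "p < t" "q < t"
    then show ?thesis using sl[of x x'] block_split[of "slot k x x' i j" "slot k x x' i' j'" p t q] b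
      by (auto simp: a split: if_splits)
  qed (use l IH b in \<open>auto simp: a split: if_splits\<close>)
  then show ?case by (simp add: a W_def)
qed simp

lemma tpos_before_left:
  assumes "i < i'" "j < j'" "i' < k" "j' < k" "p < tsize L" "q < tsize L"
  shows "tpos k L i j p < tpos k L i' j' q \<longleftrightarrow> before LA (left_word L) p q"
proof -
  have "if x = LA then slot k x x' i j < slot k x x' i' j' else slot k x x' i' j' < slot k x x' i j"
    for x x'
    using assms(1-4) by (auto simp: slot_def Let_def)
  from tpos_before[of i k j i' j' p L q "\<lambda>x x'. x", OF _ _ _ _ assms(5,6) this]
  show ?thesis using assms(1-4) by (simp add: left_word_def)
qed

text \<open>Compared with two increasing indices, reversing the order of the \<open>j\<close>'s
  reverses the slots exactly in the blocks where the words differ, which turns the letter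
  \<open>x\<close> there into \<open>x'\<close>.\<close>

lemma tpos_before_right:
  assumes "i < i'" "j' < j" "i' < k" "j < k" "p < tsize L" "q < tsize L"
  shows "tpos k L i j p < tpos k L i' j' q \<longleftrightarrow> before LA (right_word L) p q"
proof -
  have "if x' = LA then slot k x x' i j < slot k x x' i' j' else slot k x x' i' j' < slot k x x' i j"
    for x x'
    using assms(1-4) by (cases x; cases x') (auto simp: slot_def Let_def)
  from tpos_before[of i k j i' j' p L q "\<lambda>x x'. x'", OF _ _ _ _ assms(5,6) this]
  show ?thesis using assms(1-4) by (simp add: right_word_def)
qed

lemma slot_determines:
  assumes "i < k" "j < k" "i' < k" "j' < k" "slot k x x' i j = slot k x x' i' j'"
  shows "if x = x' then i = i' else j = j'"
  using assms by (auto simp: slot_def Let_def split: if_splits)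

lemma block_eq:
  fixes s s' t p q :: nat
  assumes "p < t" "q < t" "s * t + p = s' * t + q"
  shows "s = s'"
  using block_order[of p t q s s'] block_order[of q t p s' s] assms
  by (metis less_irrefl linorder_neqE_nat)

text \<open>A position lies in one group of one block and so fixes the slot there, which depends
  injectively on one index of the cell. Hence at most \<open>k\<close> of the \<open>k^2\<close>
  template edges contain it.\<close>

lemma tpos_vertex_cell:
  "\<exists>c. (\<forall>i j p. i < k \<longrightarrow> j < k \<longrightarrow> p < tsize L \<longrightarrow> tpos k L i j p = v \<longrightarrow> i = c) \<or>
       (\<forall>i j p. i < k \<longrightarrow> j < k \<longrightarrow> p < tsize L \<longrightarrow> tpos k L i j p = v \<longrightarrow> j = c)"
proof (induction L arbitrary: v)
  case (Cons a L)
  obtain t x x' where a: "a = (t, x, x')" by (cases a)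
  show ?case
  proof (cases "v < k * t")
    case True
    have lt: "p < t" if "tpos k (a # L) i j p = v" for i j p
      using that True by (auto simp: a split: if_splits)
    have val: "v = slot k x x' i j * t + p" if "tpos k (a # L) i j p = v" for i j p
      using that lt[OF that] by (simp add: a)
    have eq: "if x = x' then i = i' else j = j'"
      if "i < k" "j < k" "i' < k" "j' < k" "tpos k (a # L) i j p = v" "tpos k (a # L) i' j' q = v"
      for i j p i' j' q
    proof -
      have "slot k x x' i j * t + p = slot k x x' i' j' * t + q"
        using val[OF that(5)] val[OF that(6)] by simp
      from block_eq[OF lt[OF that(5)] lt[OF that(6)] this]
      show ?thesis by (rule slot_determines[OF that(1-4)])
    qed
    show ?thesis
    proof (cases "\<exists>i j p. i < k \<and> j < k \<and> tpos k (a # L) i j p = v")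
      case True
      then obtain i j p where ij: "i < k" "j < k" "tpos k (a # L) i j p = v" by blast
      show ?thesis
      proof (cases "x = x'")
        case True
        then have "i' = i" if "i' < k" "j' < k" "tpos k (a # L) i' j' q = v" for i' j' q
          using eq[OF that(1,2) ij(1,2) that(3) ij(3)] by simp
        then show ?thesis by (intro exI[of _ i] disjI1 allI impI)
      next
        case False
        then have "j' = j" if "i' < k" "j' < k" "tpos k (a # L) i' j' q = v" for i' j' q
          using eq[OF that(1,2) ij(1,2) that(3) ij(3)] by simp
        then show ?thesis by (intro exI[of _ j] disjI2 allI impI)
      qed
    next
      case False
      show ?thesis by (intro exI[of _ 0] disjI1 allI impI) (use False in blast)
    qed
  next
    case False
    have *: "p - t < tsize L \<and> tpos k L i j (p - t) = v - k * t"
      if "i < k" "j < k" "p < tsize (a # L)" "tpos k (a # L) i j p = v" for i j p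
      using that False slot_block_less[of i k j p t x x'] by (auto simp: a split: if_splits)
    obtain c where "(\<forall>i j p. i < k \<longrightarrow> j < k \<longrightarrow> p < tsize L \<longrightarrow> tpos k L i j p = v - k * t \<longrightarrow> i = c) \<or>
       (\<forall>i j p. i < k \<longrightarrow> j < k \<longrightarrow> p < tsize L \<longrightarrow> tpos k L i j p = v - k * t \<longrightarrow> j = c)"
      using Cons.IH[of "v - k * t"] ..
    then show ?thesis
    proof
      assume c: "\<forall>i j p. i < k \<longrightarrow> j < k \<longrightarrow> p < tsize L \<longrightarrow> tpos k L i j p = v - k * t \<longrightarrow> i = c"
      show ?thesis
        by (intro exI[of _ c] disjI1 allI impI) (metis c *)
    next
      assume c: "\<forall>i j p. i < k \<longrightarrow> j < k \<longrightarrow> p < tsize L \<longrightarrow> tpos k L i j p = v - k * t \<longrightarrow> j = c"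
      show ?thesis
        by (intro exI[of _ c] disjI2 allI impI) (metis c *)
    qed
  qed
qed simp

text \<open>\<open>p\<close> is the first coordinate of a block where the letters differ. It serves
  twice: as the coordinate that reveals \<open>j\<close> in a template edge, and as the coordinate
  whose order tells the two patterns apart in the upper bound.\<close>

lemma tpos_differ:
  assumes "proper L" "left_word L \<noteq> right_word L"
  shows "\<exists>p<tsize L. before LA (left_word L) p p \<noteq> before LA (right_word L) p p \<and>
    (\<forall>i i' j j'. j < k \<longrightarrow> j' < k \<longrightarrow> (tpos k L i j p = tpos k L i' j' p \<longleftrightarrow> j = j'))"
  using assms
proof (induction L)
  case (Cons a L)
  obtain t x x' where a: "a = (t, x, x')" by (cases a)
  show ?case
  proof (cases "x = x'")
    case True
    then have "proper L" "left_word L \<noteq> right_word L" using Cons.prems by (auto simp: a)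
    then obtain p where p: "p < tsize L" "before LA (left_word L) p p \<noteq> before LA (right_word L) p p"
      "\<And>i i' j j'. j < k \<Longrightarrow> j' < k \<Longrightarrow> tpos k L i j p = tpos k L i' j' p \<longleftrightarrow> j = j'"
      using Cons.IH by blast
    then show ?thesis by (intro exI[of _ "t + p"]) (simp add: a before_blk_shift)
  next
    case False
    have t: "t \<ge> 1" using Cons.prems by (simp add: a)
    have "before LA (left_word (a # L)) 0 0 \<noteq> before LA (right_word (a # L)) 0 0"
      using False t by (cases x; cases x'; simp add: a blk_def before_replicate
          before_replicate_other[of LA, simplified])
    moreover have "tpos k (a # L) i j 0 = tpos k (a # L) i' j' 0 \<longleftrightarrow> j = j'"
      if "j < k" "j' < k" for i i' j j'
      using that t False by (auto simp: a slot_def Let_def)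
    ultimately show ?thesis using t by (intro exI[of _ 0]) (simp add: a)
  qed
qed simp

definition tedge :: "nat \<Rightarrow> (nat \<times> letter \<times> letter) list \<Rightarrow> nat \<Rightarrow> nat \<Rightarrow> nat set" where
  "tedge k L i j = tpos k L i j ` {..<tsize L}"

lemma tedge_props:
  assumes "i < k" "j < k"
  shows "finite (tedge k L i j)" "card (tedge k L i j) = tsize L"
    "tedge k L i j \<subseteq> {..<k * tsize L}" "p < tsize L \<Longrightarrow> vx (tedge k L i j) p = tpos k L i j p"
proof -
  have m: "strict_mono_on {..<tsize L} (tpos k L i j)"
    using tpos_strict_mono[OF assms] by (auto simp: strict_mono_on_def)
  show "finite (tedge k L i j)" by (simp add: tedge_def)
  show "card (tedge k L i j) = tsize L"
    unfolding tedge_def using strict_mono_on_imp_inj_on[OF m] by (simp add: card_image)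
  show "tedge k L i j \<subseteq> {..<k * tsize L}" using tpos_less[OF assms] by (auto simp: tedge_def)
  have "vx {..<n} p = p" if "p < n" for n p
    using that by (simp add: vx_def lessThan_atLeast0)
  then show "vx (tedge k L i j) p = tpos k L i j p" if "p < tsize L"
    unfolding tedge_def using vx_image[OF _ m] that by simp
qed

text \<open>The first block orients both words, so its slot is \<open>i\<close>; a block in which the two words differ
  has slot \<open>j\<close> or \<open>k - 1 - j\<close>.\<close>

lemma tedge_disjoint:
  assumes "L = (t, LA, LA) # L'" "proper L" "i < k" "j < k" "i' < k" "j' < k"
    and "tedge k L i j \<inter> tedge k L i' j' = {}"
  shows "i \<noteq> i'" "left_word L \<noteq> right_word L \<Longrightarrow> j \<noteq> j'"
proof -
  have "tpos k L i j 0 \<in> tedge k L i j" "tpos k L i' j' 0 \<in> tedge k L i' j'"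
    using assms(1,2) by (auto simp: tedge_def)
  then have "tpos k L i j 0 \<noteq> tpos k L i' j' 0" using assms(7) by auto
  then show "i \<noteq> i'" using assms(1,2) by (auto simp: slot_def)
  assume "left_word L \<noteq> right_word L"
  from tpos_differ[OF assms(2) this, of k] obtain p where p: "p < tsize L"
    "\<forall>i i' j j'. j < k \<longrightarrow> j' < k \<longrightarrow> (tpos k L i j p = tpos k L i' j' p \<longleftrightarrow> j = j')"
    by blast
  have mem: "tpos k L a b p \<in> tedge k L a b" for a b using p(1) by (simp add: tedge_def)
  show "j \<noteq> j'"
  proof
    assume "j = j'"
    then have "tpos k L i j p = tpos k L i' j' p" using p(2) assms(4,6) by blast
    then show False using mem[of i j] mem[of i' j'] assms(7) by auto
  qed
qed

lemma tedge_degree: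
  obtains c where "(\<forall>i j. i < k \<longrightarrow> j < k \<longrightarrow> v \<in> tedge k L i j \<longrightarrow> i = c) \<or>
    (\<forall>i j. i < k \<longrightarrow> j < k \<longrightarrow> v \<in> tedge k L i j \<longrightarrow> j = c)"
proof -
  have mem: "\<exists>p<tsize L. tpos k L i j p = v" if "v \<in> tedge k L i j" for i j
    using that by (auto simp: tedge_def)
  obtain c where "(\<forall>i j p. i < k \<longrightarrow> j < k \<longrightarrow> p < tsize L \<longrightarrow> tpos k L i j p = v \<longrightarrow> i = c) \<or>
       (\<forall>i j p. i < k \<longrightarrow> j < k \<longrightarrow> p < tsize L \<longrightarrow> tpos k L i j p = v \<longrightarrow> j = c)"
    using tpos_vertex_cell[of k L v] ..
  then show thesis
  proof
    assume "\<forall>i j p. i < k \<longrightarrow> j < k \<longrightarrow> p < tsize L \<longrightarrow> tpos k L i j p = v \<longrightarrow> i = c"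
    then have "\<forall>i j. i < k \<longrightarrow> j < k \<longrightarrow> v \<in> tedge k L i j \<longrightarrow> i = c" using mem by blast
    then show thesis by (intro that disjI1)
  next
    assume "\<forall>i j p. i < k \<longrightarrow> j < k \<longrightarrow> p < tsize L \<longrightarrow> tpos k L i j p = v \<longrightarrow> j = c"
    then have "\<forall>i j. i < k \<longrightarrow> j < k \<longrightarrow> v \<in> tedge k L i j \<longrightarrow> j = c" using mem by blast
    then show thesis by (intro that disjI2)
  qed
qed

lemma tedge_arranged:
  assumes "i < k" "j < k" "i' < k" "j' < k" "i < i'"
  shows "j < j' \<Longrightarrow> arranged (tsize L) (before LA (left_word L)) (tedge k L i j) (tedge k L i' j')"
    "j' < j \<Longrightarrow> arranged (tsize L) (before LA (right_word L)) (tedge k L i j) (tedge k L i' j')"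
  using assms tpos_before_left[of i i' j j' k _ L] tpos_before_right[of i i' j' j k _ L]
  by (auto simp: arranged_def tedge_props)

section \<open>Counting matchings\<close>

text \<open>Arbitrary vertex sets are allowed so that deleting edges together with their vertices
  leaves an object of the same kind.\<close>

definition perfect :: "nat \<Rightarrow> nat set \<Rightarrow> nat set set set" where
  "perfect r V = {M. ordered_matching r M \<and> \<Union>M = V}"

lemma ordered_matching_subset: "ordered_matching r M \<Longrightarrow> N \<subseteq> M \<Longrightarrow> ordered_matching r N"
  unfolding ordered_matching_def by (blast intro: finite_subset pairwise_subset)

lemma card_Union_matching: "ordered_matching r M \<Longrightarrow> card (\<Union>M) = r * card M"
  unfolding ordered_matching_def using card_Union_disjoint[of M] by simp

lemma matchings_eq_perfect:
  assumes "r \<ge> 1"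
  shows "matchings r n = perfect r {1..r * n}"
proof -
  have "card M = n" if "ordered_matching r M" "\<Union>M = {1..r * n}" for M :: "nat set set"
    using card_Union_matching[OF that(1)] that(2) assms by simp
  then show ?thesis by (auto simp: matchings_def perfect_def)
qed

lemma finite_perfect: "finite V \<Longrightarrow> finite (perfect r V)"
  by (rule finite_subset[of _ "Pow (Pow V)"]) (auto simp: perfect_def)

lemma card_perfect_containing:
  assumes "ordered_matching r S" "\<Union>S \<subseteq> V" "r \<ge> 1"
  shows "card {M \<in> perfect r V. S \<subseteq> M} = card (perfect r (V - \<Union>S))"
proof (rule bij_betw_same_card[of "\<lambda>M. M - S"], rule bij_betw_byWitness[where f' = "\<lambda>M. M \<union> S"])
  \<comment> \<open>An empty edge would be disjoint from itself and could lie both in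
    \<open>S\<close> and in a matching of the remaining vertices.\<close>
  have ne: "e \<noteq> {}" if "ordered_matching r N" "e \<in> N" for e :: "nat set" and N
    using that assms(3) by (auto simp: ordered_matching_def)
  show "\<forall>M\<in>{M \<in> perfect r V. S \<subseteq> M}. M - S \<union> S = M" by auto
  have disj: "M \<inter> S = {}" if "M \<in> perfect r (V - \<Union>S)" for M
  proof (rule ccontr)
    assume "M \<inter> S \<noteq> {}"
    then obtain e where e: "e \<in> M" "e \<in> S" by blast
    have M: "ordered_matching r M" "\<Union>M = V - \<Union>S" using that by (auto simp: perfect_def)
    have "e \<subseteq> V - \<Union>S" unfolding M(2)[symmetric] using e(1) by blast
    moreover have "e \<noteq> {}" using ne[OF M(1) e(1)] .
    ultimately show False using e(2) by blast
  qed
  then show "\<forall>M\<in>perfect r (V - \<Union>S). M \<union> S - S = M" by blast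
  show "(\<lambda>M. M - S) ` {M \<in> perfect r V. S \<subseteq> M} \<subseteq> perfect r (V - \<Union>S)"
  proof (rule image_subsetI)
    fix M assume "M \<in> {M \<in> perfect r V. S \<subseteq> M}"
    then have M: "M \<in> perfect r V" "S \<subseteq> M" by simp_all
    have "ordered_matching r (M - S)"
      using M ordered_matching_subset[of r M] by (auto simp: perfect_def)
    moreover have "\<Union>(M - S) = V - \<Union>S"
    proof -
      have pw: "pairwise disjnt M" and U: "\<Union>M = V" using M by (auto simp: perfect_def ordered_matching_def)
      have "e \<inter> f = {}" if "e \<in> M" "e \<notin> S" "f \<in> S" for e f
        using pairwiseD[OF pw, of e f] that M(2) by (auto simp: disjnt_def)
      then have "\<Union>(M - S) \<inter> \<Union>S = {}" by blast
      moreover have "\<Union>(M - S) \<union> \<Union>S = \<Union>M" using M(2) by blast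
      ultimately show ?thesis using U by blast
    qed
    ultimately show "M - S \<in> perfect r (V - \<Union>S)" by (simp add: perfect_def)
  qed
  show "(\<lambda>M. M \<union> S) ` perfect r (V - \<Union>S) \<subseteq> {M \<in> perfect r V. S \<subseteq> M}"
  proof (rule image_subsetI)
    fix M assume M: "M \<in> perfect r (V - \<Union>S)"
    then have U: "\<Union>M = V - \<Union>S" and m: "ordered_matching r M" by (auto simp: perfect_def)
    have "disjnt e f" if "e \<in> M" "f \<in> S" for e f
      using that U by (auto simp: disjnt_def)
    then have "ordered_matching r (M \<union> S)"
      using m assms(1) unfolding ordered_matching_def pairwise_def by (metis Un_iff disjnt_sym finite_UnI)
    moreover have "\<Union>(M \<union> S) = V" using U assms(2) by auto
    ultimately show "M \<union> S \<in> {M \<in> perfect r V. S \<subseteq> M}" by (simp add: perfect_def)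
  qed
qed

section \<open>The number of matchings on a given vertex set\<close>

definition num_matchings :: "nat \<Rightarrow> nat \<Rightarrow> real" where
  "num_matchings r m = fact (r * m) / (fact r ^ m * fact m)"

lemma ordered_matching_singleton: "ordered_matching r {e} \<longleftrightarrow> finite e \<and> card e = r"
  by (auto simp: ordered_matching_def)

lemma sum_card_incidence:
  assumes "finite A" "finite B"
  shows "(\<Sum>a\<in>A. card {b \<in> B. R a b}) = (\<Sum>b\<in>B. card {a \<in> A. R a b})"
  using sum_multicount_gen[of A B R "\<lambda>b. card {a \<in> A. R a b}"] assms by simp

text \<open>Double counting of the pairs of a matching and one of its edges: each matching has
  \<open>m + 1\<close> edges, and each \<open>r\<close>-set extends by a matching of the remaining
  \<open>r * m\<close> vertices.\<close>

lemma card_perfect: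
  assumes "finite V" "card V = r * m" "r \<ge> 1"
  shows "real (card (perfect r V)) = num_matchings r m"
  using assms(1,2)
proof (induction m arbitrary: V)
  case 0
  then have V: "V = {}" by simp
  have "M = {}" if "M \<in> perfect r V" for M
  proof (rule ccontr)
    assume "M \<noteq> {}"
    then obtain e where "e \<in> M" by blast
    moreover from this have "e = {}" using that V by (auto simp: perfect_def)
    ultimately show False using that assms(3) by (auto simp: perfect_def ordered_matching_def)
  qed
  moreover have "{} \<in> perfect r V" using V by (simp add: perfect_def ordered_matching_def)
  ultimately have "perfect r V = {{}}" by blast
  then show ?case by (simp add: num_matchings_def)
next
  case (Suc m)
  let ?E = "{e. e \<subseteq> V \<and> card e = r}"
  have finE: "finite ?E" using Suc.prems(1) by simp
  have sub: "{e \<in> ?E. e \<in> M} = M" if "M \<in> perfect r V" for M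
    using that by (auto simp: perfect_def ordered_matching_def)
  have cardM: "card M = Suc m" if "M \<in> perfect r V" for M
  proof -
    have "r * card M = r * Suc m"
      using that card_Union_matching[of r M] Suc.prems(2) by (simp add: perfect_def)
    then show ?thesis using assms(3) by (simp only: mult_cancel1) auto
  qed
  have rest: "real (card {M \<in> perfect r V. e \<in> M}) = num_matchings r m" if "e \<in> ?E" for e
  proof -
    have e: "finite e" "e \<subseteq> V" "card e = r" using that Suc.prems(1) finite_subset by auto
    have "card {M \<in> perfect r V. {e} \<subseteq> M} = card (perfect r (V - \<Union>{e}))"
      using e assms(3) by (intro card_perfect_containing) (auto simp: ordered_matching_singleton)
    moreover have "card (V - e) = r * m" using e Suc.prems by (simp add: card_Diff_subset)
    ultimately show ?thesis using Suc.IH[of "V - e"] Suc.prems(1) by simp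
  qed
  have "(\<Sum>M\<in>perfect r V. card {e \<in> ?E. e \<in> M}) = (\<Sum>M\<in>perfect r V. Suc m)"
    by (rule sum.cong) (simp_all only: sub cardM)
  then have "real (card (perfect r V)) * real (Suc m) = real (\<Sum>M\<in>perfect r V. card {e \<in> ?E. e \<in> M})"
    by (simp only: sum_constant of_nat_mult of_nat_id)
  also have "\<dots> = real (\<Sum>e\<in>?E. card {M \<in> perfect r V. e \<in> M})"
    using sum_card_incidence[OF finite_perfect[OF Suc.prems(1), of r] finE, of "\<lambda>M e. e \<in> M"]
    by simp
  also have "\<dots> = (\<Sum>e\<in>?E. num_matchings r m)"
    unfolding of_nat_sum by (rule sum.cong) (use rest in auto)
  also have "\<dots> = real (r * Suc m choose r) * num_matchings r m"
    using n_subsets[OF Suc.prems(1), of r] Suc.prems(2) by simp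
  also have "real (r * Suc m choose r) = fact (r * Suc m) / (fact r * fact (r * m))"
    by (subst binomial_fact) (auto simp: algebra_simps)
  finally have *: "real (card (perfect r V)) * real (Suc m) =
      fact (r * Suc m) / (fact r * fact (r * m)) * (fact (r * m) / (fact r ^ m * fact m))"
    unfolding num_matchings_def .
  have "c = A / (B * D * (k * E))"
    if "c * k = A / (B * C) * (C / (D * E))" "C \<noteq> 0" "k \<noteq> 0" for c k A B C D E :: real
  proof -
    have "c = c * k / k" using that(3) by simp
    also have "\<dots> = A / (B * D * (k * E))" unfolding that(1) using that(2) by simp
    finally show ?thesis .
  qed
  from this[OF *] show ?case by (simp add: num_matchings_def del: of_nat_Suc)
qed

text \<open>For \<open>s \<le> n\<close>, the probability that \<open>s\<close> given pairwise
  disjoint edges all belong to the random matching.\<close>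

definition incl_prob :: "nat \<Rightarrow> nat \<Rightarrow> nat \<Rightarrow> real" where
  "incl_prob r n s = num_matchings r (n - s) / num_matchings r n"

lemma num_matchings_pos: "num_matchings r m > 0"
  by (simp add: num_matchings_def)

abbreviation RM_prob :: "nat \<Rightarrow> nat \<Rightarrow> nat set set set \<Rightarrow> real" where
  "RM_prob r n A \<equiv> measure_pmf.prob (RM r n) A"

lemma prob_RM:
  assumes "r \<ge> 1"
  shows "RM_prob r n A = card {M \<in> perfect r {1..r * n}. M \<in> A} / num_matchings r n"
proof -
  have "card (matchings r n) = num_matchings r n"
    using card_perfect[of "{1..r * n}" r n] assms by (simp add: matchings_eq_perfect)
  moreover have "matchings r n \<inter> A = {M \<in> perfect r {1..r * n}. M \<in> A}"
    using assms by (auto simp: matchings_eq_perfect)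
  ultimately show ?thesis
    unfolding RM_def
    using measure_pmf_of_set[OF matchings_nonempty[OF assms] finite_matchings, of n A] by simp
qed

lemma card_containing:
  assumes "r \<ge> 1" "ordered_matching r S" "\<Union>S \<subseteq> {1..r * n}" "card S = s"
  shows "real (card {M \<in> perfect r {1..r * n}. S \<subseteq> M}) = num_matchings r (n - s)"
proof -
  have "finite (\<Union>S)" using assms(3) finite_subset by blast
  then have "card ({1..r * n} - \<Union>S) = r * (n - s)"
    using assms card_Union_matching[of r S]
    by (simp add: card_Diff_subset right_diff_distrib')
  then show ?thesis
    using card_perfect_containing[OF assms(2,3,1)] card_perfect[of "{1..r * n} - \<Union>S" r "n - s"] assms(1)
    by simp
qed

text \<open>A set that is not a matching on the given vertices lies in no matching at all. Union
  bounds may therefore run over arbitrary families of sets.\<close>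

lemma card_containing_le:
  assumes "r \<ge> 1" "card S = s"
  shows "real (card {M \<in> perfect r {1..r * n}. S \<subseteq> M}) \<le> num_matchings r (n - s)"
proof (cases "{M \<in> perfect r {1..r * n}. S \<subseteq> M} = {}")
  case True
  show ?thesis unfolding True using num_matchings_pos[of r "n - s"] by simp
next
  case False
  then obtain M where M: "M \<in> perfect r {1..r * n}" "S \<subseteq> M" by blast
  then have "ordered_matching r S" "\<Union>S \<subseteq> {1..r * n}"
    using ordered_matching_subset[of r M S] by (auto simp: perfect_def)
  from card_containing[OF assms(1) this assms(2)] show ?thesis by simp
qed

lemma prob_contains_some_le:
  assumes "r \<ge> 1" "finite \<S>" "\<And>S. S \<in> \<S> \<Longrightarrow> card S = s"
  shows "RM_prob r n {M. \<exists>S\<in>\<S>. S \<subseteq> M} \<le> card \<S> * incl_prob r n s"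
proof -
  have "{M. \<exists>S\<in>\<S>. S \<subseteq> M} = (\<Union>S\<in>\<S>. {M. S \<subseteq> M})" by auto
  then have "RM_prob r n {M. \<exists>S\<in>\<S>. S \<subseteq> M}
      \<le> (\<Sum>S\<in>\<S>. RM_prob r n {M. S \<subseteq> M})"
    using measure_pmf.finite_measure_subadditive_finite[OF assms(2), of "\<lambda>S. {M. S \<subseteq> M}" "RM r n"]
    by simp
  also have "\<dots> \<le> (\<Sum>S\<in>\<S>. incl_prob r n s)"
    using card_containing_le[OF assms(1,3)] num_matchings_pos[of r n]
    by (intro sum_mono) (simp add: prob_RM[OF assms(1)] incl_prob_def divide_right_mono)
  finally show ?thesis by simp
qed

section \<open>Size of the inclusion probabilities\<close>

lemma incl_prob_eq:
  assumes "s \<le> n"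
  shows "incl_prob r n s =
    fact r ^ s * (fact n / fact (n - s)) * (fact (r * n - r * s) / fact (r * n))"
proof -
  have *: "(fact r :: real) ^ n = fact r ^ s * fact r ^ (n - s)"
    using assms by (simp flip: power_add)
  have "a / (p * b) / (c / (x * p * d)) = x * (d / b) * (a / c)" if "p \<noteq> 0" for a b c d p x :: real
    using that by simp
  then show ?thesis
    unfolding incl_prob_def num_matchings_def * by (simp add: right_diff_distrib')
qed

lemma fact_ratio_Suc:
  assumes "Suc s \<le> n"
  shows "(fact n / fact (n - Suc s) :: real) = real (n - s) * (fact n / fact (n - s))"
proof -
  obtain m where "n - s = Suc m" "n - Suc s = m" using assms by (metis Suc_diff_Suc Suc_le_lessD)
  then show ?thesis by simp
qed

lemma fact_ratio_le: "s \<le> n \<Longrightarrow> (fact n / fact (n - s) :: real) \<le> real n ^ s"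
proof (induction s)
  case (Suc s)
  have "real (n - s) * (fact n / fact (n - s)) \<le> real n * real n ^ s"
    by (rule mult_mono) (use Suc in simp_all)
  then show ?case using fact_ratio_Suc[OF Suc.prems] by simp
qed simp

lemma fact_ratio_ge: "s \<le> n \<Longrightarrow> real (n - s) ^ s \<le> (fact n / fact (n - s) :: real)"
proof (induction s)
  case (Suc s)
  have "real (n - Suc s) * real (n - Suc s) ^ s \<le> real (n - s) * real (n - s) ^ s"
    by (intro mult_mono power_mono) simp_all
  also have "\<dots> \<le> real (n - s) * (fact n / fact (n - s))"
    by (rule mult_left_mono) (use Suc in simp_all)
  finally show ?case using fact_ratio_Suc[OF Suc.prems] by simp
qed simp

text \<open>The quotient \<open>m^m / m!\<close> is a single term of the series of
  \<open>exp m\<close>.\<close>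

lemma fact_ge_exp: "(real m / exp 1) ^ m \<le> fact m"
proof -
  have "real m ^ m / fact m \<le> exp (real m)"
  proof -
    have "(\<Sum>i\<in>{m}. real m ^ i /\<^sub>R fact i) \<le> exp (real m)"
      unfolding exp_def by (rule sum_le_suminf[OF summable_exp_generic]) auto
    then show ?thesis by (simp add: field_simps)
  qed
  moreover have "exp (real m) = exp 1 ^ m" by (simp flip: exp_of_nat_mult)
  ultimately show ?thesis by (simp add: field_simps power_divide)
qed

text \<open>The factorials of \<open>r * n\<close> and \<open>r * n - r * s\<close> cancel. This is
  the product that appears in the first moment bound, where cliques are counted by their vertex set
  and then by their structure on it.\<close>

lemma binomial_times_incl_prob_le:
  assumes "s \<le> n"
  shows "real (r * n choose (r * s)) * incl_prob r n s \<le> (fact r * real n) ^ s / fact (r * s)"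
proof -
  have "r * s \<le> r * n" using assms by simp
  then have "real (r * n choose (r * s)) * incl_prob r n s =
      fact r ^ s * (fact n / fact (n - s)) / fact (r * s)"
    by (simp add: binomial_fact incl_prob_eq[OF assms] field_simps)
  also have "\<dots> \<le> fact r ^ s * real n ^ s / fact (r * s)"
    using fact_ratio_le[OF assms] by (intro divide_right_mono mult_left_mono) auto
  finally show ?thesis by (simp add: power_mult_distrib)
qed

text \<open>Every edge costs a factor of order \<open>n^(1-r)\<close>, uniformly in
  \<open>s\<close>. The preceding bound is divided by the binomial coefficient, using
  \<open>(N / S)^S\<close> as a lower bound for \<open>N choose S\<close> and
  \<open>(S / e)^S\<close> for \<open>S!\<close>.\<close>

lemma incl_prob_le:
  assumes "s \<le> n" "r \<ge> 1" "n \<ge> 1"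
  shows "incl_prob r n s \<le> (fact r * exp 1 ^ r * real n / real n ^ r) ^ s"
proof (cases "s = 0")
  case True
  then show ?thesis using num_matchings_pos[of r n] by (simp add: incl_prob_def)
next
  case False
  let ?N = "r * n" and ?S = "r * s"
  have le: "?S \<le> ?N" using assms by simp
  have "(real n / exp 1) ^ ?S \<le> (real ?N / exp 1) ^ ?S"
  proof (intro power_mono divide_right_mono)
    have "1 * n \<le> r * n" using assms(2) by (intro mult_le_mono1)
    then show "real n \<le> real ?N" by (simp flip: of_nat_mult)
  qed auto
  also have "\<dots> = (real ?N / real ?S) ^ ?S * (real ?S / exp 1) ^ ?S"
    using False assms(2) by (simp add: mult.commute flip: power_mult_distrib)
  also have "\<dots> \<le> real (?N choose ?S) * fact ?S"
    using binomial_ge_n_over_k_pow_k[OF le, where 'a = real] fact_ge_exp[of ?S]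
    by (intro mult_mono) auto
  finally have low: "(real n / exp 1) ^ ?S \<le> real (?N choose ?S) * fact ?S" .
  have pos: "(real n / exp 1) ^ ?S > 0" using assms(3) by simp
  have "incl_prob r n s * (real n / exp 1) ^ ?S
      \<le> incl_prob r n s * (real (?N choose ?S) * fact ?S)"
    using low num_matchings_pos by (intro mult_left_mono) (auto simp: incl_prob_def less_imp_le)
  also have "\<dots> \<le> (fact r * real n) ^ s"
    using binomial_times_incl_prob_le[OF assms(1), of r] by (simp add: field_simps)
  finally have "incl_prob r n s \<le> (fact r * real n) ^ s / (real n / exp 1) ^ ?S"
    using pos by (simp add: pos_le_divide_eq)
  also have "\<dots> = (fact r * exp 1 ^ r * real n / real n ^ r) ^ s"
    by (simp add: power_mult power_mult_distrib power_divide field_simps)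
  finally show ?thesis .
qed

section \<open>Second moment of the number of edges in a family\<close>

lemma incl_prob_1_ge:
  assumes "n \<ge> 1"
  shows "incl_prob r n 1 \<ge> fact r * real n / real (r * n) ^ r"
proof -
  have f: "fact n = real n * fact (n - 1)" using assms fact_reduce[of n, where 'a = real] by simp
  have "(fact (r * n) :: real) \<le> real (r * n) ^ r * fact (r * n - r)"
    using fact_ratio_le[of r "r * n"] assms by (simp add: divide_le_eq)
  then have "1 / real (r * n) ^ r \<le> fact (r * n - r) / fact (r * n)"
    using assms by (cases "r = 0") (auto simp: field_simps)
  then have "fact r * real n * (1 / real (r * n) ^ r) \<le> fact r * real n * (fact (r * n - r) / fact (r * n))"
    by (intro mult_left_mono) auto
  then show ?thesis using assms f by (simp add: incl_prob_eq)
qed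

lemma incl_prob_1_le:
  assumes "n \<ge> 2" "r \<ge> 1"
  shows "incl_prob r n 1 \<le> fact r * real n / real (r * n - r) ^ r"
proof -
  have f: "fact n = real n * fact (n - 1)" using assms fact_reduce[of n, where 'a = real] by simp
  have lt: "r * n - r > 0" using assms by (cases n) auto
  have "(fact (r * n) :: real) \<ge> real (r * n - r) ^ r * fact (r * n - r)"
    using fact_ratio_ge[of r "r * n"] assms by (simp add: le_divide_eq)
  then have "1 / real (r * n - r) ^ r \<ge> fact (r * n - r) / fact (r * n)"
    using lt by (simp add: field_simps)
  then have "fact r * real n * (1 / real (r * n - r) ^ r) \<ge> fact r * real n * (fact (r * n - r) / fact (r * n))"
    by (intro mult_left_mono) auto
  then show ?thesis using assms f by (simp add: incl_prob_eq)
qed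

text \<open>Joint inclusion probability of two disjoint edges relative to the product of their
  probabilities; the second moment method needs it to be at most \<open>1 + o(1)\<close>.\<close>

definition correlation :: "nat \<Rightarrow> nat \<Rightarrow> real" where
  "correlation r n = incl_prob r n 2 / (incl_prob r n 1)\<^sup>2"

lemma incl_prob_pos: "incl_prob r n s > 0"
  by (simp add: incl_prob_def num_matchings_pos)

text \<open>Given one edge, the rest is a uniform matching with \<open>n - 1\<close> edges, so the
  ratio compares the inclusion probabilities of one edge for sizes \<open>n - 1\<close> and
  \<open>n\<close>.\<close>

lemma correlation_le:
  assumes "n \<ge> 3" "r \<ge> 1"
  shows "correlation r n \<le> (real n / real (n - 2)) ^ r"
proof -
  have "n - 1 - 1 = n - 2" by simp
  then have "incl_prob r n 2 = incl_prob r n 1 * incl_prob r (n - 1) 1"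
    using num_matchings_pos[of r "n - 1"] by (simp add: incl_prob_def)
  then have "correlation r n = incl_prob r (n - 1) 1 / incl_prob r n 1"
    using incl_prob_pos[of r n 1] by (simp add: correlation_def power2_eq_square)
  also have "\<dots> \<le> (fact r * real n / real (r * (n - 1) - r) ^ r) / (fact r * real n / real (r * n) ^ r)"
  proof (rule frac_le)
    show "incl_prob r (n - 1) 1 \<le> fact r * real n / real (r * (n - 1) - r) ^ r"
    proof (rule order_trans[OF incl_prob_1_le])
      show "fact r * real (n - 1) / real (r * (n - 1) - r) ^ r \<le> fact r * real n / real (r * (n - 1) - r) ^ r"
        by (intro divide_right_mono mult_left_mono) auto
    qed (use assms in auto)
  qed (use assms incl_prob_1_ge[of n r] in auto)
  also have "\<dots> = (real (r * n) / real (r * (n - 2))) ^ r"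
  proof -
    have "r * (n - 1) - r = r * (n - 2)"
      using \<open>n - 1 - 1 = n - 2\<close> by (metis right_diff_distrib' mult.right_neutral)
    then show ?thesis using assms by (simp add: power_divide del: of_nat_mult)
  qed
  also have "\<dots> = (real n / real (n - 2)) ^ r" using assms by simp
  finally show ?thesis .
qed

text \<open>Chebyshev's inequality for a deviation of half the mean, carried out by counting. The
  variance is at most \<open>\<mu> + \<mu>\<^sup>2 * (correlation r n - 1)\<close> whatever the
  family looks like, because two distinct intersecting edges never occur together.\<close>

lemma prob_few_edges_le:
  assumes "r \<ge> 1" "finite \<E>" "\<And>e. e \<in> \<E> \<Longrightarrow> e \<subseteq> {1..r * n} \<and> card e = r"
    and "\<mu> = card \<E> * incl_prob r n 1" "\<mu> > 0"
  shows "RM_prob r n {M. card (M \<inter> \<E>) < \<mu> / 2} \<le> 4 / \<mu> + 4 * (correlation r n - 1)"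
proof -
  define \<Omega> where "\<Omega> = perfect r {1..r * n}"
  define N where "N = num_matchings r n"
  define q where "q = incl_prob r n"
  define X where "X M = real (card (M \<inter> \<E>))" for M
  have fin: "finite \<Omega>" by (simp add: \<Omega>_def finite_perfect)
  have N: "N > 0" "real (card \<Omega>) = N"
    using card_perfect[of "{1..r * n}" r n] assms(1) by (auto simp: N_def \<Omega>_def num_matchings_pos)
  have q: "num_matchings r (n - s) = q s * N" for s
    using N by (simp add: q_def incl_prob_def N_def)
  have X1: "X M = (\<Sum>e\<in>\<E>. of_bool (e \<in> M))" for M
    using assms(2) by (simp add: X_def Int_commute)
  have c: "(\<Sum>M\<in>\<Omega>. of_bool (Q M)) = real (card {M \<in> \<Omega>. Q M})" for Q
    using fin by (simp add: Collect_conj_eq)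
  have "(\<Sum>M\<in>\<Omega>. X M) = (\<Sum>e\<in>\<E>. \<Sum>M\<in>\<Omega>. of_bool (e \<in> M))"
    unfolding X1 by (rule sum.swap)
  also have "\<dots> = (\<Sum>e\<in>\<E>. q 1 * N)"
  proof (rule sum.cong)
    fix e assume e: "e \<in> \<E>"
    then have "ordered_matching r {e}" "\<Union>{e} \<subseteq> {1..r * n}"
      using assms(3)[OF e] finite_subset by (auto simp: ordered_matching_singleton)
    from card_containing[OF assms(1) this, of 1]
    show "(\<Sum>M\<in>\<Omega>. of_bool (e \<in> M)) = q 1 * N" unfolding c by (simp add: \<Omega>_def q[symmetric])
  qed simp
  finally have S1: "(\<Sum>M\<in>\<Omega>. X M) = \<mu> * N" using assms(4) by (simp add: q_def)
  have "(\<Sum>M\<in>\<Omega>. (X M)\<^sup>2) = (\<Sum>M\<in>\<Omega>. \<Sum>e\<in>\<E>. \<Sum>f\<in>\<E>. of_bool (e \<in> M \<and> f \<in> M))"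
    unfolding X1 power2_eq_square sum_product by (simp add: of_bool_conj)
  also have "\<dots> = (\<Sum>e\<in>\<E>. \<Sum>M\<in>\<Omega>. \<Sum>f\<in>\<E>. of_bool (e \<in> M \<and> f \<in> M))"
    by (rule sum.swap)
  also have "\<dots> = (\<Sum>e\<in>\<E>. \<Sum>f\<in>\<E>. \<Sum>M\<in>\<Omega>. of_bool (e \<in> M \<and> f \<in> M))"
    by (intro sum.cong refl sum.swap)
  \<comment> \<open>The diagonal gives the first moment, and each other pair at most the value for
    disjoint edges. Allowing the second summand on the diagonal as well only weakens the bound and
    makes the sum a product.\<close>
  also have "\<dots> \<le> (\<Sum>e\<in>\<E>. \<Sum>f\<in>\<E>. (if f = e then q 1 * N else 0) + q 2 * N)"
  proof (intro sum_mono)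
    fix e f assume "e \<in> \<E>" "f \<in> \<E>"
    have nonneg: "q s * N \<ge> 0" for s
      using q[of s] num_matchings_pos[of r "n - s"] by simp
    show "(\<Sum>M\<in>\<Omega>. of_bool (e \<in> M \<and> f \<in> M)) \<le> (if f = e then q 1 * N else 0) + q 2 * N"
    proof (cases "f = e")
      case True
      then show ?thesis
        using card_containing_le[OF assms(1), of "{e}" 1 n] nonneg[of 2] q[of 1]
        unfolding c by (simp add: \<Omega>_def)
    next
      case False
      then show ?thesis
        using card_containing_le[OF assms(1), of "{e, f}" 2 n] q[of 2]
        unfolding c by (simp add: \<Omega>_def)
    qed
  qed
  also have "\<dots> = (\<mu> + (card \<E>)\<^sup>2 * q 2) * N"
    using assms(2,4) by (simp add: sum.distrib q_def algebra_simps power2_eq_square)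
  also have "(card \<E>)\<^sup>2 * q 2 = \<mu>\<^sup>2 * correlation r n"
    using incl_prob_pos[of r n 1] assms(4) by (simp add: correlation_def q_def power_mult_distrib)
  finally have S2: "(\<Sum>M\<in>\<Omega>. (X M)\<^sup>2) \<le> (\<mu> + \<mu>\<^sup>2 * correlation r n) * N" .
  define B where "B = {M \<in> \<Omega>. X M < \<mu> / 2}"
  have "real (card B) * (\<mu>\<^sup>2 / 4) = (\<Sum>M\<in>B. \<mu>\<^sup>2 / 4)" by simp
  also have "\<dots> \<le> (\<Sum>M\<in>B. (\<mu> - X M)\<^sup>2)"
  proof (rule sum_mono)
    fix M assume "M \<in> B"
    then have "\<mu> / 2 \<le> \<mu> - X M" by (simp add: B_def)
    then have "(\<mu> / 2)\<^sup>2 \<le> (\<mu> - X M)\<^sup>2" using assms(5) by (intro power_mono) auto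
    then show "\<mu>\<^sup>2 / 4 \<le> (\<mu> - X M)\<^sup>2" by (simp add: power_divide)
  qed
  also have "\<dots> \<le> (\<Sum>M\<in>\<Omega>. (\<mu> - X M)\<^sup>2)"
    using fin by (intro sum_mono2) (auto simp: B_def)
  also have "\<dots> = \<mu>\<^sup>2 * N - 2 * \<mu> * (\<Sum>M\<in>\<Omega>. X M) + (\<Sum>M\<in>\<Omega>. (X M)\<^sup>2)"
    using N(2) by (simp add: power2_diff sum.distrib sum_subtractf sum_distrib_left)
  also have "\<dots> \<le> (\<mu> + \<mu>\<^sup>2 * (correlation r n - 1)) * N"
    using S1 S2 by (simp add: algebra_simps power2_eq_square)
  finally have "real (card B) / N \<le> (\<mu> + \<mu>\<^sup>2 * (correlation r n - 1)) / (\<mu>\<^sup>2 / 4)"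
    using N(1) assms(5) by (simp add: field_simps)
  also have "\<dots> = 4 / \<mu> + 4 * (correlation r n - 1)"
    using assms(5) by (simp add: field_simps power2_eq_square)
  finally show ?thesis
    unfolding prob_RM[OF assms(1)] by (simp add: B_def X_def \<Omega>_def N_def)
qed

lemma correlation_limsup:
  assumes "r \<ge> 1"
  shows "(\<lambda>n. (real n / real (n - 2)) ^ r - 1) \<longlonglongrightarrow> 0"
proof -
  have "(\<lambda>n. real n / real (n - 2)) \<longlonglongrightarrow> 1"
  proof (rule LIMSEQ_offset[of _ 3])
    show "(\<lambda>n. real (n + 3) / real (n + 3 - 2)) \<longlonglongrightarrow> 1"
    proof (rule Lim_transform_eventually)
      show "(\<lambda>n. 1 + 2 / real (Suc n)) \<longlonglongrightarrow> 1"
        using tendsto_add[OF tendsto_const[of "1::real"] lim_const_over_n[of "2::real", THEN LIMSEQ_Suc]]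
        by simp
      show "\<forall>\<^sub>F n in sequentially. 1 + 2 / real (Suc n) = real (n + 3) / real (n + 3 - 2)"
        by (intro always_eventually allI) (simp add: field_simps)
    qed
  qed
  from tendsto_power[OF this, of r] show ?thesis by (simp add: LIM_zero_iff)
qed

section \<open>First moment bound\<close>

lemma prob_not: "measure_pmf.prob p {M. \<Phi> M} = 1 - measure_pmf.prob p {M. \<not> \<Phi> M}"
proof -
  have "{M. \<Phi> M} = UNIV - {M. \<not> \<Phi> M}" by blast
  then show ?thesis using measure_pmf.prob_compl[of "{M. \<not> \<Phi> M}" p] by simp
qed

lemma aasI:
  assumes "\<forall>\<^sub>F n in sequentially. RM_prob r n {M. \<not> \<Phi> n M} \<le> g n"
    and "g \<longlonglongrightarrow> 0"
  shows "aas r \<Phi>"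
proof -
  have "(\<lambda>n. RM_prob r n {M. \<not> \<Phi> n M}) \<longlonglongrightarrow> 0"
    by (rule tendsto_sandwich[OF _ assms(1) tendsto_const assms(2)]) (simp add: always_eventually)
  from tendsto_diff[OF tendsto_const[of 1] this] show ?thesis
    unfolding aas_def by (simp add: prob_not[of _ "\<Phi> _"])
qed

lemma aas_failure: "aas r \<Phi> \<Longrightarrow> (\<lambda>n. RM_prob r n {M. \<not> \<Phi> n M}) \<longlonglongrightarrow> 0"
  unfolding aas_def using tendsto_diff[OF tendsto_const[of "1::real"], of _ 1]
  by (fastforce simp: prob_not[of _ "\<Phi> _"])

lemma set_RM: "r \<ge> 1 \<Longrightarrow> set_pmf (RM r n) = matchings r n"
  unfolding RM_def by (intro set_pmf_of_set matchings_nonempty finite_matchings)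

lemma prob_RM_mono:
  assumes "r \<ge> 1" "\<And>M. M \<in> matchings r n \<Longrightarrow> \<Phi> M \<Longrightarrow> \<Psi> M"
  shows "RM_prob r n {M. \<Phi> M} \<le> RM_prob r n {M. \<Psi> M}"
  using assms by (intro measure_pmf.finite_measure_mono_AE) (auto simp: AE_measure_pmf_iff set_RM)

lemma aas_mono:
  assumes "r \<ge> 1" "aas r \<Phi>"
    and "\<forall>\<^sub>F n in sequentially. \<forall>M\<in>matchings r n. \<Phi> n M \<longrightarrow> \<Psi> n M"
  shows "aas r \<Psi>"
proof (rule aasI[OF _ aas_failure[OF assms(2)]])
  show "\<forall>\<^sub>F n in sequentially. RM_prob r n {M. \<not> \<Psi> n M}
      \<le> RM_prob r n {M. \<not> \<Phi> n M}"
    using assms(3) by eventually_elim (rule prob_RM_mono[OF assms(1)], blast)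
qed

lemma prob_union_le:
  "measure_pmf.prob p {M. \<Phi> M \<or> \<Psi> M} \<le> measure_pmf.prob p {M. \<Phi> M} + measure_pmf.prob p {M. \<Psi> M}"
  using measure_Un_le[of "{M. \<Phi> M}" "measure_pmf p" "{M. \<Psi> M}"] by (simp add: Collect_disj_eq)

lemma aas_conj:
  assumes "aas r \<Phi>" "aas r \<Psi>"
  shows "aas r (\<lambda>n M. \<Phi> n M \<and> \<Psi> n M)"
proof (rule aasI)
  show "(\<lambda>n. RM_prob r n {M. \<not> \<Phi> n M} + RM_prob r n {M. \<not> \<Psi> n M}) \<longlonglongrightarrow> 0"
    using tendsto_add[OF aas_failure[OF assms(1)] aas_failure[OF assms(2)]] by simp
  show "\<forall>\<^sub>F n in sequentially. RM_prob r n {M. \<not> (\<Phi> n M \<and> \<Psi> n M)}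
      \<le> RM_prob r n {M. \<not> \<Phi> n M} + RM_prob r n {M. \<not> \<Psi> n M}"
    unfolding de_Morgan_conj by (intro always_eventually allI prob_union_le)
qed

lemma aas_ball:
  assumes "finite A" "\<And>a. a \<in> A \<Longrightarrow> aas r (\<Phi> a)"
  shows "aas r (\<lambda>n M. \<forall>a\<in>A. \<Phi> a n M)"
  using assms
proof (induction A rule: finite_induct)
  case empty
  then show ?case by (simp add: aas_def)
next
  case (insert a A)
  then have "aas r (\<lambda>n M. \<Phi> a n M \<and> (\<forall>a\<in>A. \<Phi> a n M))" by (intro aas_conj) auto
  then show ?case by simp
qed

section \<open>Largest cliques in a matching\<close>

lemma clique_subset: "clique r \<P> N \<Longrightarrow> N' \<subseteq> N \<Longrightarrow> clique r \<P> N'"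
  unfolding clique_def using ordered_matching_subset[of r N N'] by blast

lemma clique_sizes:
  assumes "finite M"
  shows "finite {card N | N. N \<subseteq> M \<and> clique r \<P> N}" "{card N | N. N \<subseteq> M \<and> clique r \<P> N} \<noteq> {}"
proof -
  have "{card N | N. N \<subseteq> M \<and> clique r \<P> N} \<subseteq> card ` Pow M" by auto
  then show "finite {card N | N. N \<subseteq> M \<and> clique r \<P> N}"
    using assms finite_subset by (meson finite_Pow_iff finite_imageI)
  have "clique r \<P> ({} :: 'a set set)" by (simp add: clique_def ordered_matching_def)
  then show "{card N | N. N \<subseteq> M \<and> clique r \<P> N} \<noteq> {}" by blast
qed

lemma card_le_max_clique_size:
  assumes "finite M" "N \<subseteq> M" "clique r \<P> N"
  shows "card N \<le> max_clique_size r \<P> M"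
  unfolding max_clique_size_def using clique_sizes[OF assms(1), of r \<P>] assms by (intro Max_ge) auto

lemma max_clique_size_witness:
  assumes "finite M"
  obtains N where "N \<subseteq> M" "clique r \<P> N" "card N = max_clique_size r \<P> M"
proof -
  have "max_clique_size r \<P> M \<in> {card N | N. N \<subseteq> M \<and> clique r \<P> N}"
    unfolding max_clique_size_def by (intro Max_in clique_sizes[OF assms])
  then show thesis using that by force
qed

lemma max_clique_size_mono:
  assumes "finite M" "\<P> \<subseteq> \<Q>"
  shows "max_clique_size r \<P> M \<le> max_clique_size r \<Q> M"
proof -
  obtain N where N: "N \<subseteq> M" "clique r \<P> N" "card N = max_clique_size r \<P> M"
    using max_clique_size_witness[OF assms(1)] .
  have "clique r \<Q> N" using N(2) assms(2) unfolding clique_def by blast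
  then show ?thesis using card_le_max_clique_size[OF assms(1) N(1)] N(3) by simp
qed

lemma finite_matching_member: "M \<in> matchings r n \<Longrightarrow> finite M"
  by (simp add: matchings_def ordered_matching_def)

definition cliques_in :: "nat \<Rightarrow> pattern set \<Rightarrow> nat set \<Rightarrow> nat \<Rightarrow> nat set set set" where
  "cliques_in r \<P> V k = {S. clique r \<P> S \<and> card S = k \<and> \<Union>S \<subseteq> V}"

lemma finite_cliques_in: "finite V \<Longrightarrow> finite (cliques_in r \<P> V k)"
  by (rule finite_subset[of _ "Pow (Pow V)"]) (auto simp: cliques_in_def)

lemma powr_root_power: "w \<ge> 1 \<Longrightarrow> (real n powr (1 / real w)) ^ w = real n"
proof (cases "n = 0")
  case False
  assume "w \<ge> 1"
  have "(real n powr (1 / real w)) ^ w = (real n powr (1 / real w)) powr real w"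
    using False by (subst powr_realpow) auto
  also have "\<dots> = real n powr (1 / real w * real w)" by (rule powr_powr)
  finally show ?thesis using False \<open>w \<ge> 1\<close> by simp
qed simp

lemma powr_root_tendsto:
  assumes "w \<ge> 1"
  shows "filterlim (\<lambda>n. real n powr (1 / real w)) at_top sequentially"
  unfolding filterlim_at_top
proof
  fix Z :: real
  have "Z \<le> real n powr (1 / real w)" if n: "n \<ge> nat \<lceil>max Z 0 ^ w\<rceil>" for n
  proof (rule ccontr)
    assume "\<not> ?thesis"
    then have "(real n powr (1 / real w)) ^ w < max Z 0 ^ w"
      using assms by (intro power_strict_mono) auto
    then show False using n powr_root_power[OF assms, of n] by linarith
  qed
  then show "\<forall>\<^sub>F n in sequentially. Z \<le> real n powr (1 / real w)"
    by (rule eventually_mono[OF eventually_ge_at_top])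
qed

lemma half_power_le: "k \<ge> 1 \<Longrightarrow> (1 / 2 :: real) ^ k \<le> 1 / real k"
proof -
  assume "k \<ge> 1"
  have "real k \<le> 2 ^ k" using of_nat_less_two_power[of k, where 'a = real] by simp
  then show ?thesis using \<open>k \<ge> 1\<close> by (simp add: power_divide frac_le)
qed

abbreviation upper_rate :: "nat \<Rightarrow> pattern set \<Rightarrow> nat \<Rightarrow> bool" where
  "upper_rate r \<P> w \<equiv>
     \<exists>C>0. aas r (\<lambda>n M. real (max_clique_size r \<P> M) \<le> C * real n powr (1 / real w))"

abbreviation lower_rate :: "nat \<Rightarrow> pattern set \<Rightarrow> nat \<Rightarrow> bool" where
  "lower_rate r \<P> w \<equiv>
     \<exists>c>0. aas r (\<lambda>n M. c * real n powr (1 / real w) \<le> real (max_clique_size r \<P> M))"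

text \<open>The factorial of \<open>r * k\<close> supplies \<open>k^r\<close> per edge, of which the
  count of cliques consumes \<open>k^(r-w)\<close>. What remains is
  \<open>(B r! e^r n / k^w)^k\<close>, which is small once \<open>k\<close> is a large multiple of
  \<open>n^(1/w)\<close>.\<close>

lemma clique_number_upper:
  fixes B :: real
  assumes "r \<ge> 1" "w \<ge> 1" "w \<le> r" "B > 0"
    and count: "\<And>n k. k \<ge> 1 \<Longrightarrow> real (card (cliques_in r \<P> {1..r * n} k))
      \<le> real (r * n choose (r * k)) * (B ^ k * real k ^ (k * (r - w)))"
  shows "upper_rate r \<P> w"
proof -
  \<comment> \<open>The second entry makes the base of the final power at most \<open>1 / 2\<close>;
    the first guarantees that \<open>k n\<close> is at least \<open>x n\<close>, hence
    positive.\<close>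
  define C where "C = max 1 (2 * B * fact r * exp 1 ^ r)"
  define x where "x n = real n powr (1 / real w)" for n
  define k where "k n = nat \<lceil>C * x n\<rceil>" for n
  have C: "C \<ge> 1" "2 * B * fact r * exp 1 ^ r \<le> C ^ w"
  proof -
    show "C \<ge> 1" by (simp add: C_def)
    then have "C ^ 1 \<le> C ^ w" using assms(2) by (intro power_increasing)
    then show "2 * B * fact r * exp 1 ^ r \<le> C ^ w" by (simp add: C_def)
  qed
  have bound: "RM_prob r n {M. \<not> real (max_clique_size r \<P> M) \<le> C * x n} \<le> 1 / x n"
    if n: "n \<ge> 1" for n
  proof -
    have x: "x n \<ge> 1" "x n ^ w = real n"
      using n powr_root_power[OF assms(2), of n] by (auto simp: x_def ge_one_powr_ge_zero)
    have "1 * x n \<le> C * x n" using C(1) x(1) by (intro mult_right_mono) auto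
    then have Cx: "x n \<le> C * x n" by simp
    have kC: "C * x n \<le> real (k n)" unfolding k_def by (rule of_nat_ceiling)
    with x Cx have "real (k n) \<ge> 1" by linarith
    then have k1: "k n \<ge> 1" by simp
    let ?S = "cliques_in r \<P> {1..r * n} (k n)"
    \<comment> \<open>A clique of size \<open>k n\<close> can only exist if
      \<open>k n \<le> n\<close>. The condition is recorded in the event because the estimate of the
      inclusion probability depends on it.\<close>
    have "RM_prob r n {M. \<not> real (max_clique_size r \<P> M) \<le> C * x n}
        \<le> RM_prob r n {M. k n \<le> n \<and> (\<exists>S\<in>?S. S \<subseteq> M)}"
    proof (rule prob_RM_mono[OF assms(1)])
      fix M assume M: "M \<in> matchings r n" "\<not> real (max_clique_size r \<P> M) \<le> C * x n"
      obtain N where N: "N \<subseteq> M" "clique r \<P> N" "card N = max_clique_size r \<P> M"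
        using max_clique_size_witness[OF finite_matching_member[OF M(1)]] .
      have "\<lceil>C * x n\<rceil> \<le> int (max_clique_size r \<P> M)" using M(2) by (simp add: ceiling_le_iff)
      then have le: "k n \<le> card N" unfolding N(3) k_def nat_le_iff .
      then obtain S where S: "S \<subseteq> N" "card S = k n" by (meson obtain_subset_with_card_n)
      have "card N \<le> card M" using N(1) finite_matching_member[OF M(1)] by (rule card_mono[rotated])
      moreover have M': "card M = n" "\<Union>M = {1..r * n}" using M(1) by (auto simp: matchings_def)
      ultimately have "k n \<le> n" using le by simp
      moreover have "S \<subseteq> M" using S(1) N(1) by simp
      moreover from this have "S \<in> ?S"
        using S(2) clique_subset[OF N(2) S(1)] Union_mono[of S M] M'(2)
        unfolding cliques_in_def by simp
      ultimately show "k n \<le> n \<and> (\<exists>S\<in>?S. S \<subseteq> M)" by blast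
    qed
    also have "\<dots> \<le> 1 / x n"
    proof (cases "k n \<le> n")
      case False
      then show ?thesis using x(1) by simp
    next
      case True
      let ?k = "k n"
      have kpos: "real ?k > 0" using k1 by simp
      have "RM_prob r n {M. k n \<le> n \<and> (\<exists>S\<in>?S. S \<subseteq> M)}
          \<le> card ?S * incl_prob r n ?k"
        using prob_contains_some_le[OF assms(1) finite_cliques_in[of "{1..r * n}"], of r \<P> ?k ?k n] True
        by (simp add: cliques_in_def)
      also have "\<dots> \<le> real (r * n choose (r * ?k)) * (B ^ ?k * real ?k ^ (?k * (r - w))) * incl_prob r n ?k"
        using count[OF k1, of n] incl_prob_pos[of r n ?k] by (intro mult_right_mono) auto
      also have "\<dots> = (B ^ ?k * real ?k ^ (?k * (r - w))) *
          (real (r * n choose (r * ?k)) * incl_prob r n ?k)" by simp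
      also have "\<dots> \<le> (B ^ ?k * real ?k ^ (?k * (r - w))) * ((fact r * real n) ^ ?k / fact (r * ?k))"
        using binomial_times_incl_prob_le[OF True, of r] assms(4) by (intro mult_left_mono) auto
      also have "\<dots> \<le> (B ^ ?k * real ?k ^ (?k * (r - w))) * ((fact r * real n) ^ ?k / (real ?k / exp 1) ^ (r * ?k))"
      proof -
        have "1 * ?k \<le> r * ?k" using assms(1) by (intro mult_le_mono1)
        then have "real ?k \<le> real (r * ?k)" by (simp flip: of_nat_mult)
        then have "(real ?k / exp 1) ^ (r * ?k) \<le> (real (r * ?k) / exp 1) ^ (r * ?k)"
          by (intro power_mono divide_right_mono) auto
        also have "\<dots> \<le> fact (r * ?k)" by (rule fact_ge_exp)
        finally show ?thesis using assms(4) kpos by (intro mult_left_mono divide_left_mono) auto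
      qed
      also have "\<dots> = (B * fact r * exp 1 ^ r * real n / real ?k ^ w) ^ ?k"
      proof -
        have "real ?k ^ (r * ?k) = (real ?k ^ (r - w) * real ?k ^ w) ^ ?k"
          using assms(3) by (simp add: power_mult flip: power_add)
        moreover have "real ?k ^ (?k * (r - w)) = (real ?k ^ (r - w)) ^ ?k"
          by (simp add: mult.commute flip: power_mult)
        moreover have "(exp 1 :: real) ^ (r * ?k) = (exp 1 ^ r) ^ ?k" by (simp add: power_mult)
        ultimately have "(B ^ ?k * real ?k ^ (?k * (r - w))) * ((fact r * real n) ^ ?k / (real ?k / exp 1) ^ (r * ?k))
          = (B * real ?k ^ (r - w) * ((fact r * real n) * exp 1 ^ r / (real ?k ^ (r - w) * real ?k ^ w))) ^ ?k"
          by (simp only: power_divide power_mult_distrib) simp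
        also have "B * real ?k ^ (r - w) * ((fact r * real n) * exp 1 ^ r / (real ?k ^ (r - w) * real ?k ^ w))
          = B * fact r * exp 1 ^ r * real n / real ?k ^ w"
          using kpos by simp
        finally show ?thesis .
      qed
      also have "\<dots> \<le> (1 / 2) ^ ?k"
      proof (rule power_mono)
        have "2 * (B * fact r * exp 1 ^ r * real n) \<le> C ^ w * real n"
          using mult_right_mono[OF C(2), of "real n"] by simp
        also have "\<dots> = (C * x n) ^ w" by (simp add: power_mult_distrib x)
        also have "\<dots> \<le> real ?k ^ w" using kC C x by (intro power_mono) auto
        finally show "B * fact r * exp 1 ^ r * real n / real ?k ^ w \<le> 1 / 2"
          using kpos by (simp add: divide_le_eq)
      qed (use assms(4) in auto)
      also have "\<dots> \<le> 1 / real ?k" by (rule half_power_le[OF k1])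
      also have "\<dots> \<le> 1 / x n" using kC Cx x(1) by (intro divide_left_mono mult_pos_pos) linarith+
      finally show ?thesis .
    qed
    finally show ?thesis .
  qed
  have "aas r (\<lambda>n M. real (max_clique_size r \<P> M) \<le> C * x n)"
  proof (rule aasI)
    show "\<forall>\<^sub>F n in sequentially.
        RM_prob r n {M. \<not> real (max_clique_size r \<P> M) \<le> C * x n} \<le> 1 / x n"
      using eventually_ge_at_top[of 1] by eventually_elim (rule bound)
    show "(\<lambda>n. 1 / x n) \<longlonglongrightarrow> 0"
      using tendsto_inverse_0_at_top[OF powr_root_tendsto[OF assms(2)]]
      by (simp add: x_def inverse_eq_divide)
  qed
  then show ?thesis unfolding x_def using C(1) by (intro exI[of _ C]) auto
qed

section \<open>Blow-ups of template edges\<close>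

text \<open>The cell \<open>t\<close> consists of the vertices
  \<open>t * l + 1, ..., t * l + l\<close>: vertices are counted from 1, cells from 0.\<close>

definition proj :: "nat \<Rightarrow> nat set \<Rightarrow> nat set" where
  "proj l e = (\<lambda>v. (v - 1) div l) ` e"

text \<open>Equal cardinality and projection onto \<open>T\<close> together say that
  \<open>e\<close> has exactly one vertex in each cell of \<open>T\<close>. Truncated subtraction
  would place the non-vertex 0 in cell 0, so it is excluded.\<close>

definition blowups :: "nat \<Rightarrow> nat set \<Rightarrow> nat set set" where
  "blowups l T = {e. finite e \<and> 0 \<notin> e \<and> card e = card T \<and> proj l e = T}"

lemma cell_iff:
  fixes l :: nat
  assumes "l \<ge> 1"
  shows "v \<noteq> 0 \<and> (v - 1) div l = t \<longleftrightarrow> v \<in> {t * l + 1..t * l + l}"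
proof -
  have *: "(v - 1) div l = t \<longleftrightarrow> t * l \<le> v - 1 \<and> v - 1 < Suc t * l"
    using assms by (metis Groups.mult_ac(2) div_less_iff_less_mult div_nat_eqI
        div_times_less_eq_dividend lessI less_le_trans zero_less_one)
  show ?thesis unfolding * by (cases v) auto
qed

text \<open>Blow-ups are the images of the choice functions that pick one of the \<open>l\<close>
  vertices in each cell.\<close>

lemma card_blowups:
  assumes "l \<ge> 1" "finite T"
  shows "card (blowups l T) = l ^ card T"
proof -
  let ?I = "\<lambda>t. {t * l + 1..t * l + l}" and ?h = "\<lambda>v. (v - 1) div l"
  have I: "f t \<noteq> 0 \<and> ?h (f t) = t" if "f \<in> Pi\<^sub>E T ?I" "t \<in> T" for f t
    using cell_iff[OF assms(1), of "f t" t] PiE_mem[OF that] by simp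
  have "bij_betw (\<lambda>f. f ` T) (Pi\<^sub>E T ?I) (blowups l T)"
  proof (rule bij_betw_imageI)
    show "inj_on (\<lambda>f. f ` T) (Pi\<^sub>E T ?I)"
    proof (rule inj_onI)
      fix f g assume fg: "f \<in> Pi\<^sub>E T ?I" "g \<in> Pi\<^sub>E T ?I" "f ` T = g ` T"
      show "f = g"
      proof (rule PiE_ext[OF fg(1,2)])
        fix t assume t: "t \<in> T"
        then have "f t \<in> g ` T" using fg(3) by blast
        then obtain s where s: "s \<in> T" "f t = g s" by blast
        then have "s = t" using I[OF fg(1) t] I[OF fg(2) s(1)] by simp
        then show "f t = g t" using s by simp
      qed
    qed
    show "(\<lambda>f. f ` T) ` Pi\<^sub>E T ?I = blowups l T"
    proof (intro equalityI subsetI)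
      fix e assume "e \<in> (\<lambda>f. f ` T) ` Pi\<^sub>E T ?I"
      then obtain f where f: "f \<in> Pi\<^sub>E T ?I" "e = f ` T" by blast
      have "inj_on f T"
      proof (rule inj_on_inverseI)
        show "?h (f t) = t" if "t \<in> T" for t using I[OF f(1) that] by simp
      qed
      then have "card e = card T" using f(2) by (simp add: card_image)
      moreover have "proj l e = T"
      proof -
        have "(\<lambda>t. ?h (f t)) ` T = (\<lambda>t. t) ` T" by (rule image_cong) (use I[OF f(1)] in simp_all)
        then show ?thesis unfolding proj_def f(2) image_image by simp
      qed
      moreover have "0 \<notin> e" using I[OF f(1)] f(2) by force
      ultimately show "e \<in> blowups l T" using assms(2) f(2) by (simp add: blowups_def)
    next
      fix e assume "e \<in> blowups l T"
      then have e: "finite e" "0 \<notin> e" "card e = card T" "?h ` e = T"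
        by (auto simp: blowups_def proj_def)
      then have inj: "inj_on ?h e" by (intro eq_card_imp_inj_on) simp_all
      define f where "f = restrict (inv_into e ?h) T"
      have fe: "f t \<in> e" "?h (f t) = t" if "t \<in> T" for t
        using that e(4) inv_into_into[of t ?h e] f_inv_into_f[of t ?h e] by (simp_all add: f_def)
      have "f \<in> Pi\<^sub>E T ?I"
      proof (rule PiE_I)
        fix t assume t: "t \<in> T"
        have "f t \<noteq> 0" using fe(1)[OF t] e(2) by metis
        then show "f t \<in> ?I t" using fe(2)[OF t] cell_iff[OF assms(1), of "f t" t] by simp
      qed (simp add: f_def)
      moreover have "f ` T = e"
      proof -
        have "v \<in> f ` T" if v: "v \<in> e" for v
        proof -
          have t: "?h v \<in> T" using v e(4) by blast
          have "f (?h v) = v" using inj_onD[OF inj fe(2)[OF t] fe(1)[OF t] v] .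
          then show ?thesis using t by (metis image_eqI)
        qed
        then show ?thesis using fe(1) by blast
      qed
      ultimately show "e \<in> (\<lambda>f. f ` T) ` Pi\<^sub>E T ?I" by blast
    qed
  qed
  then have "card (blowups l T) = card (Pi\<^sub>E T ?I)" by (simp add: bij_betw_same_card)
  then show ?thesis using assms(2) by (simp add: card_PiE)
qed

lemma blowups_finite: "l \<ge> 1 \<Longrightarrow> finite T \<Longrightarrow> finite (blowups l T)"
  by (rule card_ge_0_finite) (simp add: card_blowups)

lemma blowups_subset:
  assumes "l \<ge> 1" "T \<subseteq> {..<m}" "m * l \<le> V" "e \<in> blowups l T"
  shows "e \<subseteq> {1..V}"
proof
  fix v assume v: "v \<in> e"
  have "0 \<notin> e" "proj l e = T" using assms(4) by (simp_all add: blowups_def)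
  then have t: "(v - 1) div l \<in> T" "v \<noteq> 0"
    using v unfolding proj_def by (blast, metis)
  define t where "t = (v - 1) div l"
  have "v \<in> {t * l + 1..t * l + l}" using cell_iff[OF assms(1), of v t] t by (simp add: t_def)
  moreover have "Suc t * l \<le> m * l" using assms(2) t t_def by (intro mult_le_mono1) auto
  ultimately show "v \<in> {1..V}" using assms(3) by simp
qed

lemma blowups_disjoint: "T \<noteq> T' \<Longrightarrow> blowups l T \<inter> blowups l T' = {}"
  by (auto simp: blowups_def)

lemma vx_proj:
  assumes "finite e" "card (proj l e) = card e" "p < card e"
  shows "vx (proj l e) p = (vx e p - 1) div l"
  unfolding proj_def
proof (rule vx_image[OF assms(1) _ assms(3)])
  let ?h = "\<lambda>v::nat. (v - 1) div l"
  have inj: "inj_on ?h e" using assms(1,2) unfolding proj_def by (rule eq_card_imp_inj_on)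
  show "strict_mono_on e ?h"
  proof (rule strict_mono_onI)
    fix u v assume uv: "u \<in> e" "v \<in> e" "u < v"
    then have "?h u \<le> ?h v" by (intro div_le_mono) simp
    moreover have "?h u \<noteq> ?h v" using inj_onD[OF inj _ uv(1,2)] uv(3) by blast
    ultimately show "?h u < ?h v" by simp
  qed
qed

text \<open>Passing to cells is monotone, so a comparison can only be lost between two vertices in
  the same cell, and disjoint projections exclude that. Hence blow-ups inherit the pattern of their
  templates.\<close>

lemma arranged_proj:
  assumes "finite e" "finite f" "card e = r" "card f = r" "card (proj l e) = r" "card (proj l f) = r"
    and "proj l e \<inter> proj l f = {}"
  shows "arranged r R (proj l e) (proj l f) \<longleftrightarrow> arranged r R e f"
proof -
  have fin: "finite (proj l e)" "finite (proj l f)" using assms(1,2) by (simp_all add: proj_def)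
  have "vx (proj l e) p < vx (proj l f) q \<longleftrightarrow> vx e p < vx f q" if "p < r" "q < r" for p q
  proof -
    let ?u = "vx e p" and ?v = "vx f q"
    have pr: "vx (proj l e) p = (?u - 1) div l" "vx (proj l f) q = (?v - 1) div l"
      using vx_proj assms that by simp_all
    have ne: "vx (proj l e) p \<noteq> vx (proj l f) q"
      using vx_neq[OF fin, of p q] assms that by simp
    show ?thesis
    proof
      assume "vx (proj l e) p < vx (proj l f) q"
      then have "\<not> (?v - 1) div l \<le> (?u - 1) div l" unfolding pr by simp
      then show "?u < ?v" using div_le_mono[of "?v - 1" "?u - 1" l] by linarith
    next
      assume "?u < ?v"
      then have "(?u - 1) div l \<le> (?v - 1) div l" by (intro div_le_mono) simp
      then show "vx (proj l e) p < vx (proj l f) q" using ne unfolding pr by simp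
    qed
  qed
  then show ?thesis by (simp add: arranged_def)
qed

lemma clique_of_blowups:
  assumes "finite N" "\<And>P. P \<in> \<P> \<Longrightarrow> r_pattern r P"
    and N: "\<And>e. e \<in> N \<Longrightarrow> finite e \<and> card e = r \<and> card (proj l e) = r"
    and pair: "\<And>e f. e \<in> N \<Longrightarrow> f \<in> N \<Longrightarrow> e \<noteq> f \<Longrightarrow> proj l e \<inter> proj l f = {} \<and>
      (\<exists>P\<in>\<P>. forms P (proj l e) (proj l f))"
  shows "clique r \<P> N"
proof -
  have disj: "e \<inter> f = {}" if "e \<in> N" "f \<in> N" "e \<noteq> f" for e f
    using pair[OF that] by (auto simp: proj_def)
  have "\<exists>P\<in>\<P>. forms P e f" if ef: "e \<in> N" "f \<in> N" "e \<noteq> f" for e f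
  proof -
    obtain P where P: "P \<in> \<P>" "forms P (proj l e) (proj l f)"
      using pair[OF ef] by blast
    note e = N[OF ef(1)] and f = N[OF ef(2)]
    have fin: "finite (proj l e)" "finite (proj l f)" using e f by (simp_all add: proj_def)
    have d: "proj l e \<inter> proj l f = {}" "proj l f \<inter> proj l e = {}" using pair[OF ef] by auto
    have "forms P e f"
      using P(2) e f d fin disj[OF ef]
      by (simp add: order_isomorphic_pattern_iff[OF assms(2)[OF P(1)]] arranged_proj)
    then show ?thesis using P(1) by blast
  qed
  moreover have "ordered_matching r N"
    unfolding ordered_matching_def pairwise_def disjnt_def using assms(1) N disj by simp
  ultimately show ?thesis by (simp add: clique_def)
qed

lemma binomial_le_power_fact: "real (x choose t) \<le> real x ^ t / fact t"
proof (cases "t \<le> x")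
  case True
  then have "real (x choose t) = fact x / fact (x - t) / fact t" by (simp add: binomial_fact)
  also have "\<dots> \<le> real x ^ t / fact t"
    using fact_ratio_le[OF True] by (intro divide_right_mono) auto
  finally show ?thesis .
qed (simp add: binomial_eq_0)

text \<open>Union bound over \<open>J\<close> and over the \<open>t\<close>-subsets of
  \<open>E J\<close>, of which there are at most \<open>s^t / t!\<close>, hence at most
  \<open>(e s / t)^t\<close>; each is included with probability at most the \<open>t\<close>-th
  power of the cost of one edge.\<close>

lemma prob_many_edges_le:
  fixes E :: "'a \<Rightarrow> nat set set"
  assumes "r \<ge> 1" "n \<ge> 1" "t \<le> n" "finite \<J>"
    and E: "\<And>J. J \<in> \<J> \<Longrightarrow> finite (E J) \<and> real (card (E J)) \<le> s"
  shows "RM_prob r n {M. \<exists>J\<in>\<J>. t \<le> card (M \<inter> E J)}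
    \<le> real (card \<J>) * (s * exp 1 * (fact r * exp 1 ^ r * real n / real n ^ r) / real t) ^ t"
proof (cases "\<J> = {}")
  case False
  define D where "D = fact r * exp 1 ^ r * real n / real n ^ r"
  define \<S> where "\<S> = (\<Union>J\<in>\<J>. {S. S \<subseteq> E J \<and> card S = t})"
  have fin: "finite \<S>" using assms(4) E by (auto simp: \<S>_def)
  have s: "s \<ge> 0" using False E by (metis all_not_in_conv of_nat_0_le_iff order_trans)
  have D: "D \<ge> 0" by (simp add: D_def)
  have "RM_prob r n {M. \<exists>J\<in>\<J>. t \<le> card (M \<inter> E J)}
      \<le> RM_prob r n {M. \<exists>S\<in>\<S>. S \<subseteq> M}"
  proof (rule prob_RM_mono[OF assms(1)])
    fix M assume "\<exists>J\<in>\<J>. t \<le> card (M \<inter> E J)"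
    then obtain J where J: "J \<in> \<J>" "t \<le> card (M \<inter> E J)" by blast
    then obtain S where S: "S \<subseteq> M \<inter> E J" "card S = t" by (meson obtain_subset_with_card_n)
    then have "S \<in> \<S>" using J(1) by (auto simp: \<S>_def)
    then show "\<exists>S\<in>\<S>. S \<subseteq> M" using S(1) by blast
  qed
  also have "\<dots> \<le> card \<S> * incl_prob r n t"
    by (rule prob_contains_some_le[OF assms(1) fin]) (auto simp: \<S>_def)
  also have "\<dots> \<le> (real (card \<J>) * (s ^ t / fact t)) * D ^ t"
  proof (rule mult_mono)
    have "real (card \<S>) \<le> real (\<Sum>J\<in>\<J>. card {S. S \<subseteq> E J \<and> card S = t})"
      unfolding \<S>_def by (intro of_nat_mono card_UN_le assms(4))
    also have "\<dots> = (\<Sum>J\<in>\<J>. real (card (E J) choose t))"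
      unfolding of_nat_sum by (rule sum.cong) (use E n_subsets in auto)
    also have "\<dots> \<le> (\<Sum>J\<in>\<J>. s ^ t / fact t)"
    proof (rule sum_mono)
      fix J assume J: "J \<in> \<J>"
      have "real (card (E J) choose t) \<le> real (card (E J)) ^ t / fact t"
        by (rule binomial_le_power_fact)
      also have "\<dots> \<le> s ^ t / fact t" using E[OF J] by (intro divide_right_mono power_mono) auto
      finally show "real (card (E J) choose t) \<le> s ^ t / fact t" .
    qed
    finally show "real (card \<S>) \<le> real (card \<J>) * (s ^ t / fact t)" by simp
    show "incl_prob r n t \<le> D ^ t"
      unfolding D_def by (rule incl_prob_le[OF assms(3,1,2)])
  qed (use s incl_prob_pos[of r n t] in auto)
  also have "\<dots> \<le> real (card \<J>) * (s * exp 1 * D / real t) ^ t"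
  proof (cases "t = 0")
    case False
    have "s ^ t / fact t \<le> s ^ t / (real t / exp 1) ^ t"
      using s False fact_ge_exp[of t] by (intro divide_left_mono) auto
    then have "s ^ t / fact t * D ^ t \<le> s ^ t / (real t / exp 1) ^ t * D ^ t"
      using D by (intro mult_right_mono) auto
    also have "\<dots> = (s * exp 1 * D / real t) ^ t"
      by (simp add: power_divide power_mult_distrib)
    finally show ?thesis
      unfolding mult.assoc[of "real (card \<J>)"] by (rule mult_left_mono) simp
  qed simp
  finally show ?thesis unfolding D_def .
qed simp


lemma maximal_disjoint_proj:
  assumes "finite A" "\<And>e. e \<in> A \<Longrightarrow> proj l e \<noteq> {}"
  obtains I where "I \<subseteq> A" "\<And>e f. e \<in> I \<Longrightarrow> f \<in> I \<Longrightarrow> e \<noteq> f \<Longrightarrow> proj l e \<inter> proj l f = {}"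
    "\<And>e. e \<in> A \<Longrightarrow> proj l e \<inter> (\<Union>f\<in>I. proj l f) \<noteq> {}"
proof -
  define ind where "ind I \<longleftrightarrow> I \<subseteq> A \<and> (\<forall>e\<in>I. \<forall>f\<in>I. e \<noteq> f \<longrightarrow> proj l e \<inter> proj l f = {})" for I
  have "finite {I. ind I}"
    by (rule finite_subset[of _ "Pow A"]) (use assms(1) in \<open>auto simp: ind_def\<close>)
  moreover have "{} \<in> {I. ind I}" by (simp add: ind_def)
  ultimately have "\<exists>I\<in>{I. ind I}. {} \<subseteq> I \<and> (\<forall>I'\<in>{I. ind I}. I \<subseteq> I' \<longrightarrow> I = I')"
    by (rule finite_has_maximal2)
  then obtain I where I: "ind I" "\<And>I'. ind I' \<Longrightarrow> I \<subseteq> I' \<Longrightarrow> I = I'" by auto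
  show thesis
  proof (rule that[of I])
    show "I \<subseteq> A" using I(1) by (simp add: ind_def)
    show "proj l e \<inter> proj l f = {}" if "e \<in> I" "f \<in> I" "e \<noteq> f" for e f
      using I(1) that by (simp add: ind_def)
    show "proj l e \<inter> (\<Union>f\<in>I. proj l f) \<noteq> {}" if e: "e \<in> A" for e
    proof
      assume d: "proj l e \<inter> (\<Union>f\<in>I. proj l f) = {}"
      then have de: "proj l e \<inter> proj l f = {}" "proj l f \<inter> proj l e = {}" if "f \<in> I" for f
        using that by auto
      have "ind (insert e I)" using I(1) e de by (simp add: ind_def)
      then have "e \<in> I" using I(2)[of "insert e I"] by blast
      then show False using de(1)[of e] assms(2)[OF e] by simp
    qed
  qed
qed

lemma blowups_member:
  assumes "T \<subseteq> {..<r * k}" "card T = r" "e \<in> blowups l T"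
  shows "finite e" "card e = r" "proj l e = T" "card (proj l e) = r"
  using assms by (auto simp: blowups_def)

definition blowup_family :: "nat \<Rightarrow> nat set set \<Rightarrow> nat set set" where
  "blowup_family l \<T> = (\<Union>T\<in>\<T>. blowups l T)"

lemma card_blowup_family:
  assumes "l \<ge> 1" "finite \<T>" "\<And>T. T \<in> \<T> \<Longrightarrow> finite T \<and> card T = r"
  shows "finite (blowup_family l \<T>)" "card (blowup_family l \<T>) = card \<T> * l ^ r"
proof -
  show "finite (blowup_family l \<T>)"
    unfolding blowup_family_def using assms blowups_finite by (intro finite_UN_I) auto
  have "card (blowup_family l \<T>) = (\<Sum>T\<in>\<T>. card (blowups l T))"
    unfolding blowup_family_def
    using assms blowups_finite[OF assms(1)] blowups_disjoint
    by (intro card_UN_disjoint) auto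
  also have "\<dots> = (\<Sum>T\<in>\<T>. l ^ r)"
    by (rule sum.cong) (use assms(3) card_blowups[OF assms(1)] in auto)
  finally show "card (blowup_family l \<T>) = card \<T> * l ^ r" by simp
qed

text \<open>The projections of a maximal clique cover \<open>J\<close>, which all blow-ups in \<open>M\<close> have to meet.\<close>

lemma blowup_clique_size:
  assumes "r \<ge> 1" "\<And>P. P \<in> \<P> \<Longrightarrow> r_pattern r P" "finite M" "real t \<le> card (M \<inter> blowup_family l \<T>)"
    and T: "\<And>T. T \<in> \<T> \<Longrightarrow> T \<subseteq> {..<r * k} \<and> card T = r"
    and pair: "\<And>S T. S \<in> \<T> \<Longrightarrow> T \<in> \<T> \<Longrightarrow> S \<inter> T = {} \<Longrightarrow>
      \<exists>P\<in>\<P>. forms P S T"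
    and few: "\<And>J. J \<subseteq> {..<r * k} \<Longrightarrow> real (card J) \<le> real r * y \<Longrightarrow>
      card (M \<inter> blowup_family l {T \<in> \<T>. T \<inter> J \<noteq> {}}) < t"
  shows "y \<le> max_clique_size r \<P> M"
proof (rule ccontr)
  assume small: "\<not> y \<le> max_clique_size r \<P> M"
  let ?A = "M \<inter> blowup_family l \<T>"
  have A: "proj l e \<in> \<T> \<and> finite e \<and> card e = r \<and> card (proj l e) = r" if e: "e \<in> ?A" for e
  proof -
    obtain T where T': "T \<in> \<T>" "e \<in> blowups l T" using e by (auto simp: blowup_family_def)
    show ?thesis using blowups_member[OF _ _ T'(2), of r k] T[OF T'(1)] T'(1) by simp
  qed
  have ne: "proj l e \<noteq> {}" if "e \<in> ?A" for e using A[OF that] assms(1) by auto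
  obtain I where I: "I \<subseteq> ?A" "\<And>e f. e \<in> I \<Longrightarrow> f \<in> I \<Longrightarrow> e \<noteq> f \<Longrightarrow> proj l e \<inter> proj l f = {}"
    "\<And>e. e \<in> ?A \<Longrightarrow> proj l e \<inter> (\<Union>f\<in>I. proj l f) \<noteq> {}"
    using maximal_disjoint_proj[of ?A l] assms(3) ne by (metis finite_Int)
  have finI: "finite I" using I(1) assms(3) finite_subset by blast
  have "clique r \<P> I"
  proof (rule clique_of_blowups[OF finI assms(2)])
    show "finite e \<and> card e = r \<and> card (proj l e) = r" if "e \<in> I" for e using A I(1) that by blast
    show "proj l e \<inter> proj l f = {} \<and> (\<exists>P\<in>\<P>. forms P (proj l e) (proj l f))"
      if "e \<in> I" "f \<in> I" "e \<noteq> f" for e f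
      using I(2)[OF that] pair[of "proj l e" "proj l f"] A I(1) that by blast
  qed
  then have cI: "card I \<le> max_clique_size r \<P> M"
    using card_le_max_clique_size[OF assms(3)] I(1) by blast
  define J where "J = (\<Union>f\<in>I. proj l f)"
  have "card J \<le> (\<Sum>f\<in>I. card (proj l f))" unfolding J_def by (rule card_UN_le[OF finI])
  also have "\<dots> = (\<Sum>f\<in>I. r)" by (rule sum.cong) (use A I(1) in auto)
  finally have "real (card J) \<le> real r * real (card I)" by (simp add: mult.commute flip: of_nat_mult)
  also have "\<dots> \<le> real r * y" using small cI by (intro mult_left_mono) auto
  finally have "real (card J) \<le> real r * y" .
  moreover have "J \<subseteq> {..<r * k}" unfolding J_def using A I(1) T by blast
  ultimately have "card (M \<inter> blowup_family l {T \<in> \<T>. T \<inter> J \<noteq> {}}) < t" by (rule few[rotated])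
  moreover have "?A \<subseteq> M \<inter> blowup_family l {T \<in> \<T>. T \<inter> J \<noteq> {}}"
  proof
    fix e assume e: "e \<in> ?A"
    then obtain T' where T': "T' \<in> \<T>" "e \<in> blowups l T'" by (auto simp: blowup_family_def)
    have "proj l e = T'" using T'(2) by (simp add: blowups_def)
    then have "T' \<inter> J \<noteq> {}" using I(3)[OF e] by (simp add: J_def)
    then show "e \<in> M \<inter> blowup_family l {T \<in> \<T>. T \<inter> J \<noteq> {}}"
      using e T' by (auto simp: blowup_family_def)
  qed
  then have "card ?A \<le> card (M \<inter> blowup_family l {T \<in> \<T>. T \<inter> J \<noteq> {}})"
    using assms(3) by (intro card_mono) auto
  ultimately show False using assms(4) by simp
qed

section \<open>Many disjoint blow-ups\<close>

lemma correlation_error: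
  assumes "r \<ge> 1"
  shows "\<exists>g. g \<longlonglongrightarrow> 0 \<and> (\<forall>n\<ge>3. correlation r n - 1 \<le> g n)"
  using correlation_limsup[OF assms] correlation_le[OF _ assms]
  by (intro exI[of _ "\<lambda>n. (real n / real (n - 2)) ^ r - 1"]) auto

lemma div_ge_half:
  fixes k n :: nat
  assumes "1 \<le> k" "k \<le> n"
  shows "n div k \<ge> 1" "real n \<le> 2 * real k * real (n div k)"
proof -
  show l: "n div k \<ge> 1" using assms by (simp add: Suc_le_eq div_greater_zero_iff)
  have "n = k * (n div k) + n mod k" by simp
  moreover have "n mod k \<le> k * 1" using assms(1) by (simp add: less_imp_le)
  moreover have "k * 1 \<le> k * (n div k)" using l by (intro mult_le_mono2)
  ultimately have "n \<le> 2 * (k * (n div k))" by linarith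
  then have "real n \<le> real (2 * (k * (n div k)))" by (simp only: of_nat_le_iff)
  then show "real n \<le> 2 * real k * real (n div k)" by simp
qed

text \<open>\<open>k\<close> is the integer part of the \<open>w\<close>-th root of
  \<open>n\<close>, so \<open>n\<close> and \<open>k^w\<close> differ by a factor of at most
  \<open>2^w\<close>, and rounding \<open>n / k\<close> down loses at most a factor 2.\<close>

lemma grid_size:
  fixes k n w :: nat
  assumes "w \<ge> 1" "n \<ge> 1" and k: "k = nat \<lfloor>real n powr (1 / real w)\<rfloor>"
  shows "1 \<le> k" "k ^ w \<le> n" "k \<le> n" "real n \<le> (2 * real k) ^ w"
    "real n powr (1 / real w) \<le> 2 * real k" "real n \<le> 2 * real k * real (n div k)"
    "n div k \<ge> 1"
proof -
  define x where "x = real n powr (1 / real w)"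
  have x: "x \<ge> 1" "x ^ w = real n"
    using assms powr_root_power[of w n] by (auto simp: x_def ge_one_powr_ge_zero)
  have kx: "real k \<le> x" "x < real k + 1"
    using x(1) unfolding k x_def[symmetric] by linarith+
  then show k1: "1 \<le> k" using x(1) by linarith
  then have kr: "real k \<ge> 1" by simp
  have "real k ^ w \<le> x ^ w" using kx by (intro power_mono) auto
  then have "real (k ^ w) \<le> real n" using x(2) by simp
  then show kw: "k ^ w \<le> n" by (simp only: of_nat_le_iff)
  have "k ^ 1 \<le> k ^ w" using k1 assms(1) by (intro power_increasing) auto
  then show kn: "k \<le> n" using kw by simp
  show x2: "real n powr (1 / real w) \<le> 2 * real k"
    using kx kr unfolding x_def[symmetric] by linarith
  then have "x ^ w \<le> (2 * real k) ^ w" using x(1) unfolding x_def by (intro power_mono) auto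
  then show "real n \<le> (2 * real k) ^ w" using x(2) by simp
  show "real n \<le> 2 * real k * real (n div k)" "n div k \<ge> 1" using div_ge_half[OF k1 kn] by simp_all
qed

text \<open>Here \<open>s\<close> is a number of template edges and \<open>l\<close> is about \<open>n / k\<close>.\<close>

lemma expected_blowups_ge:
  assumes "r \<ge> 1" "n \<ge> 1" "k \<ge> 1" "l \<ge> 1" "real n \<le> 2 * real k * real l" "0 \<le> s"
  shows "s * (fact r / (2 * real r) ^ r) * real n / real k ^ r
    \<le> s * real l ^ r * incl_prob r n 1"
proof -
  have "s * (fact r / (2 * real r) ^ r) * real n / real k ^ r
      = s * real l ^ r * (fact r * real n / (real r * (2 * real k * real l)) ^ r)"
    using assms by (simp add: power_mult_distrib field_simps)
  also have "\<dots> \<le> s * real l ^ r * (fact r * real n / real (r * n) ^ r)"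
  proof -
    have "real (r * n) ^ r \<le> (real r * (2 * real k * real l)) ^ r"
      using assms(5) by (intro power_mono) (auto intro: mult_left_mono)
    moreover have "real (r * n) ^ r > 0" using assms by simp
    ultimately show ?thesis using assms by (intro mult_left_mono divide_left_mono mult_pos_pos) auto
  qed
  also have "\<dots> \<le> s * real l ^ r * incl_prob r n 1"
    using incl_prob_1_ge[OF assms(2), of r] assms(6) by (intro mult_left_mono) auto
  finally show ?thesis .
qed

lemma card_templates_meeting:
  assumes "finite \<T>" "finite J" "\<And>v. card {T \<in> \<T>. v \<in> T} \<le> b"
  shows "card {T \<in> \<T>. T \<inter> J \<noteq> {}} \<le> card J * b"
proof -
  have "{T \<in> \<T>. T \<inter> J \<noteq> {}} = (\<Union>v\<in>J. {T \<in> \<T>. v \<in> T})" by auto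
  then have "card {T \<in> \<T>. T \<inter> J \<noteq> {}} \<le> (\<Sum>v\<in>J. card {T \<in> \<T>. v \<in> T})"
    using card_UN_le[OF assms(2)] by simp
  also have "\<dots> \<le> (\<Sum>v\<in>J. b)" by (rule sum_mono) (rule assms(3))
  finally show ?thesis by simp
qed

text \<open>\<open>u\<close> is the number of free parameters of the templates: there are
  \<open>k^u\<close> of them and fixing a vertex costs one parameter. A set of
  \<open>\<delta> * k\<close> cells therefore meets only a fraction of order \<open>\<delta>\<close>
  of the templates, too few to account for the edges that are present.\<close>

lemma clique_number_lower:
  fixes \<T> :: "nat \<Rightarrow> nat set set"
  assumes r: "r \<ge> 1" and uw: "u \<ge> 1" "w \<ge> 1" "u + w = r + 1"
    and pat: "\<And>P. P \<in> \<P> \<Longrightarrow> r_pattern r P"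
    and T: "\<And>k T. k \<ge> 1 \<Longrightarrow> T \<in> \<T> k \<Longrightarrow> T \<subseteq> {..<r * k} \<and> card T = r"
    and card_T: "\<And>k. k \<ge> 1 \<Longrightarrow> k ^ u \<le> card (\<T> k)"
    and degree: "\<And>k v. k \<ge> 1 \<Longrightarrow> card {T \<in> \<T> k. v \<in> T} \<le> k ^ (u - 1)"
    and pair: "\<And>k S T. k \<ge> 1 \<Longrightarrow> S \<in> \<T> k \<Longrightarrow> T \<in> \<T> k \<Longrightarrow> S \<inter> T = {} \<Longrightarrow>
      \<exists>P\<in>\<P>. forms P S T"
  shows "lower_rate r \<P> w"
proof -
  \<comment> \<open>\<open>A * k\<close> bounds the expected number of blow-ups from below, and
    \<open>D\<close> is the constant in the inclusion probability. Since \<open>t\<close> is at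
    least \<open>A * k / 2\<close>, the choice of \<open>h\<close> gives
    \<open>h * t \<ge> (r + 1) * k\<close>, which beats the \<open>2 ^ (r * k)\<close> cell sets.
    The base in the union bound comes out as at most \<open>\<delta> * G\<close>, and
    \<open>\<delta>\<close> makes this \<open>(1 / 2) ^ h\<close>.\<close>
  define A :: real where "A = fact r / (2 * real r) ^ r"
  define D :: real where "D = fact r * exp 1 ^ r"
  define G where "G = 2 * exp 1 * real r * D * 2 ^ w / A"
  define h where "h = nat \<lceil>2 * (real r + 1) / A\<rceil>"
  define \<delta> where "\<delta> = (1 / 2) ^ h / G"
  have A: "A > 0" using r by (simp add: A_def)
  have A1: "A \<le> 1"
  proof -
    have "(fact r :: real) \<le> real r ^ r" using fact_le_power[of r, where 'a = real] by simp
    also have "\<dots> \<le> (2 * real r) ^ r" by (intro power_mono) auto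
    finally show ?thesis using r by (simp add: A_def)
  qed
  have DG: "D > 0" "G > 0" using r A by (auto simp: D_def G_def)
  then have \<delta>: "\<delta> > 0" by (simp add: \<delta>_def)
  obtain g where g: "g \<longlonglongrightarrow> 0" "\<And>n. n \<ge> 3 \<Longrightarrow> correlation r n - 1 \<le> g n"
    using correlation_error[OF r] by blast
  define x where "x n = real n powr (1 / real w)" for n
  have bound: "RM_prob r n {M. \<not> \<delta> / 2 * x n \<le> max_clique_size r \<P> M}
      \<le> (8 / A + 2) * (1 / x n) + 4 * g n" if n: "n \<ge> 3" for n
  proof -
    define k where "k = nat \<lfloor>x n\<rfloor>"
    define l where "l = n div k"
    define t where "t = nat \<lceil>A * real k / 2\<rceil>"
    have n1: "n \<ge> 1" using n by simp
    note gs = grid_size[OF uw(2) n1, of k, folded l_def]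
    have gs: "1 \<le> k" "k ^ w \<le> n" "k \<le> n" "real n \<le> (2 * real k) ^ w" "x n \<le> 2 * real k"
      "real n \<le> 2 * real k * real l" "l \<ge> 1"
      using gs by (simp_all add: k_def x_def)
    have kpos: "real k > 0" and xpos: "x n > 0" using gs(1) n1 by (auto simp: x_def)
    have finT: "finite (\<T> k)"
      by (rule finite_subset[of _ "Pow {..<r * k}"]) (use T[OF gs(1)] in auto)
    have Tk: "finite T' \<and> card T' = r" if "T' \<in> \<T> k" for T'
      using T[OF gs(1) that] finite_subset by blast
    define \<E> where "\<E> = blowup_family l (\<T> k)"
    have cE: "finite \<E>" "card \<E> = card (\<T> k) * l ^ r"
      using card_blowup_family[OF gs(7) finT Tk] by (auto simp: \<E>_def)
    have lk: "r * k * l \<le> r * n" by (simp add: l_def)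
    have E_sub: "e \<subseteq> {1..r * n} \<and> card e = r" if e: "e \<in> \<E>" for e
    proof -
      obtain T' where T': "T' \<in> \<T> k" "e \<in> blowups l T'" using e by (auto simp: \<E>_def blowup_family_def)
      show ?thesis
        using blowups_subset[OF gs(7) _ lk T'(2)] T[OF gs(1) T'(1)] T'(2) by (simp add: blowups_def)
    qed
    define \<mu> where "\<mu> = card \<E> * incl_prob r n 1"
    \<comment> \<open>Here the relation between \<open>u\<close> and \<open>w\<close> enters: it
      makes both the expected number of blow-ups and the number of those meeting a small cell set
      linear in \<open>k\<close>.\<close>
    have kuw: "real k ^ u * real k ^ w = real k * real k ^ r"
      using uw(3) by (simp flip: power_add power_Suc)
    have \<mu>: "A * real k \<le> \<mu>"
    proof -
      have "A * real k = real k ^ u * A * real k ^ w / real k ^ r"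
        using kuw kpos by (simp add: field_simps)
      also have "\<dots> \<le> real k ^ u * A * real n / real k ^ r"
        using gs(2) A by (intro divide_right_mono mult_left_mono) (auto simp flip: of_nat_power)
      also have "\<dots> \<le> real k ^ u * real l ^ r * incl_prob r n 1"
        unfolding A_def by (rule expected_blowups_ge[OF r n1 gs(1,7,6)]) simp
      also have "\<dots> \<le> real (card (\<T> k)) * real l ^ r * incl_prob r n 1"
        using card_T[OF gs(1)] incl_prob_pos[of r n 1]
        by (intro mult_right_mono) (auto simp: less_imp_le simp flip: of_nat_power)
      finally show ?thesis by (simp add: \<mu>_def cE)
    qed
    have \<mu>pos: "\<mu> > 0" using \<mu> A kpos by (smt (verit) mult_pos_pos)
    have tk: "A * real k / 2 \<le> real t" "t \<le> n" "t > 0"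
    proof -
      show *: "A * real k / 2 \<le> real t" unfolding t_def by (rule of_nat_ceiling)
      show "t > 0" using * A kpos by (smt (verit) mult_pos_pos divide_pos_pos of_nat_0_less_iff)
      have "A * real k \<le> 1 * real k" using A1 by (intro mult_right_mono) auto
      then have "A * real k / 2 \<le> real k" using kpos by simp
      then have "t \<le> k" unfolding t_def by (simp add: nat_le_iff ceiling_le_iff)
      then show "t \<le> n" using gs(3) by simp
    qed
    \<comment> \<open>The cell sets that a clique of size at most \<open>\<delta> * k\<close> can
      cover. Their number is exponential in \<open>k\<close>, so the bound for each of them has to
      be a smaller exponential; an estimate of Chebyshev type would not suffice.\<close>
    define \<J> where "\<J> = {J. J \<subseteq> {..<r * k} \<and> real (card J) \<le> real r * (\<delta> * real k)}"
    define F where "F J = blowup_family l {T' \<in> \<T> k. T' \<inter> J \<noteq> {}}" for J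
    define s where "s = real r * (\<delta> * real k) * real k ^ (u - 1) * real l ^ r"
    have J: "finite \<J>" "real (card \<J>) \<le> 2 ^ (r * k)"
    proof -
      have sub: "\<J> \<subseteq> Pow {..<r * k}" by (auto simp: \<J>_def)
      then show "finite \<J>" by (rule finite_subset) simp
      have "card \<J> \<le> card (Pow {..<r * k})" by (rule card_mono[OF _ sub]) simp
      then have "card \<J> \<le> 2 ^ (r * k)" by (simp add: card_Pow)
      then have "real (card \<J>) \<le> real (2 ^ (r * k))" by (simp only: of_nat_le_iff)
      then show "real (card \<J>) \<le> 2 ^ (r * k)" by simp
    qed
    have F: "finite (F J) \<and> real (card (F J)) \<le> s" if J: "J \<in> \<J>" for J
    proof -
      have finJ: "finite J" using J finite_subset by (auto simp: \<J>_def)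
      have sub: "finite {T' \<in> \<T> k. T' \<inter> J \<noteq> {}}" using finT by simp
      have c: "finite (F J)" "card (F J) = card {T' \<in> \<T> k. T' \<inter> J \<noteq> {}} * l ^ r"
        unfolding F_def using card_blowup_family[OF gs(7) sub, of r] Tk by blast+
      have "card (F J) \<le> card J * k ^ (u - 1) * l ^ r"
        unfolding c(2) using card_templates_meeting[OF finT finJ degree[OF gs(1)]]
        by (intro mult_le_mono1)
      then have "real (card (F J)) \<le> real (card J * k ^ (u - 1) * l ^ r)" by (simp only: of_nat_le_iff)
      also have "\<dots> = real (card J) * (real k ^ (u - 1) * real l ^ r)" by simp
      also have "\<dots> \<le> real r * (\<delta> * real k) * (real k ^ (u - 1) * real l ^ r)"
        using J by (intro mult_right_mono) (auto simp: \<J>_def)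
      finally show ?thesis using c(1) by (simp add: s_def mult.assoc)
    qed
    have many: "RM_prob r n {M. \<exists>J\<in>\<J>. t \<le> card (M \<inter> F J)} \<le> 2 / x n"
    proof -
      define y where "y = s * exp 1 * (D * real n / real n ^ r) / real t"
      have y0: "y \<ge> 0" using \<delta> DG by (simp add: y_def s_def)
      have "real k ^ u = real k * real k ^ (u - 1)" using uw(1) by (simp flip: power_Suc)
      then have s: "s = real r * \<delta> * real k ^ u * real l ^ r" by (simp add: s_def)
      have ln: "real l ^ r / real n ^ r \<le> 1 / real k ^ r"
      proof -
        have "l * k \<le> n" by (simp add: l_def)
        then have "real l * real k \<le> real n" by (simp flip: of_nat_mult)
        then have "(real l * real k) ^ r \<le> real n ^ r" by (intro power_mono) auto
        then show ?thesis using n1 kpos by (simp add: power_mult_distrib divide_le_eq le_divide_eq field_simps)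
      qed
      have "s * (real n / real n ^ r) = real r * \<delta> * real k ^ u * real n * (real l ^ r / real n ^ r)"
        by (simp add: s)
      also have "\<dots> \<le> real r * \<delta> * real k ^ u * (2 * real k) ^ w * (1 / real k ^ r)"
        using ln gs(4) \<delta> by (intro mult_mono) auto
      also have "\<dots> = real r * \<delta> * 2 ^ w * (real k ^ u * real k ^ w) / real k ^ r"
        by (simp add: power_mult_distrib)
      also have "\<dots> = real r * \<delta> * 2 ^ w * real k" unfolding kuw using kpos by simp
      finally have "s * (real n / real n ^ r) \<le> real r * \<delta> * 2 ^ w * real k" .
      then have "exp 1 * D * (s * (real n / real n ^ r)) \<le> exp 1 * D * (real r * \<delta> * 2 ^ w * real k)"
        using DG by (intro mult_left_mono) auto
      then have "y \<le> exp 1 * D * (real r * \<delta> * 2 ^ w * real k) / real t"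
        unfolding y_def by (intro divide_right_mono) (auto simp: mult_ac)
      also have "\<dots> \<le> exp 1 * D * (real r * \<delta> * 2 ^ w * real k) / (A * real k / 2)"
        using tk DG \<delta> A kpos by (intro divide_left_mono) auto
      also have "\<dots> = \<delta> * G" using kpos A by (simp add: G_def)
      also have "\<dots> = (1 / 2) ^ h" using DG by (simp add: \<delta>_def)
      finally have y: "y \<le> (1 / 2) ^ h" .
      have ht: "(r + 1) * k \<le> h * t"
      proof -
        have "2 * (real r + 1) / A \<le> real h" unfolding h_def by (rule of_nat_ceiling)
        then have "(2 * (real r + 1) / A) * (A * real k / 2) \<le> real h * real t"
          using tk(1) A by (intro mult_mono) auto
        moreover have "(2 * (real r + 1) / A) * (A * real k / 2) = (real r + 1) * real k"
          using A by simp
        ultimately have "(real r + 1) * real k \<le> real h * real t" by simp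
        then have "real ((r + 1) * k) \<le> real (h * t)" by (simp add: algebra_simps)
        then show ?thesis by (simp only: of_nat_le_iff)
      qed
      have "RM_prob r n {M. \<exists>J\<in>\<J>. t \<le> card (M \<inter> F J)} \<le> real (card \<J>) * y ^ t"
        unfolding y_def D_def by (rule prob_many_edges_le[OF r n1 tk(2) J(1) F])
      also have "\<dots> \<le> 2 ^ (r * k) * ((1 / 2) ^ h) ^ t"
        using J(2) y y0 by (intro mult_mono power_mono) auto
      also have "\<dots> = 2 ^ (r * k) * (1 / 2) ^ (h * t)" by (simp only: power_mult)
      also have "\<dots> \<le> 2 ^ (r * k) * (1 / 2) ^ ((r + 1) * k)"
        using ht by (intro mult_left_mono power_decreasing) auto
      also have "\<dots> = (1 / 2) ^ k"
      proof -
        have *: "(r + 1) * k = r * k + k" by simp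
        have "(2 :: real) ^ m * (1 / 2) ^ m = 1" for m by (simp flip: power_mult_distrib)
        then show ?thesis unfolding * power_add by (simp flip: mult.assoc)
      qed
      also have "\<dots> \<le> 1 / real k" by (rule half_power_le[OF gs(1)])
      also have "\<dots> \<le> 2 / x n" using gs(5) kpos xpos by (simp add: divide_le_eq le_divide_eq)
      finally show ?thesis .
    qed
    have few: "RM_prob r n {M. card (M \<inter> \<E>) < \<mu> / 2} \<le> 8 / A * (1 / x n) + 4 * g n"
    proof -
      have "RM_prob r n {M. card (M \<inter> \<E>) < \<mu> / 2} \<le> 4 / \<mu> + 4 * (correlation r n - 1)"
        by (rule prob_few_edges_le[OF r cE(1) E_sub \<mu>_def \<mu>pos])
      also have "4 / \<mu> \<le> 4 / (A * real k)" using \<mu> \<mu>pos A kpos by (intro divide_left_mono) auto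
      also have "\<dots> \<le> 8 / A * (1 / x n)"
        using gs(5) kpos xpos A by (simp add: divide_le_eq le_divide_eq field_simps)
      finally show ?thesis using g(2)[OF n] by simp
    qed
    have "RM_prob r n {M. \<not> \<delta> / 2 * x n \<le> max_clique_size r \<P> M}
      \<le> RM_prob r n {M. card (M \<inter> \<E>) < \<mu> / 2 \<or> (\<exists>J\<in>\<J>. t \<le> card (M \<inter> F J))}"
    proof (rule prob_RM_mono[OF r])
      fix M assume M: "M \<in> matchings r n" and small: "\<not> \<delta> / 2 * x n \<le> max_clique_size r \<P> M"
      show "card (M \<inter> \<E>) < \<mu> / 2 \<or> (\<exists>J\<in>\<J>. t \<le> card (M \<inter> F J))"
      proof (rule ccontr)
        assume neg: "\<not> ?thesis"
        then have "A * real k / 2 \<le> real (card (M \<inter> \<E>))" using \<mu> by simp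
        then have "t \<le> card (M \<inter> \<E>)" by (simp add: t_def nat_le_iff ceiling_le_iff)
        then have tM: "real t \<le> card (M \<inter> blowup_family l (\<T> k))" by (simp add: \<E>_def)
        have "\<delta> * real k \<le> max_clique_size r \<P> M"
        proof (rule blowup_clique_size[where t = t and l = l and \<T> = "\<T> k" and k = k])
          show "T' \<subseteq> {..<r * k} \<and> card T' = r" if "T' \<in> \<T> k" for T' by (rule T[OF gs(1) that])
          show "\<exists>P\<in>\<P>. forms P S T'"
            if "S \<in> \<T> k" "T' \<in> \<T> k" "S \<inter> T' = {}" for S T'
            by (rule pair[OF gs(1) that])
          show "card (M \<inter> blowup_family l {T' \<in> \<T> k. T' \<inter> J \<noteq> {}}) < t"
            if "J \<subseteq> {..<r * k}" "real (card J) \<le> real r * (\<delta> * real k)" for J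
          proof -
            have "J \<in> \<J>" using that by (simp add: \<J>_def)
            then show ?thesis using neg by (auto simp: F_def not_le)
          qed
        qed (use r pat finite_matching_member[OF M] tM in auto)
        \<comment> \<open>Halving \<open>\<delta>\<close> pays for rounding \<open>x n\<close> down
          to \<open>k\<close>.\<close>
        moreover have "\<delta> / 2 * x n \<le> \<delta> / 2 * (2 * real k)" using gs(5) \<delta> by (intro mult_left_mono) auto
        ultimately show False using small by simp
      qed
    qed
    also have "\<dots> \<le> (8 / A * (1 / x n) + 4 * g n) + 2 / x n"
      by (rule order_trans[OF prob_union_le]) (intro add_mono few many)
    finally show ?thesis by (simp add: algebra_simps)
  qed
  have "aas r (\<lambda>n M. \<delta> / 2 * x n \<le> max_clique_size r \<P> M)"
  proof (rule aasI)
    show "\<forall>\<^sub>F n in sequentially. RM_prob r n {M. \<not> \<delta> / 2 * x n \<le> max_clique_size r \<P> M}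
        \<le> (8 / A + 2) * (1 / x n) + 4 * g n"
      using eventually_ge_at_top[of 3] by eventually_elim (rule bound)
    have lim: "(\<lambda>n. 1 / x n) \<longlonglongrightarrow> 0"
      using tendsto_inverse_0_at_top[OF powr_root_tendsto[OF uw(2)]]
      by (simp add: x_def inverse_eq_divide)
    show "(\<lambda>n. (8 / A + 2) * (1 / x n) + 4 * g n) \<longlonglongrightarrow> 0"
      using tendsto_add[OF tendsto_mult_left[OF lim, of "8 / A + 2"] tendsto_mult_left[OF g(1), of 4]]
      by simp
  qed
  then show ?thesis unfolding x_def using \<delta> by (intro exI[of _ "\<delta> / 2"]) auto
qed


section \<open>Occurrence of fixed cliques\<close>

lemma expected_edges_tendsto:
  assumes "b > 0"
  shows "(\<lambda>n. 4 / (b * real n)) \<longlonglongrightarrow> 0"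
  using tendsto_mult_left[OF lim_const_over_n[of "4 / b"], of 1] assms by simp

text \<open>With \<open>k\<close> fixed, the blow-ups of a single template already have an expected
  number of occurrences linear in \<open>n\<close>, so the second moment bound tends to 0.\<close>

lemma aas_contains_blowup:
  assumes "r \<ge> 1" "k \<ge> 1" "T \<subseteq> {..<r * k}" "card T = r"
  shows "aas r (\<lambda>n M. \<exists>e\<in>M. e \<in> blowups (n div k) T)"
proof -
  define b where "b = fact r / (2 * real r) ^ r / real k ^ r"
  have b: "b > 0" using assms by (simp add: b_def)
  obtain g where g: "g \<longlonglongrightarrow> 0" "\<And>n. n \<ge> 3 \<Longrightarrow> correlation r n - 1 \<le> g n"
    using correlation_error[OF assms(1)] by blast
  have finT: "finite T" using assms(3) finite_subset by blast
  have bound: "RM_prob r n {M. \<not> (\<exists>e\<in>M. e \<in> blowups (n div k) T)}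
      \<le> 4 / (b * real n) + 4 * g n" if n: "n \<ge> max 3 k" for n
  proof -
    define l where "l = n div k"
    define \<mu> where "\<mu> = card (blowups l T) * incl_prob r n 1"
    have l: "l \<ge> 1" and nl: "real n \<le> 2 * real k * real l"
      using div_ge_half[OF assms(2), of n] n by (simp_all add: l_def)
    from nl have "1 * (fact r / (2 * real r) ^ r) * real n / real k ^ r
      \<le> 1 * real l ^ r * incl_prob r n 1"
      using n by (intro expected_blowups_ge assms l) auto
    then have \<mu>: "b * real n \<le> \<mu>"
      using card_blowups[OF l finT] assms(4) by (simp add: b_def \<mu>_def)
    have bn: "b * real n > 0" using b n by simp
    then have \<mu>pos: "\<mu> > 0" using \<mu> by simp
    have lk: "r * k * l \<le> r * n" by (simp add: l_def)
    have sub: "e \<subseteq> {1..r * n} \<and> card e = r" if "e \<in> blowups l T" for e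
      using blowups_subset[OF l assms(3) lk that] that assms(4) by (simp add: blowups_def)
    have "RM_prob r n {M. \<not> (\<exists>e\<in>M. e \<in> blowups (n div k) T)}
        \<le> RM_prob r n {M. card (M \<inter> blowups l T) < \<mu> / 2}"
    proof (rule prob_RM_mono[OF assms(1)])
      fix M assume "\<not> (\<exists>e\<in>M. e \<in> blowups (n div k) T)"
      then have "M \<inter> blowups l T = {}" by (auto simp: l_def)
      then show "card (M \<inter> blowups l T) < \<mu> / 2" using \<mu>pos by simp
    qed
    also have "\<dots> \<le> 4 / \<mu> + 4 * (correlation r n - 1)"
      by (rule prob_few_edges_le[OF assms(1) blowups_finite[OF l finT] sub \<mu>_def \<mu>pos])
    also have "4 / \<mu> \<le> 4 / (b * real n)" using \<mu> \<mu>pos bn by (intro divide_left_mono) auto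
    finally show ?thesis using g(2)[of n] n by simp
  qed
  show ?thesis
  proof (rule aasI)
    show "\<forall>\<^sub>F n in sequentially. RM_prob r n {M. \<not> (\<exists>e\<in>M. e \<in> blowups (n div k) T)}
        \<le> 4 / (b * real n) + 4 * g n"
      using eventually_ge_at_top[of "max 3 k"] by eventually_elim (rule bound)
    show "(\<lambda>n. 4 / (b * real n) + 4 * g n) \<longlonglongrightarrow> 0"
      using tendsto_add[OF expected_edges_tendsto[OF b] tendsto_mult_left[OF g(1), of 4]] by simp
  qed
qed

text \<open>The edges of \<open>F\<close> are used as templates. They are finitely many and
  disjoint, so blow-ups of all of them occur simultaneously and form a copy of
  \<open>F\<close>.\<close>

lemma aas_clique_size_ge:
  fixes F :: "nat set set"
  assumes "r \<ge> 1" "\<And>P. P \<in> \<P> \<Longrightarrow> r_pattern r P" "clique r \<P> F"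
  shows "aas r (\<lambda>n M. card F \<le> max_clique_size r \<P> M)"
proof -
  have F: "finite F" "\<And>f. f \<in> F \<Longrightarrow> finite f \<and> card f = r" "pairwise disjnt F"
    using assms(3) by (auto simp: clique_def ordered_matching_def)
  then have "finite (\<Union>F)" by blast
  then obtain K where K: "\<Union>F \<subseteq> {..<K}" using finite_nat_iff_bounded by blast
  \<comment> \<open>The successor keeps \<open>k\<close> positive even if \<open>F\<close> is
    empty.\<close>
  define k where "k = Suc K"
  have "K \<le> r * k" using mult_le_mono1[OF assms(1), of k] by (simp add: k_def)
  then have sub: "f \<subseteq> {..<r * k}" if "f \<in> F" for f using K that by force
  have "aas r (\<lambda>n M. \<forall>f\<in>F. \<exists>e\<in>M. e \<in> blowups (n div k) f)"
    using aas_contains_blowup[OF assms(1), of k] sub F by (intro aas_ball) (auto simp: k_def)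
  then show ?thesis
  proof (rule aas_mono[OF assms(1)], intro always_eventually allI ballI impI)
    fix n M assume M: "M \<in> matchings r n" "\<forall>f\<in>F. \<exists>e\<in>M. e \<in> blowups (n div k) f"
    define l where "l = n div k"
    obtain \<phi> where \<phi>: "\<And>f. f \<in> F \<Longrightarrow> \<phi> f \<in> M \<and> \<phi> f \<in> blowups l f"
      using M(2) unfolding l_def by metis
    have pr: "proj l (\<phi> f) = f" "finite (\<phi> f)" "card (\<phi> f) = r" if "f \<in> F" for f
      using \<phi>[OF that] F(2)[OF that] by (auto simp: blowups_def)
    have inj: "inj_on \<phi> F" by (rule inj_on_inverseI[of _ "proj l"]) (rule pr(1))
    have "clique r \<P> (\<phi> ` F)"
    proof (rule clique_of_blowups[where l = l])
      show "finite (\<phi> ` F)" using F(1) by simp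
      show "finite e \<and> card e = r \<and> card (proj l e) = r" if "e \<in> \<phi> ` F" for e
        using that pr F(2) by auto
      show "proj l e \<inter> proj l f = {} \<and> (\<exists>P\<in>\<P>. forms P (proj l e) (proj l f))"
        if ef: "e \<in> \<phi> ` F" "f \<in> \<phi> ` F" "e \<noteq> f" for e f
      proof -
        obtain e' f' where *: "e' \<in> F" "f' \<in> F" "e = \<phi> e'" "f = \<phi> f'" using ef by blast
        then have "e' \<noteq> f'" using ef(3) by blast
        moreover from this have "e' \<inter> f' = {}"
          using pairwiseD[OF F(3) *(1,2)] by (simp add: disjnt_def)
        ultimately show ?thesis using assms(3) * pr(1) by (simp add: clique_def)
      qed
    qed (rule assms(2))
    moreover have "\<phi> ` F \<subseteq> M" using \<phi> by blast
    ultimately have "card (\<phi> ` F) \<le> max_clique_size r \<P> M"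
      using card_le_max_clique_size[OF finite_matching_member[OF M(1)]] by blast
    then show "card F \<le> max_clique_size r \<P> M" using inj by (simp add: card_image)
  qed
qed

section \<open>Cliques from templates and the number of cliques\<close>

lemma tsize_pattern: "r_pattern r (left_word L) \<Longrightarrow> tsize L = r"
  using count_list_letter[of r "left_word L" LA] by (simp add: count_list_words)

text \<open>Every pattern begins with \<open>LA\<close>, so the first blocks of the two words agree
  and place the edges by \<open>i\<close>. This is why disjoint template edges have different
  \<open>i\<close>.\<close>

lemma first_block:
  assumes "proper L" "r_pattern r (left_word L)" "r_pattern r (right_word L)"
  obtains t L' where "L = (t, LA, LA) # L'"
proof (cases L)
  case Nil
  then show ?thesis using assms by (simp add: r_pattern_def)
next
  case (Cons a L')
  obtain t x x' where a: "a = (t, x, x')" by (cases a)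
  have "t \<ge> 1" using assms(1) by (simp add: Cons a)
  then obtain t' where "t = Suc t'" by (cases t) auto
  then have "x = LA" "x' = LA"
    using assms(2,3) by (simp_all add: r_pattern_def Cons a blk_def)
  then show ?thesis using that a Cons by simp
qed

lemma tedge_pair:
  assumes "r_pattern r (left_word L)" "r_pattern r (right_word L)"
    and ij: "i < k" "j < k" "i' < k" "j' < k"
    and disj: "tedge k L i j \<inter> tedge k L i' j' = {}"
    and neq: "i \<noteq> i'" "j \<noteq> j'"
  shows "(i < i' \<longleftrightarrow> j < j') \<Longrightarrow>
      forms (left_word L) (tedge k L i j) (tedge k L i' j')"
    "\<not> (i < i' \<longleftrightarrow> j < j') \<Longrightarrow>
      forms (right_word L) (tedge k L i j) (tedge k L i' j')"
proof -
  have r: "tsize L = r" by (rule tsize_pattern[OF assms(1)])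
  note p = tedge_props(1,2)[OF ij(1,2), where L = L, unfolded r]
    tedge_props(1,2)[OF ij(3,4), where L = L, unfolded r]
  show "forms (left_word L) (tedge k L i j) (tedge k L i' j')"
    if "i < i' \<longleftrightarrow> j < j'"
    unfolding order_isomorphic_pattern_iff[OF assms(1) p(1,3,2,4) disj]
    using tedge_arranged(1)[of i k j i' j' L] tedge_arranged(1)[of i' k j' i j L] ij neq that r
    by (cases "i < i'") auto
  show "forms (right_word L) (tedge k L i j) (tedge k L i' j')"
    if "\<not> (i < i' \<longleftrightarrow> j < j')"
    unfolding order_isomorphic_pattern_iff[OF assms(2) p(1,3,2,4) disj]
    using tedge_arranged(2)[of i k j i' j' L] tedge_arranged(2)[of i' k j' i j L] ij neq that r
    by (cases "i < i'") auto
qed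

lemma tedge_eqD:
  assumes "L = (t, LA, LA) # L'" "proper L" "i < k" "j < k" "i' < k" "j' < k"
    and "tedge k L i j = tedge k L i' j'"
  shows "i = i'" "left_word L \<noteq> right_word L \<Longrightarrow> j = j'"
proof -
  have eq: "tpos k L i j p = tpos k L i' j' p" if "p < tsize L" for p
    using tedge_props(4)[OF assms(3,4) that] tedge_props(4)[OF assms(5,6) that] assms(7) by simp
  show i: "i = i'" using eq[of 0] assms(1,2) by (simp add: slot_def)
  assume "left_word L \<noteq> right_word L"
  from tpos_differ[OF assms(2) this, of k] show "j = j'" using eq assms(4,6) by blast
qed

text \<open>All \<open>k^2\<close> cells are used, so \<open>u = 2\<close>. Disjoint template edges
  differ in both indices, and whether these are ordered alike or oppositely decides between
  \<open>P\<close> and \<open>Q\<close>.\<close>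

lemma lower_harmonious:
  assumes "r \<ge> 2" "r_pattern r P" "r_pattern r Q" "harmonious P Q"
  shows "lower_rate r {P, Q} (r - 1)"
proof -
  obtain L where L: "proper L" "P = left_word L" "Q = right_word L"
    using harmonious_words[OF assms(4)] .
  have neq: "left_word L \<noteq> right_word L" using assms(4) L by (simp add: harmonious_def)
  have pat: "r_pattern r (left_word L)" "r_pattern r (right_word L)" using assms L by simp_all
  have r: "tsize L = r" by (rule tsize_pattern[OF pat(1)])
  obtain t L' where L': "L = (t, LA, LA) # L'" using first_block[OF L(1) pat] .
  define \<T> where "\<T> k = (\<lambda>(i, j). tedge k L i j) ` ({..<k} \<times> {..<k})" for k
  show ?thesis
  proof (rule clique_number_lower[where u = 2 and \<T> = \<T>])
    show "T \<subseteq> {..<r * k} \<and> card T = r" if "T \<in> \<T> k" for k T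
    proof -
      obtain i j where "i < k" "j < k" "T = tedge k L i j" using \<open>T \<in> \<T> k\<close> by (auto simp: \<T>_def)
      then show ?thesis using tedge_props(2,3)[of i k j L] by (simp add: r mult.commute)
    qed
    show "k ^ 2 \<le> card (\<T> k)" for k
    proof -
      have "inj_on (\<lambda>(i, j). tedge k L i j) ({..<k} \<times> {..<k})"
        using tedge_eqD[OF L' L(1)] neq by (auto intro!: inj_onI)
      then have "card (\<T> k) = card ({..<k} \<times> {..<k})" unfolding \<T>_def by (rule card_image)
      then show ?thesis by (simp add: card_cartesian_product power2_eq_square)
    qed
    show "card {T \<in> \<T> k. v \<in> T} \<le> k ^ (2 - 1)" for k v
    proof -
      obtain c where c: "(\<forall>i j. i < k \<longrightarrow> j < k \<longrightarrow> v \<in> tedge k L i j \<longrightarrow> i = c) \<or>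
          (\<forall>i j. i < k \<longrightarrow> j < k \<longrightarrow> v \<in> tedge k L i j \<longrightarrow> j = c)"
        using tedge_degree .
      have "\<exists>h. {T \<in> \<T> k. v \<in> T} \<subseteq> h ` {..<k}"
        using c
      proof
        assume c: "\<forall>i j. i < k \<longrightarrow> j < k \<longrightarrow> v \<in> tedge k L i j \<longrightarrow> i = c"
        show ?thesis
          by (rule exI[of _ "\<lambda>j. tedge k L c j"]) (use c in \<open>auto simp: \<T>_def\<close>)
      next
        assume c: "\<forall>i j. i < k \<longrightarrow> j < k \<longrightarrow> v \<in> tedge k L i j \<longrightarrow> j = c"
        show ?thesis
          by (rule exI[of _ "\<lambda>i. tedge k L i c"]) (use c in \<open>auto simp: \<T>_def\<close>)
      qed
      then obtain h where "{T \<in> \<T> k. v \<in> T} \<subseteq> h ` {..<k}" ..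
      then have "card {T \<in> \<T> k. v \<in> T} \<le> card {..<k}" by (rule surj_card_le[rotated]) simp
      then show ?thesis by simp
    qed
    show "\<exists>P\<in>{P, Q}. forms P S T"
      if ST: "S \<in> \<T> k" "T \<in> \<T> k" "S \<inter> T = {}" for k S T
    proof -
      obtain i j i' j' where S: "S = tedge k L i j" "T = tedge k L i' j'"
        and ij: "i < k" "j < k" "i' < k" "j' < k"
        using ST(1,2) by (auto simp: \<T>_def)
      note d = tedge_disjoint[OF L' L(1) ij ST(3)[unfolded S]]
      show ?thesis
        using tedge_pair[OF pat ij ST(3)[unfolded S] d(1) d(2)[OF neq]] S L by auto
    qed
  qed (use assms in auto)
qed

text \<open>\<open>P\<close> is paired with itself and only the diagonal cells are kept. Two of
  these are ordered alike in both indices, so they form \<open>P\<close>, and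
  \<open>u = 1\<close>.\<close>

lemma lower_collectable:
  assumes "r \<ge> 1" "r_pattern r P" "collectable P"
  shows "lower_rate r {P} r"
proof -
  obtain L where L: "proper L" "P = left_word L" "P = right_word L"
    using collectable_word[OF assms(3)] .
  have pat: "r_pattern r (left_word L)" "r_pattern r (right_word L)" using assms L by simp_all
  have r: "tsize L = r" by (rule tsize_pattern[OF pat(1)])
  obtain t L' where L': "L = (t, LA, LA) # L'" using first_block[OF L(1) pat] .
  define \<T> where "\<T> k = (\<lambda>i. tedge k L i i) ` {..<k}" for k
  show ?thesis
  proof (rule clique_number_lower[where u = 1 and \<T> = \<T>])
    show "T \<subseteq> {..<r * k} \<and> card T = r" if "T \<in> \<T> k" for k T
    proof -
      obtain i where "i < k" "T = tedge k L i i" using \<open>T \<in> \<T> k\<close> by (auto simp: \<T>_def)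
      then show ?thesis using tedge_props(2,3)[of i k i L] by (simp add: r mult.commute)
    qed
    show "k ^ 1 \<le> card (\<T> k)" for k
    proof -
      have "inj_on (\<lambda>i. tedge k L i i) {..<k}"
        using tedge_eqD(1)[OF L' L(1)] by (auto intro!: inj_onI)
      then have "card (\<T> k) = card {..<k}" unfolding \<T>_def by (rule card_image)
      then show ?thesis by simp
    qed
    show "card {T \<in> \<T> k. v \<in> T} \<le> k ^ (1 - 1)" for k v
    proof -
      obtain c where c: "(\<forall>i j. i < k \<longrightarrow> j < k \<longrightarrow> v \<in> tedge k L i j \<longrightarrow> i = c) \<or>
          (\<forall>i j. i < k \<longrightarrow> j < k \<longrightarrow> v \<in> tedge k L i j \<longrightarrow> j = c)"
        using tedge_degree .
      then have "{T \<in> \<T> k. v \<in> T} \<subseteq> {tedge k L c c}" by (auto simp: \<T>_def)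
      then have "card {T \<in> \<T> k. v \<in> T} \<le> card {tedge k L c c}" by (rule card_mono[rotated]) simp
      then show ?thesis by simp
    qed
    show "\<exists>P\<in>{P}. forms P S T"
      if ST: "S \<in> \<T> k" "T \<in> \<T> k" "S \<inter> T = {}" for k S T
    proof -
      obtain i i' where S: "S = tedge k L i i" "T = tedge k L i' i'"
        and ij: "i < k" "i' < k"
        using ST(1,2) by (auto simp: \<T>_def)
      note d = tedge_disjoint(1)[OF L' L(1) ij(1) ij(1) ij(2) ij(2) ST(3)[unfolded S]]
      show ?thesis
        using tedge_pair(1)[OF pat ij(1) ij(1) ij(2) ij(2) ST(3)[unfolded S] d d] S L by simp
    qed
  qed (use assms in auto)
qed

text \<open>The composite \<open>X'\<close> after the inverse of \<open>X\<close> is a strictly monotone map of a finite set onto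
  itself.\<close>

lemma same_order_same_image:
  fixes X X' :: "'a \<Rightarrow> nat"
  assumes "finite I" "X ` I = X' ` I"
    and iff: "\<And>s t. s \<in> I \<Longrightarrow> t \<in> I \<Longrightarrow> X s < X t \<longleftrightarrow> X' s < X' t"
    and "s \<in> I"
  shows "X s = X' s"
proof -
  define V where "V = X ` I"
  define h where "h v = X' (inv_into I X v)" for v
  have inv: "inv_into I X v \<in> I \<and> X (inv_into I X v) = v" if "v \<in> V" for v
    using that inv_into_into[of v X I] f_inv_into_f[of v X I] by (simp add: V_def)
  have h: "h (X t) = X' t" if t: "t \<in> I" for t
  proof -
    have Xt: "X t \<in> V" using t by (simp add: V_def)
    let ?t = "inv_into I X (X t)"
    have "?t \<in> I" "X ?t = X t" using inv[OF Xt] by simp_all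
    then have "\<not> X' ?t < X' t" "\<not> X' t < X' ?t"
      using iff[of ?t t] iff[of t ?t] t by simp_all
    then show ?thesis by (simp add: h_def)
  qed
  have finV: "finite V" using assms(1) by (simp add: V_def)
  have "strict_mono_on V h"
  proof (rule strict_mono_onI)
    fix u v assume uv: "u \<in> V" "v \<in> V" "u < v"
    then show "h u < h v"
      using iff[of "inv_into I X u" "inv_into I X v"] inv[OF uv(1)] inv[OF uv(2)]
      by (simp add: h_def)
  qed
  then have "sorted_list_of_set (h ` V) = map h (sorted_list_of_set V)"
    by (rule sorted_list_of_set_image_strict_mono[OF finV])
  moreover have "h ` V = V"
  proof -
    have "h ` X ` I = X' ` I" unfolding image_image by (rule image_cong) (simp_all add: h)
    then show ?thesis using assms(2) by (simp add: V_def)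
  qed
  ultimately have "map h (sorted_list_of_set V) = map (\<lambda>v. v) (sorted_list_of_set V)" by simp
  then have "h v = v" if "v \<in> V" for v using that finV by (simp only: map_eq_conv) simp
  then have "h (X s) = X s" using assms(4) by (simp add: V_def)
  then show ?thesis using h[OF assms(4)] by simp
qed

section \<open>Counting cliques by codes\<close>

definition sorted_clique ::
  "nat \<Rightarrow> nat \<Rightarrow> nat \<Rightarrow> (nat \<Rightarrow> nat \<Rightarrow> bool) \<Rightarrow> (nat \<Rightarrow> nat \<Rightarrow> bool) \<Rightarrow> (nat \<Rightarrow> nat set) \<Rightarrow> bool" where
  "sorted_clique r d k R R' f \<longleftrightarrow> (\<forall>i<k. finite (f i) \<and> card (f i) = r) \<and>
     (\<forall>j<k. \<forall>i<j. f i \<inter> f j = {} \<and> vx (f i) d < vx (f j) d \<and>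
       (arranged r R (f i) (f j) \<or> arranged r R' (f i) (f j)))"

lemma sorted_clique_exists:
  assumes "r_pattern r P" "r_pattern r Q" "d < r" "before x P d d" "before x' Q d d"
    and "clique r {P, Q} S" "card S = k"
  obtains f where "sorted_clique r d k (before x P) (before x' Q) f" "f ` {..<k} = S"
proof -
  have S: "finite S" "\<And>e. e \<in> S \<Longrightarrow> finite e \<and> card e = r"
    "\<And>e f. e \<in> S \<Longrightarrow> f \<in> S \<Longrightarrow> e \<noteq> f \<Longrightarrow> e \<inter> f = {}"
    using assms(6) unfolding clique_def ordered_matching_def pairwise_def disjnt_def by auto
  define key where "key e = vx e d" for e
  have inj: "inj_on key S"
  proof (rule inj_onI, rule ccontr)
    fix e f assume "e \<in> S" "f \<in> S" "key e = key f" "e \<noteq> f"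
    then show False using vx_neq[of e f d d] S(2)[of e] S(2)[of f] S(3)[of e f] assms(3)
      by (simp add: key_def)
  qed
  define xs where "xs = sorted_list_of_set (key ` S)"
  have xs: "set xs = key ` S" "length xs = k"
    using S(1) inj assms(7) by (simp_all add: xs_def card_image)
  define f where "f i = inv_into S key (xs ! i)" for i
  have f: "f i \<in> S" "key (f i) = xs ! i" if "i < k" for i
  proof -
    have "xs ! i \<in> key ` S" using that xs nth_mem by metis
    then show "f i \<in> S" "key (f i) = xs ! i"
      unfolding f_def by (rule inv_into_into, rule f_inv_into_f)
  qed
  have less: "key (f i) < key (f j)" if "i < j" "j < k" for i j
  proof -
    have "xs ! i < xs ! j"
      using sorted_wrt_nth_less[of "(<)" xs i j] strict_sorted_list_of_set[of "key ` S"] that xs(2)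
      by (simp add: xs_def)
    then show ?thesis using f that by simp
  qed
  have im: "f ` {..<k} = S"
  proof (intro equalityI subsetI)
    fix e assume "e \<in> S"
    then have "key e \<in> set xs" using xs(1) by simp
    then obtain i where i: "i < k" "xs ! i = key e" using xs(2) by (metis in_set_conv_nth)
    then have "f i = e" using \<open>e \<in> S\<close> inj by (simp add: f_def)
    then show "e \<in> f ` {..<k}" using i(1) by blast
  qed (use f(1) in auto)
  have "sorted_clique r d k (before x P) (before x' Q) f"
    unfolding sorted_clique_def
  proof (intro conjI allI impI)
    fix i j assume ij: "j < k" "i < j"
    then have m: "f i \<in> S" "f j \<in> S" using f(1) by simp_all
    have l: "vx (f i) d < vx (f j) d" using less[OF ij(2,1)] by (simp add: key_def)
    then show "vx (f i) d < vx (f j) d" .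
    have ne: "f i \<noteq> f j" using l by auto
    show disj: "f i \<inter> f j = {}" by (rule S(3)[OF m ne])
    have "forms P (f i) (f j) \<or> forms Q (f i) (f j)"
      using assms(6) m ne by (simp add: clique_def)
    then show "arranged r (before x P) (f i) (f j) \<or> arranged r (before x' Q) (f i) (f j)"
      using order_isomorphic_pattern_arranged[OF assms(1) _ _ _ _ disj _ assms(3,4) l]
        order_isomorphic_pattern_arranged[OF assms(2) _ _ _ _ disj _ assms(3,5) l] S(2)[OF m(1)] S(2)[OF m(2)]
      by blast
  qed (use S(2) f(1) in auto)
  then show thesis using im that by blast
qed

text \<open>\<open>R\<close> and \<open>R'\<close> disagree at \<open>(a, b)\<close>, so this one
  comparison reveals the pattern of a pair and thereby all its comparisons. The order of all pairs
  \<open>(i, p)\<close> together with the set of vertices then gives back every vertex.\<close>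

lemma sorted_clique_determined:
  assumes "sorted_clique r d k R R' f" "sorted_clique r d k R R' f'"
    and "a < r" "b < r" "R a b \<noteq> R' a b"
    and "\<And>i j. i < j \<Longrightarrow> j < k \<Longrightarrow> vx (f i) a < vx (f j) b \<longleftrightarrow> vx (f' i) a < vx (f' j) b"
    and "\<Union>(f ` {..<k}) = \<Union>(f' ` {..<k})"
  shows "f ` {..<k} = f' ` {..<k}"
proof -
  have F: "finite (f i)" "card (f i) = r" "finite (f' i)" "card (f' i) = r" if "i < k" for i
    using assms(1,2) that by (simp_all add: sorted_clique_def)
  have D: "f i \<inter> f j = {}" "f' i \<inter> f' j = {}" if "i < j" "j < k" for i j
    using assms(1,2) that by (simp_all add: sorted_clique_def)
  have up: "vx (f i) p < vx (f j) q \<longleftrightarrow> vx (f' i) p < vx (f' j) q"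
    if "i < j" "j < k" "p < r" "q < r" for i j p q
  proof -
    have "arranged r R (f i) (f j) \<or> arranged r R' (f i) (f j)"
      "arranged r R (f' i) (f' j) \<or> arranged r R' (f' i) (f' j)"
      using assms(1,2) that(1,2) by (simp_all add: sorted_clique_def)
    then show ?thesis
      using assms(3-5) assms(6)[OF that(1,2)] that(3,4) unfolding arranged_def by metis
  qed
  have all: "vx (f i) p < vx (f j) q \<longleftrightarrow> vx (f' i) p < vx (f' j) q"
    if "i < k" "j < k" "p < r" "q < r" for i j p q
  proof (rule linorder_cases[of i j])
    assume "i < j"
    then show ?thesis using up that by simp
  next
    assume "i = j"
    then show ?thesis using vx_less_iff F[OF that(1)] that(3,4) by simp
  next
    assume ji: "j < i"
    have "vx (f j) q \<noteq> vx (f i) p" "vx (f' j) q \<noteq> vx (f' i) p"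
      using vx_neq[of "f j" "f i" q p] vx_neq[of "f' j" "f' i" q p] D[OF ji that(1)]
        F[OF that(1)] F[OF that(2)] that(3,4) by simp_all
    then show ?thesis using up[OF ji that(1) that(4) that(3)] by linarith
  qed
  define X where "X = (\<lambda>(i, p). vx (f i) p)"
  define X' where "X' = (\<lambda>(i, p). vx (f' i) p)"
  have img: "vx (f i) ` {..<r} = f i" "vx (f' i) ` {..<r} = f' i" if "i < k" for i
    using vx_image_lessThan F[OF that] by metis+
  have "X ` ({..<k} \<times> {..<r}) = (\<Union>i<k. vx (f i) ` {..<r})" by (auto simp: X_def)
  moreover have "X' ` ({..<k} \<times> {..<r}) = (\<Union>i<k. vx (f' i) ` {..<r})" by (auto simp: X'_def)
  ultimately have "X ` ({..<k} \<times> {..<r}) = X' ` ({..<k} \<times> {..<r})"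
    using assms(7) img by simp
  then have "X s = X' s" if "s \<in> {..<k} \<times> {..<r}" for s
    using that all by (intro same_order_same_image[of "{..<k} \<times> {..<r}"]) (auto simp: X_def X'_def)
  then have "vx (f i) p = vx (f' i) p" if "i < k" "p < r" for i p
    using that by (auto simp: X_def X'_def)
  then have "f i = f' i" if "i < k" for i
    using img[OF that] that by (metis (no_types, lifting) image_cong lessThan_iff)
  then show ?thesis by (intro image_cong) auto
qed

text \<open>A clique is recovered from its vertex set, which has \<open>r * k\<close> elements, and
  the code of one sorted enumeration.\<close>

lemma card_cliques_le:
  assumes "r_pattern r P" "r_pattern r Q" "d < r" "before x P d d" "before x' Q d d"
    and "a < r" "b < r" "before x P a b \<noteq> before x' Q a b" "finite V" "finite \<C>"
    and code: "\<And>f. sorted_clique r d k (before x P) (before x' Q) f \<Longrightarrow> code f \<in> \<C>"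
    and determines: "\<And>f f' i j. sorted_clique r d k (before x P) (before x' Q) f \<Longrightarrow>
      sorted_clique r d k (before x P) (before x' Q) f' \<Longrightarrow> code f = code f' \<Longrightarrow> i < j \<Longrightarrow> j < k \<Longrightarrow>
      vx (f i) a < vx (f j) b \<longleftrightarrow> vx (f' i) a < vx (f' j) b"
  shows "card (cliques_in r {P, Q} V k) \<le> (card V choose (r * k)) * card \<C>"
proof -
  let ?S = "cliques_in r {P, Q} V k" and ?W = "{W. W \<subseteq> V \<and> card W = r * k}"
  let ?sorted = "sorted_clique r d k (before x P) (before x' Q)"
  define en where "en S = (SOME f. ?sorted f \<and> f ` {..<k} = S)" for S
  have en: "?sorted (en S)" "en S ` {..<k} = S" if "S \<in> ?S" for S
  proof -
    have "clique r {P, Q} S" "card S = k" using that by (simp_all add: cliques_in_def)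
    then obtain f where "?sorted f \<and> f ` {..<k} = S"
      using sorted_clique_exists[OF assms(1-5)] by metis
    then have "?sorted (en S) \<and> en S ` {..<k} = S" unfolding en_def by (rule someI[of "\<lambda>f. ?sorted f \<and> f ` {..<k} = S"])
    then show "?sorted (en S)" "en S ` {..<k} = S" by simp_all
  qed
  have "inj_on (\<lambda>S. (\<Union>S, code (en S))) ?S"
  proof (rule inj_onI)
    fix S S' assume S: "S \<in> ?S" "S' \<in> ?S" "(\<Union>S, code (en S)) = (\<Union>S', code (en S'))"
    have eq: "\<Union>S = \<Union>S'" "code (en S) = code (en S')" using S(3) by simp_all
    have "en S ` {..<k} = en S' ` {..<k}"
    proof (rule sorted_clique_determined[OF en(1)[OF S(1)] en(1)[OF S(2)] assms(6-8)])
      show "vx (en S i) a < vx (en S j) b \<longleftrightarrow> vx (en S' i) a < vx (en S' j) b"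
        if "i < j" "j < k" for i j
        by (rule determines[OF en(1)[OF S(1)] en(1)[OF S(2)] eq(2) that])
      show "\<Union>(en S ` {..<k}) = \<Union>(en S' ` {..<k})"
        unfolding en(2)[OF S(1)] en(2)[OF S(2)] by (rule eq(1))
    qed
    then show "S = S'" using en(2)[OF S(1)] en(2)[OF S(2)] by simp
  qed
  moreover have "(\<lambda>S. (\<Union>S, code (en S))) ` ?S \<subseteq> ?W \<times> \<C>"
  proof (rule image_subsetI)
    fix S assume S: "S \<in> ?S"
    then have "\<Union>S \<subseteq> V" "card S = k" "ordered_matching r S"
      by (simp_all add: cliques_in_def clique_def)
    then show "(\<Union>S, code (en S)) \<in> ?W \<times> \<C>"
      using card_Union_matching[of r S] code[OF en(1)[OF S]] by simp
  qed
  moreover have "finite (?W \<times> \<C>)" using assms(9,10) by simp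
  ultimately have "card ?S \<le> card (?W \<times> \<C>)" by (rule card_inj_on_le)
  also have "\<dots> = (card V choose (r * k)) * card \<C>"
    using n_subsets[OF assms(9), of "r * k"] by (simp add: card_cartesian_product)
  finally show ?thesis .
qed

lemma rank_less:
  fixes u :: "nat \<Rightarrow> nat"
  assumes "i < k" "u i < u j"
  shows "card {l. l < k \<and> u l < u i} < card {l. l < k \<and> u l < u j}"
proof (rule psubset_card_mono)
  show "{l. l < k \<and> u l < u i} \<subset> {l. l < k \<and> u l < u j}" using assms by auto
qed simp

text \<open>The edges are sorted at coordinate 0, where both patterns start with \<open>LA\<close>,
  and compared at the coordinate \<open>p\<close> where the patterns disagree. The order at
  \<open>p\<close> relative to the order at 0 is the permutation.\<close>

lemma upper_harmonious:
  assumes "r \<ge> 2" "r_pattern r P" "r_pattern r Q" "harmonious P Q"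
  shows "upper_rate r {P, Q} (r - 1)"
proof -
  obtain L where L: "proper L" "P = left_word L" "Q = right_word L"
    using harmonious_words[OF assms(4)] .
  have neq: "left_word L \<noteq> right_word L" using assms(4) L by (simp add: harmonious_def)
  have r: "tsize L = r" using tsize_pattern assms(2) L by simp
  obtain p where p: "p < r" "before LA P p p \<noteq> before LA Q p p"
    using tpos_differ[OF L(1) neq] L r by metis
  have d: "before LA P 0 0" "before LA Q 0 0"
    using assms(2,3) by (auto simp: r_pattern_def intro: before_hd)
  \<comment> \<open>Ranks replace the vertices themselves, so that the number of codes depends on
    \<open>k\<close> only.\<close>
  define code where "code k f = restrict (\<lambda>i. card {l. l < k \<and> vx (f l) p < vx (f i) p}) {..<k}"
    for k and f :: "nat \<Rightarrow> nat set"
  show ?thesis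
  proof (rule clique_number_upper[where B = 1])
    fix n k :: nat assume "k \<ge> 1"
    let ?C = "{..<k} \<rightarrow>\<^sub>E {..<k}"
    have "card (cliques_in r {P, Q} {1..r * n} k) \<le> (card {1..r * n} choose (r * k)) * card ?C"
    proof (rule card_cliques_le[OF assms(2,3) _ d p(1) p(1) p(2), of _ _ _ "code k"])
      fix f assume f: "sorted_clique r 0 k (before LA P) (before LA Q) f"
      have "card {l. l < k \<and> vx (f l) p < vx (f i) p} < k" if "i < k" for i
      proof -
        have "card {l. l < k \<and> vx (f l) p < vx (f i) p} < card {..<k}"
          by (rule psubset_card_mono) (use that in auto)
        then show ?thesis by simp
      qed
      then show "code k f \<in> ?C" by (auto simp: code_def)
    next
      have code_iff: "vx (f i) p < vx (f j) p \<longleftrightarrow> code k f i < code k f j"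
        if f: "sorted_clique r 0 k (before LA P) (before LA Q) f" and ij: "i < j" "j < k" for f i j
      proof -
        have "f i \<inter> f j = {}" "finite (f i)" "finite (f j)" "card (f i) = r" "card (f j) = r"
          using f ij by (simp_all add: sorted_clique_def)
        then have "vx (f i) p \<noteq> vx (f j) p" using vx_neq p(1) by simp
        then consider "vx (f i) p < vx (f j) p" | "vx (f j) p < vx (f i) p" by linarith
        then show ?thesis
          using rank_less[of i k "\<lambda>l. vx (f l) p" j] rank_less[of j k "\<lambda>l. vx (f l) p" i] ij
          by cases (auto simp: code_def)
      qed
      fix f f' i j
      assume "sorted_clique r 0 k (before LA P) (before LA Q) f"
        "sorted_clique r 0 k (before LA P) (before LA Q) f'"
        "code k f = code k f'" "i < j" "j < k"
      then show "vx (f i) p < vx (f j) p \<longleftrightarrow> vx (f' i) p < vx (f' j) p"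
        using code_iff[of f i j] code_iff[of f' i j] by simp
    qed (use assms(1) in \<open>auto intro: finite_PiE\<close>)
    also have "card ?C = k ^ k" by (simp add: card_PiE)
    finally have "real (card (cliques_in r {P, Q} {1..r * n} k))
        \<le> real ((r * n choose (r * k)) * k ^ k)" by (simp only: of_nat_le_iff) simp
    moreover have "r - (r - 1) = 1" using assms(1) by simp
    ultimately show "real (card (cliques_in r {P, Q} {1..r * n} k))
        \<le> real (r * n choose (r * k)) * (1 ^ k * real k ^ (k * (r - (r - 1))))" by simp
  qed (use assms(1) in auto)
qed

lemma before_mono: "before x P p q \<Longrightarrow> p' \<le> p \<Longrightarrow> q \<le> q' \<Longrightarrow> before x P p' q'"
proof (induction P arbitrary: p q p' q')
  case (Cons z w)
  show ?case
  proof (cases "z = x")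
    case True
    show ?thesis
    proof (cases "p' = 0")
      case False
      then have "before x w (p - 1) q" "p' - 1 \<le> p - 1" using Cons.prems True by auto
      then show ?thesis using Cons.IH[of "p - 1" q "p' - 1" q'] Cons.prems(3) True by simp
    qed (simp add: True)
  next
    case False
    then have "q \<noteq> 0" "before x w p (q - 1)" using Cons.prems by auto
    then show ?thesis using Cons.IH[of p "q - 1" p' "q' - 1"] Cons.prems False by auto
  qed
qed simp

section \<open>Interval systems that cross or nest\<close>

lemma strict_mono_image_unique:
  fixes g g' :: "nat \<Rightarrow> nat"
  assumes "\<And>i j. i < j \<Longrightarrow> j < k \<Longrightarrow> g i < g j" "\<And>i j. i < j \<Longrightarrow> j < k \<Longrightarrow> g' i < g' j"
    and "g ` {..<k} = g' ` {..<k}" "i < k"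
  shows "g i = g' i"
proof (rule same_order_same_image[where X = g and X' = g' and I = "{..<k}" and s = i])
  have iff: "h s < h t \<longleftrightarrow> s < t" if "\<And>i j. i < j \<Longrightarrow> j < k \<Longrightarrow> h i < h j" "s < k" "t < k"
    for s t and h :: "nat \<Rightarrow> nat"
    using that(1)[of s t] that(1)[of t s] that(2,3) by (cases s t rule: linorder_cases) auto
  show "g s < g t \<longleftrightarrow> g' s < g' t" if "s \<in> {..<k}" "t \<in> {..<k}" for s t
    using iff[of g s t] iff[of g' s t] assms(1,2) that by simp
qed (use assms in auto)

text \<open>Intervals \<open>[F i, X i]\<close> with increasing left endpoints. If no two of them cross, or none is
  nested in another, then the numbers \<open>\<eta> j\<close> of intervals to the left of the \<open>j\<close>-th one
  determine which pairs overlap.\<close>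

definition left_count :: "nat \<Rightarrow> (nat \<Rightarrow> nat) \<Rightarrow> (nat \<Rightarrow> nat) \<Rightarrow> nat \<Rightarrow> nat" where
  "left_count k F X j = card {i. i < k \<and> X i < F j}"

lemma left_count_less:
  fixes F X :: "nat \<Rightarrow> nat"
  assumes "\<And>i. i < k \<Longrightarrow> F i < X i" "\<And>i j. i < j \<Longrightarrow> j < k \<Longrightarrow> F i < F j" "i < k" "j < k" "X i < F j"
  shows "i < j"
proof (rule ccontr)
  assume "\<not> i < j"
  then consider "j < i" | "j = i" by linarith
  then have "F j \<le> F i" using assms(2)[of j i] assms(3) by cases auto
  then show False using assms(1)[OF assms(3)] assms(5) by simp
qed

text \<open>Without nesting the right endpoints increase along with the left ones, so the intervals
  to the left of the \<open>j\<close>-th one form an initial segment of the indices.\<close>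

lemma crossing_overlap:
  fixes F X :: "nat \<Rightarrow> nat"
  assumes "\<And>i. i < k \<Longrightarrow> F i < X i" "\<And>i j. i < j \<Longrightarrow> j < k \<Longrightarrow> F i < F j"
    and cross: "\<And>i j. i < j \<Longrightarrow> j < k \<Longrightarrow> F j < X i \<Longrightarrow> X i < X j"
    and ne: "\<And>i j. i < j \<Longrightarrow> j < k \<Longrightarrow> F j \<noteq> X i"
    and "i < j" "j < k"
  shows "X i < F j \<longleftrightarrow> i < left_count k F X j"
proof -
  have X: "X a < X b" if "a < b" "b < k" for a b
  proof (cases "F b < X a")
    case False
    then have "X a < F b" using ne[OF that] by simp
    also have "\<dots> < X b" by (rule assms(1)[OF that(2)])
    finally show ?thesis .
  qed (rule cross[OF that])
  show ?thesis
  proof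
    assume "X i < F j"
    have "X a < F j" if "a \<le> i" for a
      using X[of a i] that \<open>X i < F j\<close> assms(5,6) by (cases "a = i") auto
    then have "{..i} \<subseteq> {a. a < k \<and> X a < F j}" using assms(5,6) by auto
    then have "card {..i} \<le> left_count k F X j" unfolding left_count_def by (intro card_mono) auto
    then show "i < left_count k F X j" by simp
  next
    assume l: "i < left_count k F X j"
    show "X i < F j"
    proof (rule ccontr)
      assume n: "\<not> X i < F j"
      have "a < i" if "a < k" "X a < F j" for a
      proof (rule ccontr)
        assume "\<not> a < i"
        then have "X i \<le> X a" using X[of i a] that(1) by (cases "a = i") auto
        then show False using n that(2) by simp
      qed
      then have "{a. a < k \<and> X a < F j} \<subseteq> {..<i}" by auto
      then have "left_count k F X j \<le> card {..<i}" unfolding left_count_def by (intro card_mono) auto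
      then show False using l by simp
    qed
  qed
qed

text \<open>In the nested case \<open>m - \<eta> m\<close> intervals contain \<open>F m\<close> in their interior. Interval \<open>i\<close> ends before
  \<open>F j\<close> if and only if this number drops to its value at \<open>i\<close> somewhere in between.\<close>

lemma nesting_overlap:
  fixes F X :: "nat \<Rightarrow> nat"
  assumes "\<And>i. i < k \<Longrightarrow> F i < X i" "\<And>i j. i < j \<Longrightarrow> j < k \<Longrightarrow> F i < F j"
    and nest: "\<And>i j. i < j \<Longrightarrow> j < k \<Longrightarrow> F j < X i \<Longrightarrow> X j < X i"
    and ne: "\<And>i j. i < j \<Longrightarrow> j < k \<Longrightarrow> F j \<noteq> X i"
    and "i < j" "j < k"
  shows "X i < F j \<longleftrightarrow> (\<exists>m. i < m \<and> m \<le> j \<and> m + left_count k F X i \<le> i + left_count k F X m)"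
proof -
  define opn where "opn m = {c. c < m \<and> F m < X c}" for m
  have fin: "finite (opn m)" for m by (simp add: opn_def)
  have count: "m = left_count k F X m + card (opn m)" if m: "m < k" for m
  proof -
    have "{..<m} = {c. c < k \<and> X c < F m} \<union> opn m"
    proof (intro equalityI subsetI)
      fix c assume c: "c \<in> {..<m}"
      then have "F m \<noteq> X c" using ne[of c m] m by simp
      then show "c \<in> {c. c < k \<and> X c < F m} \<union> opn m" using c m by (auto simp: opn_def)
    next
      fix c assume "c \<in> {c. c < k \<and> X c < F m} \<union> opn m"
      then show "c \<in> {..<m}"
        using left_count_less[of k F X c m, OF assms(1,2)] m by (auto simp: opn_def)
    qed
    then have "card {..<m} = card ({c. c < k \<and> X c < F m} \<union> opn m)" by simp
    also have "\<dots> = left_count k F X m + card (opn m)"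
      unfolding left_count_def by (rule card_Un_disjoint) (auto simp: opn_def)
    finally show ?thesis by simp
  qed
  have iff: "m + left_count k F X i \<le> i + left_count k F X m \<longleftrightarrow> card (opn m) \<le> card (opn i)"
    if "m < k" for m
    using count[OF that] count[of i] assms(5,6) by linarith
  show ?thesis
  proof
    assume Xi: "X i < F j"
    \<comment> \<open>At the first left endpoint beyond \<open>X i\<close> every interval opened
      after \<open>F i\<close> has been closed: it started inside the interval \<open>i\<close> and
      is nested in it. So nothing is open that was not open at \<open>i\<close>.\<close>
    define m where "m = (LEAST m. i < m \<and> X i < F m)"
    have m: "i < m" "X i < F m" "m \<le> j"
      using LeastI[of "\<lambda>m. i < m \<and> X i < F m" j] Least_le[of "\<lambda>m. i < m \<and> X i < F m" j] Xi assms(5)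
      by (simp_all add: m_def)
    then have mk: "m < k" using assms(6) by simp
    have "opn m \<subseteq> opn i"
    proof
      fix c assume "c \<in> opn m"
      then have c: "c < m" "F m < X c" by (simp_all add: opn_def)
      have "\<not> i < c"
      proof
        assume ic: "i < c"
        have ck: "c < k" using c(1) mk by simp
        have "\<not> X i < F c" using not_less_Least[of c "\<lambda>m. i < m \<and> X i < F m"] c(1) ic by (simp add: m_def)
        then have "F c < X i" using ne[OF ic ck] by simp
        then have "X c < X i" by (rule nest[OF ic ck])
        then show False using c(2) m(2) by simp
      qed
      moreover have "c \<noteq> i" using c(2) m(2) by auto
      ultimately have "c < i" by simp
      moreover have "F i < X c" using assms(2)[OF m(1) mk] c(2) by simp
      ultimately show "c \<in> opn i" by (simp add: opn_def)
    qed
    then have "card (opn m) \<le> card (opn i)" by (rule card_mono[OF fin])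
    then show "\<exists>m. i < m \<and> m \<le> j \<and> m + left_count k F X i \<le> i + left_count k F X m"
      using iff[OF mk] m by blast
  next
    assume "\<exists>m. i < m \<and> m \<le> j \<and> m + left_count k F X i \<le> i + left_count k F X m"
    then obtain m where m: "i < m" "m \<le> j" "m + left_count k F X i \<le> i + left_count k F X m" by blast
    have mk: "m < k" using m(2) assms(6) by simp
    then have le: "card (opn m) \<le> card (opn i)" using iff m(3) by blast
    show "X i < F j"
    proof (rule ccontr)
      assume "\<not> X i < F j"
      then have "F j < X i" using ne[OF assms(5,6)] by simp
      moreover have "F m \<le> F j" using assms(2)[of m j] m(2) assms(6) by (cases "m = j") auto
      ultimately have Fm: "F m < X i" by simp
      \<comment> \<open>As long as the interval \<open>i\<close> is open, so are all intervals that
        contain it, and \<open>i\<close> itself adds one more.\<close>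
      have "insert i (opn i) \<subseteq> opn m"
      proof
        fix c assume "c \<in> insert i (opn i)"
        then consider "c = i" | "c < i" "F i < X c" by (auto simp: opn_def)
        then show "c \<in> opn m"
        proof cases
          case 1
          then show ?thesis using m(1) Fm by (simp add: opn_def)
        next
          case 2
          have "X i < X c" using nest[OF 2(1) _ 2(2)] assms(5,6) by simp
          then show ?thesis using 2(1) m(1) Fm by (simp add: opn_def)
        qed
      qed
      then have "card (insert i (opn i)) \<le> card (opn m)" by (rule card_mono[OF fin])
      moreover have "card (insert i (opn i)) = Suc (card (opn i))"
        using fin by (simp add: opn_def)
      ultimately show False using le by simp
    qed
  qed
qed

text \<open>Adding \<open>j\<close> makes the weakly increasing counts strictly increasing, so they
  can be recovered from their set of values alone. The bit \<open>b\<close> says whether overlapping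
  intervals cross or nest; it must be common to both systems.\<close>

lemma left_count_code:
  fixes F X F' X' :: "nat \<Rightarrow> nat"
  assumes FX: "\<And>i. i < k \<Longrightarrow> F i < X i" "\<And>i j. i < j \<Longrightarrow> j < k \<Longrightarrow> F i < F j"
    and FX': "\<And>i. i < k \<Longrightarrow> F' i < X' i" "\<And>i j. i < j \<Longrightarrow> j < k \<Longrightarrow> F' i < F' j"
    and ne: "\<And>i j. i < j \<Longrightarrow> j < k \<Longrightarrow> F j \<noteq> X i" "\<And>i j. i < j \<Longrightarrow> j < k \<Longrightarrow> F' j \<noteq> X' i"
    and order: "\<And>i j. i < j \<Longrightarrow> j < k \<Longrightarrow> F j < X i \<Longrightarrow> (X i < X j \<longleftrightarrow> b) \<and> (X j < X i \<longleftrightarrow> \<not> b)"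
      "\<And>i j. i < j \<Longrightarrow> j < k \<Longrightarrow> F' j < X' i \<Longrightarrow> (X' i < X' j \<longleftrightarrow> b) \<and> (X' j < X' i \<longleftrightarrow> \<not> b)"
    and code: "(\<lambda>j. j + left_count k F X j) ` {..<k} = (\<lambda>j. j + left_count k F' X' j) ` {..<k}"
    and ij: "i < j" "j < k"
  shows "X i < F j \<longleftrightarrow> X' i < F' j"
proof -
  have mono: "a + left_count k G Y a < b + left_count k G Y b"
    if "a < b" "b < k" "\<And>i j. i < j \<Longrightarrow> j < k \<Longrightarrow> G i < G j" for a b and G Y :: "nat \<Rightarrow> nat"
  proof -
    have "G a < G b" by (rule that(3)[OF that(1,2)])
    then have "left_count k G Y a \<le> left_count k G Y b"
      unfolding left_count_def by (intro card_mono) auto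
    then show ?thesis using that(1) by simp
  qed
  have "m + left_count k F X m = m + left_count k F' X' m" if "m < k" for m
    by (rule strict_mono_image_unique[OF _ _ code that]) (use mono FX(2) FX'(2) in blast)+
  then have eq: "left_count k F X m = left_count k F' X' m" if "m < k" for m using that by simp
  show ?thesis
  proof (cases b)
    case True
    have "X i < F j \<longleftrightarrow> i < left_count k F X j"
      by (rule crossing_overlap[OF FX _ ne(1) ij]) (use order(1) True in auto)
    moreover have "X' i < F' j \<longleftrightarrow> i < left_count k F' X' j"
      by (rule crossing_overlap[OF FX' _ ne(2) ij]) (use order(2) True in auto)
    ultimately show ?thesis using eq[OF ij(2)] by simp
  next
    case False
    have "X i < F j \<longleftrightarrow> (\<exists>m. i < m \<and> m \<le> j \<and> m + left_count k F X i \<le> i + left_count k F X m)"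
      by (rule nesting_overlap[OF FX _ ne(1) ij]) (use order(1) False in auto)
    moreover have "X' i < F' j \<longleftrightarrow> (\<exists>m. i < m \<and> m \<le> j \<and> m + left_count k F' X' i \<le> i + left_count k F' X' m)"
      by (rule nesting_overlap[OF FX' _ ne(2) ij]) (use order(2) False in auto)
    moreover have "left_count k F X m = left_count k F' X' m" if "m \<le> j" for m
      using eq that ij(2) by simp
    ultimately show ?thesis using ij(1) by (metis less_imp_le_nat)
  qed
qed

section \<open>The size of the largest clique\<close>

text \<open>Subsets of \<open>{..<2 * k}\<close> as codes number \<open>4 ^ k\<close>, which
  involves no power of \<open>k\<close>; hence the exponent \<open>1 / r\<close>.\<close>

lemma clique_number_upper_code:
  assumes "r \<ge> 1" "r_pattern r P" "r_pattern r Q" "d < r" "before x P d d" "before x' Q d d"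
    and "a < r" "b < r" "before x P a b \<noteq> before x' Q a b"
    and code: "\<And>k f. k \<ge> 1 \<Longrightarrow> sorted_clique r d k (before x P) (before x' Q) f \<Longrightarrow>
      code k f \<subseteq> {..<2 * k}"
    and determines: "\<And>k f f' i j. k \<ge> 1 \<Longrightarrow> sorted_clique r d k (before x P) (before x' Q) f \<Longrightarrow>
      sorted_clique r d k (before x P) (before x' Q) f' \<Longrightarrow> code k f = code k f' \<Longrightarrow> i < j \<Longrightarrow> j < k \<Longrightarrow>
      vx (f i) a < vx (f j) b \<longleftrightarrow> vx (f' i) a < vx (f' j) b"
  shows "upper_rate r {P, Q} r"
proof (rule clique_number_upper[where B = 4])
  fix n k :: nat assume k: "k \<ge> 1"
  have "card (cliques_in r {P, Q} {1..r * n} k)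
      \<le> (card {1..r * n} choose (r * k)) * card (Pow {..<2 * k})"
  proof (rule card_cliques_le[OF assms(2-9), where code = "code k"])
    show "code k f \<in> Pow {..<2 * k}" if "sorted_clique r d k (before x P) (before x' Q) f" for f
      using code[OF k that] by simp
    show "vx (f i) a < vx (f j) b \<longleftrightarrow> vx (f' i) a < vx (f' j) b"
      if "sorted_clique r d k (before x P) (before x' Q) f"
        "sorted_clique r d k (before x P) (before x' Q) f'" "code k f = code k f'" "i < j" "j < k"
      for f f' i j
      by (rule determines[OF k that])
    show "finite {1..r * n}" "finite (Pow {..<2 * k})" by simp_all
  qed
  also have "card (Pow {..<2 * k}) = 4 ^ k"
  proof -
    have "(2 :: nat) ^ (2 * k) = (2 ^ 2) ^ k" by (rule power_mult)
    then show ?thesis by (simp add: card_Pow)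
  qed
  finally have "real (card (cliques_in r {P, Q} {1..r * n} k))
      \<le> real ((r * n choose (r * k)) * 4 ^ k)" by (simp only: of_nat_le_iff) simp
  then show "real (card (cliques_in r {P, Q} {1..r * n} k))
      \<le> real (r * n choose (r * k)) * (4 ^ k * real k ^ (k * (r - r)))" by simp
qed (use assms(1) in auto)

lemma upper_different_runs:
  assumes "r \<ge> 1" "r_pattern r P" "r_pattern r Q" "d < r" "before x P d d" "before x' Q d d"
    and "s < r" "\<not> before x P s d" "before x' Q s d"
  shows "upper_rate r {P, Q} r"
proof -
  \<comment> \<open>\<open>before\<close> is antitone in its first index, and \<open>P\<close>
    satisfies it at \<open>(d, d)\<close> but not at \<open>(s, d)\<close>.\<close>
  have ds: "d < s"
    using before_mono[OF assms(5), of s d] assms(8) by (meson not_le order_refl)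
  define F where "F f i = vx (f i) d" for f :: "nat \<Rightarrow> nat set" and i
  define X where "X f i = vx (f i) s" for f :: "nat \<Rightarrow> nat set" and i
  \<comment> \<open>Overlap forces the pair to form \<open>P\<close>, because \<open>Q\<close> puts
    the whole interval \<open>i\<close> before \<open>F f j\<close>. The value of
    \<open>before x P s s\<close> then decides between crossing and nesting, uniformly for all
    pairs.\<close>
  have FX: "i < k \<Longrightarrow> F f i < X f i" "i < j \<Longrightarrow> j < k \<Longrightarrow> F f i < F f j"
    "i < j \<Longrightarrow> j < k \<Longrightarrow> F f j \<noteq> X f i"
    "i < j \<Longrightarrow> j < k \<Longrightarrow> F f j < X f i \<Longrightarrow>
      (X f i < X f j \<longleftrightarrow> before x P s s) \<and> (X f j < X f i \<longleftrightarrow> \<not> before x P s s)"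
    if f: "sorted_clique r d k (before x P) (before x' Q) f" for f i j k
  proof -
    have fi: "finite (f i)" "card (f i) = r" if "i < k" for i
      using f that by (simp_all add: sorted_clique_def)
    show "F f i < X f i" if "i < k"
      using vx_less[OF fi(1)[OF that] ds] fi(2)[OF that] assms(7) by (simp add: F_def X_def)
    assume ij: "i < j" "j < k"
    then have ik: "i < k" by simp
    have D: "f i \<inter> f j = {}" "vx (f i) d < vx (f j) d"
      "arranged r (before x P) (f i) (f j) \<or> arranged r (before x' Q) (f i) (f j)"
      using f ij by (simp_all add: sorted_clique_def)
    have ne: "vx (f i) s \<noteq> vx (f j) q" if "q < r" for q
      using vx_neq[OF fi(1)[OF ik] fi(1)[OF ij(2)] _ _ D(1)] fi(2)[OF ik] fi(2)[OF ij(2)] assms(7) that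
      by simp
    show "F f i < F f j" using D(2) by (simp add: F_def)
    show "F f j \<noteq> X f i" using ne[OF assms(4)] by (simp add: F_def X_def)
    assume "F f j < X f i"
    then have "\<not> vx (f i) s < vx (f j) d" by (simp add: F_def X_def)
    then have "arranged r (before x P) (f i) (f j)"
      using D(3) assms(4,7,9) by (auto simp: arranged_def)
    then have "X f i < X f j \<longleftrightarrow> before x P s s" using assms(7) by (simp add: arranged_def X_def)
    then show "(X f i < X f j \<longleftrightarrow> before x P s s) \<and> (X f j < X f i \<longleftrightarrow> \<not> before x P s s)"
      using ne[OF assms(7)] by (auto simp: X_def)
  qed
  show ?thesis
  proof (rule clique_number_upper_code[OF assms(1-6,7,4),
        where code = "\<lambda>k f. (\<lambda>j. j + left_count k (F f) (X f) j) ` {..<k}"])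
    show "before x P s d \<noteq> before x' Q s d" using assms(8,9) by simp
    show "(\<lambda>j. j + left_count k (F f) (X f) j) ` {..<k} \<subseteq> {..<2 * k}" for k f
    proof -
      have "left_count k (F f) (X f) j \<le> card {..<k}" for j
        unfolding left_count_def by (rule card_mono) auto
      then have "j + left_count k (F f) (X f) j < 2 * k" if "j < k" for j
        using that by (simp add: mult_2 add_less_le_mono)
      then show ?thesis by auto
    qed
    fix k f f' i j
    assume f: "sorted_clique r d k (before x P) (before x' Q) f"
      and f': "sorted_clique r d k (before x P) (before x' Q) f'"
      and code: "(\<lambda>j. j + left_count k (F f) (X f) j) ` {..<k}
        = (\<lambda>j. j + left_count k (F f') (X f') j) ` {..<k}"
      and ij: "i < j" "j < k"
    have "X f i < F f j \<longleftrightarrow> X f' i < F f' j"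
      by (rule left_count_code[OF FX(1,2)[OF f] FX(1,2)[OF f'] FX(3)[OF f] FX(3)[OF f']
            FX(4)[OF f] FX(4)[OF f'] code ij])
    then show "vx (f i) s < vx (f j) d \<longleftrightarrow> vx (f' i) s < vx (f' j) d" by (simp add: F_def X_def)
  qed
qed

text \<open>Disjointness turns the second inequality into a strict one, and the three close a cycle.
  In applications \<open>e\<close>, \<open>f\<close>, \<open>g\<close> are three edges of a sorted
  clique, and the first two inequalities hold whichever pattern the pairs form.\<close>

lemma vertex_contradiction:
  assumes "u < r" "s < r" "d < r"
    and "finite e" "finite f" "finite g" "card e = r" "card f = r" "card g = r" "e \<inter> g = {}"
    and "vx f u < vx g d" "\<not> vx e s < vx g d" "vx e s < vx f u"
  shows False
  using assms(11-13) vx_neq[of e g s d] assms by auto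

text \<open>Only pairs involving the last edge can be arranged like \<open>Q\<close>.\<close>

lemma upper_broken_block:
  assumes "r \<ge> 1" "r_pattern r P" "r_pattern r Q" "d < r" "before x P d d" "before x' Q d d"
    and u: "u < r" "before x P u d" "before x' Q u d"
    and s: "s < r" "\<not> before x P s d" "\<not> before x' Q s d" "\<not> before x P s u" "before x' Q s u"
  shows "upper_rate r {P, Q} r"
proof (rule clique_number_upper_code[OF assms(1-6) s(1) u(1),
      where code = "\<lambda>k f. {i. i < k \<and> vx (f i) s < vx (f (k - 1)) u}"])
  show "before x P s u \<noteq> before x' Q s u" using s by simp
  show "{i. i < k \<and> vx (f i) s < vx (f (k - 1)) u} \<subseteq> {..<2 * k}" for k and f :: "nat \<Rightarrow> nat set"
    by auto
  \<comment> \<open>Suppose an edge \<open>m\<close> follows \<open>j\<close>. Both patterns put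
    \<open>u\<close> of \<open>j\<close> before \<open>d\<close> of \<open>m\<close>, and
    \<open>d\<close> of \<open>m\<close> before \<open>s\<close> of \<open>i\<close>. So
    \<open>s\<close> of \<open>i\<close> is not before \<open>u\<close> of \<open>j\<close>, and the
    pair \<open>i\<close>, \<open>j\<close> cannot form \<open>Q\<close>. Only the pairs with the
    last edge remain to be recorded.\<close>
  have last: "vx (f i) s < vx (f j) u \<longleftrightarrow> j = k - 1 \<and> i \<in> {i. i < k \<and> vx (f i) s < vx (f (k - 1)) u}"
    if f: "sorted_clique r d k (before x P) (before x' Q) f" and ij: "i < j" "j < k" for k f i j
  proof (cases "j = k - 1")
    case True
    then show ?thesis using ij by auto
  next
    case False
    define m where "m = k - 1"
    have m: "j < m" "m < k" "i < m" using False ij by (simp_all add: m_def)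
    have fin: "finite (f l)" "card (f l) = r" if "l < k" for l
      using f that by (simp_all add: sorted_clique_def)
    have ar: "arranged r (before x P) (f j) (f m) \<or> arranged r (before x' Q) (f j) (f m)"
      "arranged r (before x P) (f i) (f m) \<or> arranged r (before x' Q) (f i) (f m)"
      and disj: "f i \<inter> f m = {}"
      using f m by (simp_all add: sorted_clique_def)
    have "vx (f j) u < vx (f m) d" "\<not> vx (f i) s < vx (f m) d"
      using ar u s assms(4) by (auto simp: arranged_def)
    then have "\<not> vx (f i) s < vx (f j) u"
      using vertex_contradiction[OF u(1) s(1) assms(4) fin(1) fin(1) fin(1) fin(2) fin(2) fin(2) disj] ij m
      by (meson less_trans)
    then show ?thesis using False by simp
  qed
  fix k f f' i j
  assume "sorted_clique r d k (before x P) (before x' Q) f"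
    "sorted_clique r d k (before x P) (before x' Q) f'"
    "{i. i < k \<and> vx (f i) s < vx (f (k - 1)) u} = {i. i < k \<and> vx (f' i) s < vx (f' (k - 1)) u}"
    "i < j" "j < k"
  then show "vx (f i) s < vx (f j) u \<longleftrightarrow> vx (f' i) s < vx (f' j) u"
    using last[of k f i j] last[of k f' i j] by simp
qed

section \<open>Bounds for mismatches\<close>

lemma r_pattern_balanced: "r_pattern r P \<Longrightarrow> balanced P \<and> count_list P LA = r"
  by (simp add: r_pattern_def balanced_def)

lemma upper_mismatch_collectable:
  assumes "r \<ge> 1" "r_pattern r P" "r_pattern r Q" "collectable P" "P \<noteq> Q" "\<not> harmonious P Q"
  shows "upper_rate r {P, Q} r"
proof -
  have bal: "balanced Q" "count_list P LA = count_list Q LA" and cQ: "count_list Q LA = r"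
    using r_pattern_balanced[OF assms(2)] r_pattern_balanced[OF assms(3)] by simp_all
  have "\<not> (\<exists>L. proper L \<and> P = left_word L \<and> Q = right_word L)"
    using collectable_words assms(5,6) by (auto simp: harmonious_def)
  then obtain x x' d where d: "d < r" "before x P d d" "before x' Q d d"
    and alt: "(\<exists>s<r. before x P s d \<noteq> before x' Q s d) \<or>
       (\<exists>u<r. \<exists>s<r. before x P u d \<and> before x' Q u d \<and>
          \<not> before x P s d \<and> \<not> before x' Q s d \<and> \<not> before x P s u \<and> before x' Q s u)"
    using compare_words[OF assms(4) bal, unfolded cQ] by (elim disjE exE conjE) blast+
  from alt show ?thesis
  proof (elim disjE exE conjE, goal_cases)
    case (1 s)
    show ?thesis
    proof (cases "before x P s d")
      case True
      then have "upper_rate r {Q, P} r"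
        using upper_different_runs[OF assms(1,3,2) d(1,3,2) 1(1)] 1(2) by simp
      then show ?thesis by (simp add: insert_commute)
    next
      case False
      then show ?thesis using upper_different_runs[OF assms(1,2,3) d 1(1)] 1(2) by simp
    qed
  next
    case (2 u s)
    then show ?thesis using upper_broken_block[OF assms(1,2,3) d] by blast
  qed
qed

lemma mismatch_bounds:
  assumes "r \<ge> 1" "r_pattern r P" "r_pattern r Q" "mismatch P Q"
  shows "upper_rate r {P, Q} r"
    "lower_rate r {P, Q} r"
proof -
  have neq: "P \<noteq> Q" "Q \<noteq> P" "\<not> harmonious P Q" "\<not> harmonious Q P" "collectable P \<or> collectable Q"
    using assms(4) by (auto simp: mismatch_def harmonious_def)
  have comm: "{Q, P} = {P, Q}" by (rule insert_commute)
  show "upper_rate r {P, Q} r"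
    using neq(5) upper_mismatch_collectable[OF assms(1,2,3) _ neq(1,3)]
      upper_mismatch_collectable[OF assms(1,3,2) _ neq(2,4), unfolded comm] by blast
  \<comment> \<open>More patterns can only enlarge the largest clique, so a collectable member alone
    yields the lower bound.\<close>
  have single: "lower_rate r {P, Q} r"
    if R: "collectable R" "r_pattern r R" "R \<in> {P, Q}" for R
  proof -
    obtain c where c: "c > 0" "aas r (\<lambda>n M. c * real n powr (1 / real r) \<le> real (max_clique_size r {R} M))"
      using lower_collectable[OF assms(1) R(2,1)] by blast
    have "aas r (\<lambda>n M. c * real n powr (1 / real r) \<le> real (max_clique_size r {P, Q} M))"
    proof (rule aas_mono[OF assms(1) c(2)], intro always_eventually allI ballI impI)
      fix n M assume M: "M \<in> matchings r n"
        and le: "c * real n powr (1 / real r) \<le> real (max_clique_size r {R} M)"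
      have "max_clique_size r {R} M \<le> max_clique_size r {P, Q} M"
        using R(3) by (intro max_clique_size_mono finite_matching_member[OF M]) auto
      then show "c * real n powr (1 / real r) \<le> real (max_clique_size r {P, Q} M)" using le by simp
    qed
    then show ?thesis using c(1) by blast
  qed
  show "lower_rate r {P, Q} r"
    using neq(5) single[of P] single[of Q] assms(2,3) by auto
qed

lemma two_sided_bounds:
  fixes Z :: "nat set set \<Rightarrow> nat" and g :: "nat \<Rightarrow> real"
  assumes "r \<ge> 1" "\<exists>c>0. aas r (\<lambda>n M. c * g n \<le> real (Z M))" "\<exists>C>0. aas r (\<lambda>n M. real (Z M) \<le> C * g n)"
    and "\<And>n. g n \<ge> 0"
  shows "\<exists>c C :: real. 0 < c \<and> c < C \<and> aas r (\<lambda>n M. c * g n \<le> real (Z M) \<and> real (Z M) \<le> C * g n)"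
proof -
  obtain c C where cC: "c > 0" "aas r (\<lambda>n M. c * g n \<le> real (Z M))"
    "C > 0" "aas r (\<lambda>n M. real (Z M) \<le> C * g n)" using assms(2,3) by blast
  \<comment> \<open>Adding \<open>c\<close> to the upper constant forces it above the lower
    one.\<close>
  have "aas r (\<lambda>n M. c * g n \<le> real (Z M) \<and> real (Z M) \<le> (C + c) * g n)"
  proof (rule aas_mono[OF assms(1) aas_conj[OF cC(2,4)]], intro always_eventually allI ballI impI)
    fix n M assume *: "c * g n \<le> real (Z M) \<and> real (Z M) \<le> C * g n"
    have "0 \<le> c * g n" using cC(1) assms(4)[of n] by simp
    then show "c * g n \<le> real (Z M) \<and> real (Z M) \<le> (C + c) * g n"
      using * by (simp add: distrib_right)
  qed
  then show ?thesis using cC(1,3) by (intro exI[of _ c] exI[of _ "C + c"]) auto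
qed

section \<open>Pairs of non-collectable patterns\<close>

lemma no_triple_clique:
  fixes T :: "nat set set"
  assumes "r_pattern r P" "\<not> collectable P" "clique r {P} T" "card T = 3"
  shows False
proof -
  obtain x d u s where w: "d < r" "u < r" "s < r" "before x P d d" "before x P u d"
    "\<not> before x P s d" "before x P s u"
    using not_collectable_defect[of P] assms(2) r_pattern_balanced[OF assms(1)] by auto
  obtain f where f: "sorted_clique r d 3 (before x P) (before x P) f"
    using sorted_clique_exists[OF assms(1,1) w(1,4,4), of T 3] assms(3,4) by auto
  have ar: "arranged r (before x P) (f i) (f j)" "f i \<inter> f j = {}" if "i < j" "j < 3" for i j
    using f that by (auto simp: sorted_clique_def)
  have fin: "finite (f i)" "card (f i) = r" if "i < 3" for i
    using f that by (simp_all add: sorted_clique_def)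
  \<comment> \<open>The defect is read off the pairs (1, 2), (0, 2) and (0, 1): coordinate
    \<open>u\<close> of edge 1, \<open>d\<close> of edge 2 and \<open>s\<close> of edge 0 would each
    have to precede the next cyclically.\<close>
  have "vx (f 1) u < vx (f 2) d" "\<not> vx (f 0) s < vx (f 2) d" "vx (f 0) s < vx (f 1) u"
    using ar(1)[of 1 2] ar(1)[of 0 2] ar(1)[of 0 1] w by (simp_all add: arranged_def)
  then show False
    using vertex_contradiction[OF w(2,3,1), of "f 0" "f 1" "f 2"] fin ar(2)[of 0 2] by simp
qed

text \<open>Some three vertices are joined to \<open>v\<close> in one colour \<open>c\<close>;
  either two of them are also joined in \<open>c\<close> and complete a triangle with
  \<open>v\<close>, or all three are joined in the other colour.\<close>

lemma ramsey_3_3: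
  assumes "finite N" "card N \<ge> 6" and sym: "\<And>a b. R a b \<longleftrightarrow> R b a"
  shows "\<exists>T\<subseteq>N. card T = 3 \<and> ((\<forall>a\<in>T. \<forall>b\<in>T. a \<noteq> b \<longrightarrow> R a b) \<or> (\<forall>a\<in>T. \<forall>b\<in>T. a \<noteq> b \<longrightarrow> \<not> R a b))"
proof -
  have "N \<noteq> {}" using assms(2) by auto
  then obtain v where v: "v \<in> N" by blast
  define W where "W c = {e \<in> N - {v}. R v e \<longleftrightarrow> c}" for c
  have "N - {v} = W True \<union> W False" "W True \<inter> W False = {}" "finite (W c)" for c
    using assms(1) by (auto simp: W_def)
  then have "card (W True) + card (W False) = card (N - {v})" by (simp add: card_Un_disjoint)
  moreover have "card (N - {v}) = card N - 1" using v by simp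
  ultimately have "card (W True) \<ge> 3 \<or> card (W False) \<ge> 3" using assms(2) by linarith
  then obtain c where "card (W c) \<ge> 3" by blast
  then obtain T where T: "T \<subseteq> W c" "card T = 3" by (meson obtain_subset_with_card_n)
  show ?thesis
  proof (cases "\<exists>a\<in>T. \<exists>b\<in>T. a \<noteq> b \<and> (R a b \<longleftrightarrow> c)")
    case True
    then obtain a b where ab: "a \<in> T" "b \<in> T" "a \<noteq> b" "R a b \<longleftrightarrow> c" by blast
    then have "v \<noteq> a" "v \<noteq> b" "R v a \<longleftrightarrow> c" "R v b \<longleftrightarrow> c" "{v, a, b} \<subseteq> N"
      using T(1) v by (auto simp: W_def)
    moreover from this have "\<forall>e\<in>{v, a, b}. \<forall>f\<in>{v, a, b}. e \<noteq> f \<longrightarrow> (R e f \<longleftrightarrow> c)"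
      using ab(4) sym by auto
    ultimately show ?thesis using ab(3) by (intro exI[of _ "{v, a, b}"]) (cases c; simp)
  next
    case False
    then show ?thesis using T by (intro exI[of _ T]) (cases c; auto simp: W_def)
  qed
qed

text \<open>Pairs are coloured by whether they form \<open>P\<close>. A pair that does not must form
  \<open>Q\<close>, so a triple of one colour is a clique for a single non-collectable
  pattern.\<close>

lemma card_clique_le_5:
  fixes N :: "nat set set"
  assumes "r_pattern r P" "r_pattern r Q" "\<not> collectable P" "\<not> collectable Q" "clique r {P, Q} N"
  shows "card N \<le> 5"
proof (rule ccontr)
  assume "\<not> card N \<le> 5"
  then have six: "card N \<ge> 6" by simp
  define R where "R e f \<longleftrightarrow> forms P e f" for e f :: "nat set"
  have sym: "R a b \<longleftrightarrow> R b a" for a b unfolding R_def by (simp only: insert_commute)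
  have fin: "finite N" using assms(5) by (simp add: clique_def ordered_matching_def)
  from ramsey_3_3[of N R, OF fin six sym] obtain T where T: "T \<subseteq> N" "card T = 3"
    and mono: "(\<forall>a\<in>T. \<forall>b\<in>T. a \<noteq> b \<longrightarrow> R a b) \<or> (\<forall>a\<in>T. \<forall>b\<in>T. a \<noteq> b \<longrightarrow> \<not> R a b)"
    by (elim exE conjE) (rule that; assumption)
  have "clique r {P, Q} T" by (rule clique_subset[OF assms(5) T(1)])
  then have T': "ordered_matching r T"
    "\<And>e f. e \<in> T \<Longrightarrow> f \<in> T \<Longrightarrow> e \<noteq> f \<Longrightarrow> R e f \<or> forms Q e f"
    unfolding clique_def R_def by simp_all
  from mono show False
  proof
    assume R: "\<forall>a\<in>T. \<forall>b\<in>T. a \<noteq> b \<longrightarrow> R a b"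
    have "forms P e f" if "e \<in> T" "f \<in> T" "e \<noteq> f" for e f
      using R that unfolding R_def by blast
    then have "clique r {P} T" using T'(1) by (simp add: clique_def)
    then show False by (rule no_triple_clique[OF assms(1,3) _ T(2)])
  next
    assume R: "\<forall>a\<in>T. \<forall>b\<in>T. a \<noteq> b \<longrightarrow> \<not> R a b"
    have "forms Q e f" if "e \<in> T" "f \<in> T" "e \<noteq> f" for e f
      using T'(2)[OF that] R that by blast
    then have "clique r {Q} T" using T'(1) by (simp add: clique_def)
    then show False by (rule no_triple_clique[OF assms(2,4) _ T(2)])
  qed
qed

lemma pattern_clique:
  assumes "r \<ge> 1" "r_pattern r P"
  shows "clique r {P, Q} (pattern_matching P)" "card (pattern_matching P) = 2"
proof -
  let ?A = "pattern_edge P LA" and ?B = "pattern_edge P LB"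
  have c: "card ?A = r" "card ?B = r" by (simp_all add: card_pattern_edge count_list_letter[OF assms(2)])
  have d: "?A \<inter> ?B = {}" by (auto simp: pattern_edge_def)
  have "?A \<noteq> {}" using c(1) assms(1) by auto
  then have ne: "?A \<noteq> ?B" using d by auto
  then show "card (pattern_matching P) = 2" by (simp add: pattern_matching_def)
  have "forms P ?A ?B"
    unfolding order_isomorphic_def pattern_matching_def
    by (rule exI[of _ "\<lambda>v. v"]) (simp add: strict_mono_on_def bij_betw_def)
  then show "clique r {P, Q} (pattern_matching P)"
    using c d by (auto simp: clique_def ordered_matching_def pattern_matching_def pairwise_insert
        disjnt_def insert_commute)
qed

text \<open>\<open>z\<close> is the largest size of a clique of any kind, independently of the
  random matching. The upper bound then holds for every matching, and only the occurrence of one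
  largest clique is a probabilistic statement.\<close>

lemma not_collectable_clique_number:
  assumes "r \<ge> 1" "r_pattern r P" "r_pattern r Q" "\<not> collectable P" "\<not> collectable Q"
  shows "\<exists>z :: nat. 2 \<le> z \<and> z \<le> 5 \<and> aas r (\<lambda>n M. max_clique_size r {P, Q} M = z)"
proof -
  define Z where "Z = {card N | N :: nat set set. clique r {P, Q} N}"
  define z where "z = Max Z"
  have le5: "y \<le> 5" if "y \<in> Z" for y using that card_clique_le_5[OF assms(2-5)] by (auto simp: Z_def)
  then have fin: "finite Z" by (intro finite_subset[of Z "{..5}"]) auto
  have two: "2 \<in> Z" using pattern_clique(1)[OF assms(1,2), of Q] pattern_clique(2)[OF assms(1,2)] unfolding Z_def by force
  have zZ: "z \<in> Z" unfolding z_def using fin two by (intro Max_in) auto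
  then obtain F :: "nat set set" where F: "clique r {P, Q} F" "card F = z" by (auto simp: Z_def)
  have pat: "r_pattern r R" if "R \<in> {P, Q}" for R using that assms(2,3) by auto
  have "aas r (\<lambda>n M. max_clique_size r {P, Q} M = z)"
  proof (rule aas_mono[OF assms(1) aas_clique_size_ge[OF assms(1) pat F(1)]],
      simp, intro always_eventually allI ballI impI)
    fix n M assume M: "M \<in> matchings r n" and le: "card F \<le> max_clique_size r {P, Q} M"
    obtain N where "N \<subseteq> M" "clique r {P, Q} N" "card N = max_clique_size r {P, Q} M"
      using max_clique_size_witness[OF finite_matching_member[OF M]] .
    then have "max_clique_size r {P, Q} M \<in> Z" by (auto simp: Z_def intro!: exI[of _ N])
    then have "max_clique_size r {P, Q} M \<le> z" unfolding z_def using fin by simp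
    then show "max_clique_size r {P, Q} M = z" using le F(2) by simp
  qed
  moreover have "2 \<le> z" unfolding z_def using fin two by simp
  ultimately show ?thesis using le5[OF zZ] by blast
qed

theorem theorem2p3:
  fixes r :: nat and P Q :: pattern
  assumes "r \<ge> 2" and "r_pattern r P" and "r_pattern r Q" and "P \<noteq> Q"
  shows
    "(harmonious P Q \<longrightarrow>
        (\<exists>c C :: real. 0 < c \<and> c < C \<and>
           aas r (\<lambda>n M. c * real n powr (1 / (real r - 1)) \<le> real (max_clique_size r {P, Q} M) \<and>
                        real (max_clique_size r {P, Q} M) \<le> C * real n powr (1 / (real r - 1))))) \<and>
     (mismatch P Q \<longrightarrow>
        (\<exists>c C :: real. 0 < c \<and> c < C \<and>
           aas r (\<lambda>n M. c * real n powr (1 / real r) \<le> real (max_clique_size r {P, Q} M) \<and>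
                        real (max_clique_size r {P, Q} M) \<le> C * real n powr (1 / real r)))) \<and>
     (\<not> collectable P \<and> \<not> collectable Q \<longrightarrow>
        (\<exists>z :: nat. 2 \<le> z \<and> z \<le> 5 \<and>
           aas r (\<lambda>n M. max_clique_size r {P, Q} M = z)))"
proof (intro conjI impI)
  have r: "r \<ge> 1" "real (r - 1) = real r - 1" using assms(1) by simp_all
  show "\<exists>c C :: real. 0 < c \<and> c < C \<and>
           aas r (\<lambda>n M. c * real n powr (1 / (real r - 1)) \<le> real (max_clique_size r {P, Q} M) \<and>
                        real (max_clique_size r {P, Q} M) \<le> C * real n powr (1 / (real r - 1)))"
    if "harmonious P Q"
    by (rule two_sided_bounds[OF r(1) lower_harmonious[OF assms(1-3) that, unfolded r(2)]
          upper_harmonious[OF assms(1-3) that, unfolded r(2)]]) simp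
  show "\<exists>c C :: real. 0 < c \<and> c < C \<and>
           aas r (\<lambda>n M. c * real n powr (1 / real r) \<le> real (max_clique_size r {P, Q} M) \<and>
                        real (max_clique_size r {P, Q} M) \<le> C * real n powr (1 / real r))"
    if "mismatch P Q"
    using mismatch_bounds[OF r(1) assms(2,3) that] by (intro two_sided_bounds[OF r(1)]) simp_all
  show "\<exists>z :: nat. 2 \<le> z \<and> z \<le> 5 \<and> aas r (\<lambda>n M. max_clique_size r {P, Q} M = z)"
    if "\<not> collectable P \<and> \<not> collectable Q"
    using not_collectable_clique_number[OF r(1) assms(2,3)] that by blast
qed

end
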